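(* Let $\alpha\in(0,2)$, $\eta>0$, and let $\pi^X$ be a probability density on $\mathbb{R}^d$. Suppose the restricted $\alpha$-stable oracle in the stable proximal sampler (parameter $\alpha$, step $\eta$, target $\pi^X$) is implemented inexactly, i.e. there is $\varepsilon_{\mathrm{TV}}>0$ such that $\mathrm{TV}\big(\tilde\rho_k^{X|Y}(\cdot|y),\rho_k^{X|Y}(\cdot|y)\big)\le\varepsilon_{\mathrm{TV}}$ for all $y\in\mathbb{R}^d$ and $k\ge1$, where $\tilde\rho_k^{X|Y}(\cdot|y)$ is the density of the inexact oracle sample (producing the $k$-th iterate) conditioned on $y$ and $\rho_k^{X|Y}(\cdot|y)=\pi^{X|Y}(\cdot|y)$ is that of the exact oracle. Let $\tilde\rho_k^X$ and $\rho_k^X$ be the densities of the $k$-th iterate of the stable proximal sampler with the inexact oracle and with the exact oracle, respectively. Then for all $k\ge0$, $$\mathrm{TV}(\tilde\rho_k^X,\rho_k^X)\le\mathrm{TV}(\tilde\rho_0^X,\rho_0^X)+k\,\varepsilon_{\mathrm{TV}}.$$ Further, suppose $\pi^X$ satisfies the $\alpha$-fractional Poincaré inequality with parameter $C_{\mathrm{FPI}(\alpha)}$ and $\tilde\rho_0^X=\rho_0^X$. Let $\varepsilon>0$ and $K_0=\big(1+C_{\mathrm{FPI}(\alpha)}\eta^{-1}\big)\log\big(\chi^2(\tilde\rho_0^X|\pi^X)/\varepsilon^2\big)$. Then for any $K\ge K_0$, $\mathrm{TV}(\tilde\rho_K^X,\pi^X)\le\varepsilon$ provided $\varepsilon_{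\mathrm{TV}}\le\varepsilon/(2K)$.
   Context: $\mathrm{TV}(\mu,\nu)=\sup_A|\mu(A)-\nu(A)|$ and $\chi^2(\rho|\pi)=\int(\rho/\pi-1)^2\pi\,\mathrm{d}x$. Isotropic $\alpha$-stable density: $p_t^{(\alpha)}(y)=(2\pi)^{-d}\int_{\mathbb{R}^d}e^{-t|\xi|^\alpha}e^{-i\langle\xi,y\rangle}\,\mathrm{d}\xi$ and $p^{(\alpha)}(t;x,y)=p_t^{(\alpha)}(y-x)$. Stable proximal sampler with parameter $\alpha$, step $\eta$, target $\pi^X$: started from $x_0$, at each iteration $k=0,1,\dots$ (i) sample $y_k\mid x_k\sim p^{(\alpha)}(\eta;x_k,\cdot)$; (ii) sample $x_{k+1}\mid y_k$ from the density $\pi^{X|Y}(\cdot|y_k)\propto\pi^X(\cdot)\,p^{(\alpha)}(\eta;\cdot,y_k)$. An oracle that, given $y$, outputs a sample from $\pi^{X|Y}(\cdot|y)$ is the restricted $\alpha$-stable oracle; in the inexact version of the sampler, step (ii) draws $x_{k+1}$ from $\tilde\rho_{k+1}^{X|Y}(\cdot|y_k)$ instead. Fractional Poincaré inequality: for $\vartheta\in(0,2)$, a probability density $\mu$ satisfies the $\vartheta$-fractional Poincaré inequality with parameter $C_{\mathrm{FPI}(\vartheta)}>0$ if $\mathrm{Var}_\mu(\phi)\le C_{\mathrm{FPI}(\vartheta)}\mathcal{E}_\mu^{(\vartheta)}(\phi)$ for every $\phi:\mathbb{R}^d\to\mathbb{R}$ in the domain of $\mathcal{E}_\mu^{(\vartheta)}$,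 where $\mathcal{E}_\mu^{(\vartheta)}(\phi)=c_{d,\vartheta}\iint_{\{x\ne y\}}\frac{(\phi(x)-\phi(y))^2}{|x-y|^{d+\vartheta}}\,\mathrm{d}x\,\mu(y)\,\mathrm{d}y$ and $c_{d,\vartheta}=\frac{2^\vartheta\Gamma((d+\vartheta)/2)}{\pi^{d/2}|\Gamma(-\vartheta/2)|}$. *)

theory Defs
  imports "HOL-Probability.Probability"
begin

text \<open>
  \<open>\<real>\<^sup>d\<close> is an arbitrary type of class \<open>euclidean_space\<close>, with \<open>d = DIM('a)\<close>; all laws
  are measures on its Borel sets.
\<close>

definition prob_density :: "('a::euclidean_space \<Rightarrow> real) \<Rightarrow> bool" where
  "prob_density f \<longleftrightarrow>
     f \<in> borel_measurable borel \<and> (\<forall>x. 0 \<le> f x) \<and> (\<integral>\<^sup>+x. ennreal (f x) \<partial>lborel) = 1"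

definition law_of :: "('a::euclidean_space \<Rightarrow> real) \<Rightarrow> 'a measure" where
  "law_of f = density lborel (\<lambda>x. ennreal (f x))"

definition tv_dist :: "'a::euclidean_space measure \<Rightarrow> 'a measure \<Rightarrow> real" where
  "tv_dist M N = (SUP A\<in>sets borel. \<bar>measure M A - measure N A\<bar>)"

text \<open>
  The guard gives the integrand \<open>(\<rho>/\<pi> - 1)\<^sup>2 \<pi>\<close> its usual value \<open>\<infinity>\<close> on a non-null set where
  \<open>\<pi> = 0 < \<rho>\<close>; without it the convention \<open>x / 0 = 0\<close> would discard that set.
\<close>

definition chi_square :: "('a::euclidean_space \<Rightarrow> real) \<Rightarrow> ('a \<Rightarrow> real) \<Rightarrow> ennreal" where
  "chi_square \<rho> \<pi> =
     (if absolutely_continuous (law_of \<pi>) (law_of \<rho>)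
      then (\<integral>\<^sup>+x. ennreal ((\<rho> x / \<pi> x - 1)\<^sup>2 * \<pi> x) \<partial>lborel)
      else \<infinity>)"

definition ln_ext :: "ennreal \<Rightarrow> ereal" where
  "ln_ext x = (if x = 0 then - \<infinity> else if x = \<infinity> then \<infinity> else ereal (ln (enn2real x)))"

text \<open>
  The inverse Fourier integral below is real, by the symmetry \<open>\<xi> \<mapsto> - \<xi>\<close>, so taking the
  real part loses nothing.
\<close>

definition stable_density :: "real \<Rightarrow> real \<Rightarrow> 'a::euclidean_space \<Rightarrow> real" where
  "stable_density \<alpha> t y =
     Re (complex_of_real (1 / (2 * pi) ^ DIM('a)) *
         (LINT \<xi>|lborel. complex_of_real (exp (- t * norm \<xi> powr \<alpha>)) *
                         exp (- \<i> * complex_of_real (\<xi> \<bullet> y))))"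

definition stable_transition :: "real \<Rightarrow> real \<Rightarrow> 'a::euclidean_space \<Rightarrow> 'a \<Rightarrow> real" where
  "stable_transition \<alpha> t x y = stable_density \<alpha> t (y - x)"

definition restricted_stable_oracle ::
  "real \<Rightarrow> real \<Rightarrow> ('a::euclidean_space \<Rightarrow> real) \<Rightarrow> 'a \<Rightarrow> 'a \<Rightarrow> real" where
  "restricted_stable_oracle \<alpha> \<eta> \<pi> y x =
     \<pi> x * stable_transition \<alpha> \<eta> x y /
     (LINT x'|lborel. \<pi> x' * stable_transition \<alpha> \<eta> x' y)"

text \<open>
  A possibly inexact oracle is a family \<open>q\<close>, where \<open>q k y\<close> is the density given \<open>y\<close> of the
  sample that produces the \<open>k\<close>-th iterate (\<open>k \<ge> 1\<close>; \<open>q 0\<close> is unused).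
\<close>

definition oracle_kernel :: "(nat \<Rightarrow> 'a::euclidean_space \<Rightarrow> 'a \<Rightarrow> real) \<Rightarrow> bool" where
  "oracle_kernel q \<longleftrightarrow>
     (\<forall>k\<ge>1. (\<forall>y. prob_density (q k y)) \<and> (\<lambda>y. law_of (q k y)) \<in> borel \<rightarrow>\<^sub>M prob_algebra borel)"

text \<open>
  Law of the \<open>k\<close>-th iterate \<open>x\<^sub>k\<close>: draw \<open>y\<^sub>k\<close> from the stable kernel at \<open>x\<^sub>k\<close>, then
  \<open>x\<^sub>k\<^sub>+\<^sub>1\<close> from the oracle at \<open>y\<^sub>k\<close>.
\<close>

primrec sampler_law ::
  "real \<Rightarrow> real \<Rightarrow> (nat \<Rightarrow> 'a::euclidean_space \<Rightarrow> 'a \<Rightarrow> real) \<Rightarrow> ('a \<Rightarrow> real) \<Rightarrow> nat \<Rightarrow> 'a measure"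
where
  "sampler_law \<alpha> \<eta> q \<rho>0 0 = law_of \<rho>0"
| "sampler_law \<alpha> \<eta> q \<rho>0 (Suc k) =
     Giry_Monad.bind
       (Giry_Monad.bind (sampler_law \<alpha> \<eta> q \<rho>0 k) (\<lambda>x. law_of (stable_transition \<alpha> \<eta> x)))
       (\<lambda>y. law_of (q (Suc k) y))"

definition fractional_const :: "nat \<Rightarrow> real \<Rightarrow> real" where
  "fractional_const d \<theta> =
     2 powr \<theta> * Gamma ((real d + \<theta>) / 2) / (pi powr (real d / 2) * \<bar>Gamma (- \<theta> / 2)\<bar>)"

definition fractional_energy ::
  "real \<Rightarrow> ('a::euclidean_space \<Rightarrow> real) \<Rightarrow> ('a \<Rightarrow> real) \<Rightarrow> ennreal" where
  "fractional_energy \<theta> \<mu> \<phi> =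
     ennreal (fractional_const DIM('a) \<theta>) *
     (\<integral>\<^sup>+y. (\<integral>\<^sup>+x\<in>{x. x \<noteq> y}.
        ennreal ((\<phi> x - \<phi> y)\<^sup>2 / norm (x - y) powr (real DIM('a) + \<theta>)) \<partial>lborel)
        * ennreal (\<mu> y) \<partial>lborel)"

text \<open>
  The domain of the Dirichlet form is the usual one: \<open>L\<^sup>2(\<mu>)\<close> functions of finite energy.
\<close>

definition fractional_domain ::
  "real \<Rightarrow> ('a::euclidean_space \<Rightarrow> real) \<Rightarrow> ('a \<Rightarrow> real) set" where
  "fractional_domain \<theta> \<mu> =
     {\<phi> \<in> borel_measurable borel.
        integrable (law_of \<mu>) (\<lambda>x. (\<phi> x)\<^sup>2) \<and> fractional_energy \<theta> \<mu> \<phi> < \<infinity>}"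

definition fractional_poincare :: "real \<Rightarrow> ('a::euclidean_space \<Rightarrow> real) \<Rightarrow> real \<Rightarrow> bool" where
  "fractional_poincare \<theta> \<mu> C \<longleftrightarrow>
     C > 0 \<and>
     (\<forall>\<phi>\<in>fractional_domain \<theta> \<mu>.
        ennreal (prob_space.variance (law_of \<mu>) \<phi>) \<le> ennreal C * fractional_energy \<theta> \<mu> \<phi>)"

end

theory Submission
  imports Defs "HOL-Real_Asymp.Real_Asymp"
begin

text \<open>
  One iteration applies two Markov kernels, which contract total variation, and the exact and inexact oracles
  differ by at most \<open>\<epsilon>TV\<close>; this gives the first bound.

  For the second, let \<open>P\<close> be convolution with the stable density \<open>p\<close> at time \<open>\<eta>\<close>. The function
  \<open>exp (- \<eta> |\<xi>| powr \<alpha>)\<close> is the limit of the \<open>n\<close>-th powers of the Fourier transforms of Gaussian mixtures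
  \<open>\<mu>\<^sub>n\<close> for which \<open>n \<mu>\<^sub>n\<close> has a density tending to \<open>\<eta> c / |z| powr (d + \<alpha>)\<close>. For independent \<open>Z\<^sub>i\<close> with law \<open>\<mu>\<^sub>n\<close>,
  the variance of \<open>g (x + Z\<^sub>1 + \<dots> + Z\<^sub>n)\<close> is at least the sum of the variances of its conditional expectations given
  a single \<open>Z\<^sub>i\<close>, so in the limit \<open>P (g\<^sup>2) - (P g)\<^sup>2\<close> at \<open>x\<close> is at least
  \<open>\<eta> c \<integral> (P g (x + z) - P g x)\<^sup>2 / |z| powr (d + \<alpha>) dz\<close>. Integrating against \<open>\<pi>X\<close> and applying the fractional Poincare
  inequality to \<open>P g\<close> yields \<open>(1 + \<eta> / C) Var (P g) \<le> Var g\<close>. Hence every exact iteration divides the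
  chi-square divergence by at least \<open>1 + \<eta> / C\<close>, and total variation is at most half its square root.
\<close>

section \<open>Gaussian integrals\<close>

text \<open>The usual route differentiates the chi-square divergence along the fractional heat flow.
  A static variance inequality for one step replaces it here, so that neither a semigroup nor a
  generator has to be built. Gaussian mixtures come from subordination: with
  \<open>b = \<alpha> / 2\<close>, \<open>\<lambda> powr b\<close> is an integral of
  \<open>1 - exp (- \<lambda> / u)\<close> against a multiple of \<open>u powr (b - 1) du\<close>,
  and the cutoff \<open>u \<le> U\<close> leaves a finite measure that can be normalised. The powers
  of the transforms are multiplied by \<open>exp (- |\<xi>|\<^sup>2 / v)\<close>: this gives a
  dominating function that does not depend on \<open>n\<close>, and the zeroth power becomes the
  transform of a Gaussian density. Hence there are two limits, \<open>n\<close> to infinity at fixed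
  \<open>v\<close> and then \<open>v\<close> to infinity. All decay is gained in the oracle step;
  drawing \<open>y\<close> is only shown not to increase the divergence. The constant in
  \<open>K\<^sub>0\<close> reflects \<open>ln (1 + r) \<ge> 1 / (1 + 1 / r)\<close> for
  \<open>r = \<eta> / C\<close>. Half of \<open>\<epsilon>\<close> pays for the inexact oracle over
  \<open>K\<close> iterations, the other half for the distance of the exact iterate to the
  target.\<close>

lemma integral_lborel_affine:
  fixes f :: "'a::euclidean_space \<Rightarrow> 'b::{banach,second_countable_topology}"
  assumes [measurable]: "f \<in> borel_measurable borel" and c: "c \<noteq> 0"
  shows "(\<integral>x. f x \<partial>lborel) = (\<bar>c\<bar> ^ DIM('a)) *\<^sub>R (\<integral>x. f (t + c *\<^sub>R x) \<partial>lborel)"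
  by (subst lborel_affine[OF c, of t]) (simp add: integral_density integral_distr)

lemma nn_integral_lborel_affine:
  fixes f :: "'a::euclidean_space \<Rightarrow> ennreal"
  assumes [measurable]: "f \<in> borel_measurable borel" and c: "c \<noteq> 0"
  shows "(\<integral>\<^sup>+x. f x \<partial>lborel) = ennreal (\<bar>c\<bar> ^ DIM('a)) * (\<integral>\<^sup>+x. f (t + c *\<^sub>R x) \<partial>lborel)"
  by (subst lborel_affine[OF c, of t])
     (simp add: nn_integral_density nn_integral_distr nn_integral_cmult)

lemma integrable_lborel_affine:
  fixes f :: "'a::euclidean_space \<Rightarrow> 'b::{banach,second_countable_topology}"
  assumes f: "integrable lborel f" and c: "c \<noteq> 0"
  shows "integrable lborel (\<lambda>x. f (t + c *\<^sub>R x))"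
  using f f[THEN borel_measurable_integrable] unfolding integrable_iff_bounded
  by (subst (asm) nn_integral_lborel_affine[where c=c and t=t])
     (use c in \<open>auto simp: ennreal_mult_less_top\<close>)

lemma nn_integral_lborel_translate:
  fixes f :: "'a::euclidean_space \<Rightarrow> ennreal"
  assumes "f \<in> borel_measurable borel"
  shows "(\<integral>\<^sup>+x. f (t + x) \<partial>lborel) = (\<integral>\<^sup>+x. f x \<partial>lborel)"
  using nn_integral_lborel_affine[OF assms, of 1 t] by simp

lemma nn_integral_lborel_reflect:
  fixes f :: "'a::euclidean_space \<Rightarrow> ennreal"
  assumes "f \<in> borel_measurable borel"
  shows "(\<integral>\<^sup>+x. f (t - x) \<partial>lborel) = (\<integral>\<^sup>+x. f x \<partial>lborel)"
  using nn_integral_lborel_affine[OF assms, of "-1" t] by simp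

lemma integral_lborel_translate:
  fixes f :: "'a::euclidean_space \<Rightarrow> real"
  assumes "f \<in> borel_measurable borel"
  shows "(\<integral>x. f (t + x) \<partial>lborel) = (\<integral>x. f x \<partial>lborel)"
  using integral_lborel_affine[OF assms, of 1 t] by simp

lemma integral_lborel_reflect:
  fixes f :: "'a::euclidean_space \<Rightarrow> real"
  assumes "f \<in> borel_measurable borel"
  shows "(\<integral>x. f (t - x) \<partial>lborel) = (\<integral>x. f x \<partial>lborel)"
  using integral_lborel_affine[OF assms, of "-1" t] by simp

text \<open>Scaling by \<open>c\<close> with \<open>c\<^sup>2 = 2 * a\<close> turns
  \<open>exp (- a * x\<^sup>2)\<close> into a multiple of the standard normal density, whose
  characteristic function is known.\<close>

lemma gaussian_iexp_real:
  fixes a t :: real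
  assumes a: "0 < a"
  shows "has_bochner_integral lborel (\<lambda>x. complex_of_real (exp (- a * x\<^sup>2)) * iexp (t * x))
           (complex_of_real (sqrt (pi / a) * exp (- t\<^sup>2 / (4 * a))))"
proof -
  define c where "c = sqrt (2 * a)"
  have c: "c > 0" "c\<^sup>2 = 2 * a" using a by (auto simp: c_def)
  interpret N: real_distribution std_normal_distribution by (rule real_dist_normal_dist)
  have c0: "c \<noteq> 0" using c by simp
  have i0: "integrable std_normal_distribution (\<lambda>x. iexp ((t / c) * x))"
    by (rule N.integrable_iexp) (auto simp del: of_real_mult of_real_divide)
  then have i1: "integrable lborel (\<lambda>x. std_normal_density x *\<^sub>R iexp ((t / c) * x))"
    by (subst (asm) integrable_density) auto
  have v1: "(\<integral>x. std_normal_density x *\<^sub>R iexp ((t / c) * x) \<partial>lborel) = complex_of_real (exp (- ((t / c)\<^sup>2) / 2))"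
    using fun_cong[OF char_std_normal_distribution, of "t / c"]
    unfolding char_def by (subst (asm) integral_density) auto
  have hb: "has_bochner_integral lborel (\<lambda>x. std_normal_density x *\<^sub>R iexp ((t / c) * x)) (complex_of_real (exp (- ((t / c)\<^sup>2) / 2)))"
    using i1 v1 by (simp add: has_bochner_integral_iff)

  define F where "F = (\<lambda>x. std_normal_density x *\<^sub>R iexp ((t / c) * x))"
  define V where "V = complex_of_real (exp (- ((t / c)\<^sup>2) / 2))"
  have hb': "has_bochner_integral lborel F V" using hb by (simp only: F_def V_def)
  have "has_bochner_integral lborel (\<lambda>x. F (0 + c * x)) (V /\<^sub>R \<bar>c\<bar>)"
    using hb' lborel_has_bochner_integral_real_affine_iff[OF c0, of F V 0] by (rule iffD1[rotated])
  then have sc: "has_bochner_integral lborel (\<lambda>x. sqrt (2 * pi) *\<^sub>R F (c * x)) (sqrt (2*pi) *\<^sub>R (V /\<^sub>R \<bar>c\<bar>))"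
    by (intro has_bochner_integral_scaleR_right) simp
  have fx: "sqrt (2 * pi) *\<^sub>R F (c * x) = complex_of_real (exp (- a * x\<^sup>2)) * iexp (t * x)" for x
  proof -
    have "sqrt (2 * pi) * std_normal_density (c * x) = exp (- a * x\<^sup>2)"
    proof -
      have "- (c * x)\<^sup>2 / 2 = - a * x\<^sup>2" unfolding power_mult_distrib c(2) by simp
      moreover have "sqrt (2 * pi) * (1 / sqrt (2 * pi) * e) = e" for e by simp
      ultimately show ?thesis unfolding std_normal_density_def by (simp only:)
    qed
    moreover have "(t / c) * (c * x) = t * x" using c0 by simp
    ultimately show ?thesis unfolding F_def scaleR_scaleR by (simp only: scaleR_conv_of_real)
  qed
  have "sqrt (2 * pi) / c = sqrt (pi / a)"
    unfolding c_def real_sqrt_divide[symmetric] by simp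
  moreover have tc: "(t / c)\<^sup>2 / 2 = t\<^sup>2 / (4 * a)"
    using c(2) by (simp add: power_divide)
  have "exp (- (t / c)\<^sup>2 / 2) = exp (- t\<^sup>2 / (4 * a))"
    unfolding minus_divide_left[symmetric] tc ..
  ultimately have V: "sqrt (2*pi) *\<^sub>R (V /\<^sub>R \<bar>c\<bar>) = complex_of_real (sqrt (pi / a) * exp (- t\<^sup>2 / (4 * a)))"
    unfolding V_def abs_of_pos[OF c(1)] scaleR_conv_of_real of_real_mult[symmetric] divide_inverse
    by (metis mult.assoc)
  show ?thesis using sc unfolding fx V .
qed

text \<open>The Gaussian and the complex exponential both split over the coordinates, so
  \<open>lborel\<close> as a product measure reduces the claim to \<open>gaussian_iexp_real\<close>.
  The cosine alone does not split; it is recovered as a real part at the end.\<close>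

lemma gaussian_fourier:
  fixes y :: "'a::euclidean_space" and a :: real
  assumes a: "0 < a"
  shows integrable_gaussian: "integrable lborel (\<lambda>x::'a. exp (- a * (norm x)\<^sup>2))"
    and gaussian_cos_integral: "(\<integral>x. exp (- a * (norm x)\<^sup>2) * cos (x \<bullet> y) \<partial>lborel)
           = (pi / a) powr (DIM('a) / 2) * exp (- (norm y)\<^sup>2 / (4 * a))"
proof -
  let ?f = "\<lambda>(y::'a) b x. complex_of_real (exp (- a * x\<^sup>2)) * iexp ((y \<bullet> b) * x)"
  interpret P: product_sigma_finite "\<lambda>b::'a. lborel :: real measure" by standard
  have norm2: "(norm x)\<^sup>2 = (\<Sum>b\<in>Basis. (x \<bullet> b)\<^sup>2)" for x :: 'a
    unfolding power2_norm_eq_inner by (subst euclidean_inner) (simp add: power2_eq_square)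
  have eq: "(\<Prod>b\<in>Basis. ?f y b (x \<bullet> b)) = complex_of_real (exp (- a * (norm x)\<^sup>2)) * iexp (x \<bullet> y)" for x y :: 'a
  proof -
    have "(\<Prod>b\<in>Basis. ?f y b (x \<bullet> b)) = (\<Prod>b\<in>Basis. exp (complex_of_real (- a * (x \<bullet> b)\<^sup>2) + \<i> * complex_of_real ((y \<bullet> b) * (x \<bullet> b))))"
      unfolding exp_add exp_of_real by (simp only: of_real_mult)
    also have "\<dots> = exp (\<Sum>b\<in>Basis. (complex_of_real (- a * (x \<bullet> b)\<^sup>2) + \<i> * complex_of_real ((y \<bullet> b) * (x \<bullet> b))))"
      by (simp add: exp_sum)
    also have "(\<Sum>b\<in>Basis. (complex_of_real (- a * (x \<bullet> b)\<^sup>2) + \<i> * complex_of_real ((y \<bullet> b) * (x \<bullet> b)))) =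
       complex_of_real (\<Sum>b\<in>Basis. - a * (x \<bullet> b)\<^sup>2) + \<i> * complex_of_real (\<Sum>b\<in>Basis. (y \<bullet> b) * (x \<bullet> b))"
      unfolding sum.distrib of_real_sum sum_distrib_left by (rule refl)
    also have "(\<Sum>b\<in>Basis. - a * (x \<bullet> b)\<^sup>2) = - a * (norm x)\<^sup>2"
      by (simp add: norm2 sum_distrib_left)
    also have "(\<Sum>b\<in>Basis. (y \<bullet> b) * (x \<bullet> b)) = x \<bullet> y"
      by (subst euclidean_inner) (simp add: mult.commute)
    finally show ?thesis by (simp only: exp_add exp_of_real)
  qed
  have int1: "integrable lborel (?f y b)" for y b
    using gaussian_iexp_real[OF a, of "y \<bullet> b"] by (simp add: has_bochner_integral_iff)
  have val1: "(\<integral>x. ?f y b x \<partial>lborel) = complex_of_real (sqrt (pi / a) * exp (- (y \<bullet> b)\<^sup>2 / (4 * a)))" for b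
    using gaussian_iexp_real[OF a, of "y \<bullet> b"] by (simp add: has_bochner_integral_iff)
  have int: "integrable lborel (\<lambda>x. complex_of_real (exp (- a * (norm x)\<^sup>2)) * iexp (x \<bullet> y))" for y :: 'a
  proof -
    have "integrable (\<Pi>\<^sub>M b\<in>Basis. lborel) (\<lambda>g. \<Prod>b\<in>Basis. ?f y b (g b))"
      by (rule P.product_integrable_prod) (use int1 in auto)
    then have "integrable lborel (\<lambda>x. \<Prod>b\<in>Basis. ?f y b (x \<bullet> b))"
      by (subst lborel_eq) (simp add: integrable_distr_eq)
    then show ?thesis unfolding eq .
  qed
  have "(\<integral>x. complex_of_real (exp (- a * (norm x)\<^sup>2)) * iexp (x \<bullet> y) \<partial>lborel) = (\<integral>x. (\<Prod>b\<in>Basis. ?f y b (x \<bullet> b)) \<partial>lborel)"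
    unfolding eq ..
  also have "\<dots> = (\<integral>g. (\<Prod>b\<in>Basis. ?f y b (g b)) \<partial>(\<Pi>\<^sub>M b\<in>Basis. lborel))"
    by (subst lborel_eq) (simp add: integral_distr)
  also have "\<dots> = (\<Prod>b\<in>Basis. complex_of_real (sqrt (pi / a) * exp (- (y \<bullet> b)\<^sup>2 / (4 * a))))"
    by (subst P.product_integral_prod) (use int1 val1 in auto)
  also have "\<dots> = complex_of_real (\<Prod>b\<in>Basis. (sqrt (pi / a) * exp (- (y \<bullet> b)\<^sup>2 / (4 * a))))"
    by simp
  also have "(\<Prod>b\<in>Basis. (sqrt (pi / a) * exp (- (y \<bullet> b)\<^sup>2 / (4 * a)))) = (pi / a) powr (DIM('a) / 2) * exp (- (norm y)\<^sup>2 / (4 * a))"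
  proof -
    have "sqrt (pi / a) ^ DIM('a) = (pi / a) powr (DIM('a) / 2)"
      using a by (simp add: powr_half_sqrt[symmetric] powr_powr powr_realpow[symmetric])
    moreover have "(\<Prod>b\<in>Basis. exp (- (y \<bullet> b)\<^sup>2 / (4 * a))) = exp (- (norm y)\<^sup>2 / (4 * a))"
      unfolding exp_sum[OF finite_Basis, symmetric] norm2 by (simp only: sum_negf[symmetric] sum_divide_distrib)
    ultimately show ?thesis unfolding prod.distrib prod_constant by (simp only:)
  qed
  finally have *: "(\<integral>x. complex_of_real (exp (- a * (norm x)\<^sup>2)) * iexp (x \<bullet> y) \<partial>lborel) =
      complex_of_real ((pi / a) powr (DIM('a) / 2) * exp (- (norm y)\<^sup>2 / (4 * a)))" .
  from int[of 0] show "integrable lborel (\<lambda>x::'a. exp (- a * (norm x)\<^sup>2))"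
    by (auto simp flip: complex_of_real_integrable_eq)
  have "(\<integral>x. exp (- a * (norm x)\<^sup>2) * cos (x \<bullet> y) \<partial>lborel) = Re (\<integral>x. complex_of_real (exp (- a * (norm x)\<^sup>2)) * iexp (x \<bullet> y) \<partial>lborel)"
    by (subst integral_Re[symmetric, OF int]) (simp add: cis_conv_exp[symmetric])
  then show "(\<integral>x. exp (- a * (norm x)\<^sup>2) * cos (x \<bullet> y) \<partial>lborel)
           = (pi / a) powr (DIM('a) / 2) * exp (- (norm y)\<^sup>2 / (4 * a))"
    unfolding * by simp
qed

section \<open>Power and Gamma integrals on the half-line\<close>

lemma nn_integral_powr_Icc:
  fixes a c :: real
  assumes "a > 0" "c \<ge> 0"
  shows "(\<integral>\<^sup>+u. ennreal (u powr (a - 1)) * indicator {0..c} u \<partial>lborel) = ennreal (c powr a / a)"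
proof -
  have "((\<lambda>x. x powr (a - 1)) has_integral (c powr (a - 1 + 1) / (a - 1 + 1))) {0..c}"
    by (rule has_integral_powr_from_0) (use assms in auto)
  then have "integral\<^sup>N lborel (\<lambda>x. indicator {0..c} x * (x powr (a - 1))) = c powr a / a"
    by (intro nn_integral_has_integral_lebesgue) auto
  then show ?thesis by (simp add: ennreal_mult' ennreal_indicator mult.commute)
qed

lemma nn_integral_Gamma:
  fixes a c :: real
  assumes a: "a > 0" and c: "c > 0"
  shows "(\<integral>\<^sup>+u. ennreal (u powr (a - 1) * exp (- c * u)) * indicator {0..} u \<partial>lborel) = ennreal (Gamma a / c powr a)"
proof -
  have "integral\<^sup>N lborel (\<lambda>x. indicator {0..} x * (x powr (a - 1) / exp x)) = Gamma a"
    by (intro nn_integral_has_integral_lebesgue Gamma_integral_real a) auto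
  moreover have "(\<lambda>x. ennreal (indicator {0..} x * (x powr (a - 1) / exp x))) = (\<lambda>x. ennreal (x powr (a - 1) / exp x) * indicator {0..} x)"
    by (auto simp: indicator_def)
  ultimately have "ennreal (Gamma a) = (\<integral>\<^sup>+x. ennreal (x powr (a - 1) / exp x) * indicator {0..} x \<partial>lborel)"
    by simp
  also have "\<dots> = ennreal \<bar>c\<bar> * (\<integral>\<^sup>+x. ennreal ((0 + c * x) powr (a - 1) / exp (0 + c * x)) * indicator {0..} (0 + c * x) \<partial>lborel)"
    by (rule nn_integral_real_affine) (use c in auto)
  also have "(\<integral>\<^sup>+x. ennreal ((0 + c * x) powr (a - 1) / exp (0 + c * x)) * indicator {0..} (0 + c * x) \<partial>lborel)
     = (\<integral>\<^sup>+x. ennreal (c powr (a - 1)) * (ennreal (x powr (a - 1) * exp (- c * x)) * indicator {0..} x) \<partial>lborel)"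
    using c by (intro nn_integral_cong)
      (auto simp: indicator_def powr_mult exp_minus ennreal_mult'[symmetric] field_simps zero_le_mult_iff)
  also have "\<dots> = ennreal (c powr (a - 1)) * (\<integral>\<^sup>+x. ennreal (x powr (a - 1) * exp (- c * x)) * indicator {0..} x \<partial>lborel)"
    by (rule nn_integral_cmult) auto
  finally have e: "ennreal (Gamma a) = ennreal (c powr a) * (\<integral>\<^sup>+x. ennreal (x powr (a - 1) * exp (- c * x)) * indicator {0..} x \<partial>lborel)" (is "_ = _ * ?I")
    using c by (simp add: mult.assoc[symmetric] ennreal_mult'[symmetric] powr_diff)
  have "ennreal (Gamma a / c powr a) = ennreal (1 / c powr a) * ennreal (Gamma a)"
    using c by (simp add: ennreal_mult'[symmetric])
  also have "\<dots> = ?I"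
    unfolding e mult.assoc[symmetric] using c by (simp add: ennreal_mult'[symmetric])
  finally show ?thesis ..
qed

lemma nn_integral_exp_Icc:
  assumes c: "(c::real) \<ge> 0"
  shows "(\<integral>\<^sup>+v. ennreal (exp (- v)) * indicator {0..c} v \<partial>lborel) = ennreal (1 - exp (- c))"
proof -
  have "(\<integral>\<^sup>+v. ennreal (exp (- v)) * indicator {0..c} v \<partial>lborel) = ennreal ((- exp (- c)) - (- exp (- 0)))"
    by (rule nn_integral_FTC_Icc) (use c in \<open>auto intro!: derivative_eq_intros\<close>)
  then show ?thesis by simp
qed

text \<open>The subordination formula. \<open>1 - exp (- (l / u))\<close> is the integral of
  \<open>exp (- v)\<close> over \<open>0 \<le> v \<le> l / u\<close>; exchanging the order on the
  region \<open>u * v \<le> l\<close> leaves \<open>(l / v) powr b / b\<close> inside and the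
  integral for \<open>Gamma (1 - b)\<close> outside, which converges because
  \<open>b < 1\<close>.\<close>

lemma nn_integral_one_minus_exp_powr:
  fixes b l :: real
  assumes b: "0 < b" "b < 1" and l: "0 \<le> l"
  shows "(\<integral>\<^sup>+u. ennreal ((1 - exp (- (l / u))) * u powr (b - 1)) * indicator {0<..} u \<partial>lborel)
           = ennreal (l powr b * Gamma (1 - b) / b)"
proof -
  let ?h = "\<lambda>u v::real. ennreal (exp (- v)) * indicator {0..} v * (ennreal (u powr (b - 1)) * indicator {0<..} u) * indicator {..l} (u * v)"
  have "(\<integral>\<^sup>+u. ennreal ((1 - exp (- (l / u))) * u powr (b - 1)) * indicator {0<..} u \<partial>lborel)
      = (\<integral>\<^sup>+u. \<integral>\<^sup>+v. ?h u v \<partial>lborel \<partial>lborel)"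
  proof (intro nn_integral_cong)
    fix u :: real
    show "ennreal ((1 - exp (- (l / u))) * u powr (b - 1)) * indicator {0<..} u = (\<integral>\<^sup>+v. ?h u v \<partial>lborel)"
    proof (cases "u > 0")
      case True
      then have "0 \<le> l / u" using l by simp
      have "(\<integral>\<^sup>+v. ?h u v \<partial>lborel) = (\<integral>\<^sup>+v. ennreal (u powr (b - 1)) * (ennreal (exp (- v)) * indicator {0..l / u} v) \<partial>lborel)"
        using True by (intro nn_integral_cong) (auto simp: indicator_def field_simps)
      also have "\<dots> = ennreal (u powr (b - 1)) * ennreal (1 - exp (- (l / u)))"
        by (subst nn_integral_cmult) (auto simp: nn_integral_exp_Icc[OF \<open>0 \<le> l / u\<close>])
      finally show ?thesis using True \<open>0 \<le> l / u\<close> by (simp add: ennreal_mult'[symmetric] mult.commute)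
    qed simp
  qed
  also have "\<dots> = (\<integral>\<^sup>+v. \<integral>\<^sup>+u. ?h u v \<partial>lborel \<partial>lborel)"
    by (rule lborel_pair.Fubini'[symmetric]) measurable
  also have "\<dots> = (\<integral>\<^sup>+v. ennreal (l powr b / b) * (ennreal (v powr ((1 - b) - 1) * exp (- 1 * v)) * indicator {0..} v) \<partial>lborel)"
  proof (intro nn_integral_cong_AE)
    \<comment> \<open>At \<open>v = 0\<close> the inner integral is infinite while the right side is
      0, as \<open>0 powr _ = 0\<close>; the two sides agree only almost everywhere.\<close>
    show "AE v in lborel. (\<integral>\<^sup>+u. ?h u v \<partial>lborel) = ennreal (l powr b / b) * (ennreal (v powr ((1 - b) - 1) * exp (- 1 * v)) * indicator {0..} v)"
      using AE_lborel_singleton[of 0]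
    proof eventually_elim
      fix v :: real assume v: "v \<noteq> 0"
      show "(\<integral>\<^sup>+u. ?h u v \<partial>lborel) = ennreal (l powr b / b) * (ennreal (v powr ((1 - b) - 1) * exp (- 1 * v)) * indicator {0..} v)"
      proof (cases "v > 0")
        case True
        then have lv: "0 \<le> l / v" using l by simp
        have "(\<integral>\<^sup>+u. ?h u v \<partial>lborel) = (\<integral>\<^sup>+u. ennreal (exp (- v)) * (ennreal (u powr (b - 1)) * indicator {0..l / v} u) \<partial>lborel)"
          using True by (intro nn_integral_cong) (auto simp: indicator_def field_simps)
        also have "\<dots> = ennreal (exp (- v)) * ennreal ((l / v) powr b / b)"
          by (subst nn_integral_cmult) (auto simp: nn_integral_powr_Icc[OF b(1) lv])
        also have "(l / v) powr b = l powr b * v powr (- b)"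
          using True l by (simp add: powr_divide powr_minus_divide)
        finally show ?thesis using True b by (simp add: ennreal_mult'[symmetric] mult_ac)
      next
        case False
        with v have "v < 0" by simp
        then show ?thesis by simp
      qed
    qed
  qed
  also have "\<dots> = ennreal (l powr b / b) * ennreal (Gamma (1 - b) / 1 powr (1 - b))"
    by (subst nn_integral_cmult, measurable, subst nn_integral_Gamma) (use b in auto)
  finally show ?thesis using b by (simp add: ennreal_mult'[symmetric])
qed

section \<open>Mixtures of Gaussians\<close>

text \<open>The heat kernel at time \<open>1 / u\<close>.\<close>

definition inv_heat :: "real \<Rightarrow> 'a::euclidean_space \<Rightarrow> real" where
  "inv_heat u z = (u / (4 * pi)) powr (DIM('a) / 2) * exp (- (u / 4) * (norm z)\<^sup>2)"

lemma inv_heat_measurable[measurable]: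
  "(\<lambda>(u, z). inv_heat u z) \<in> borel_measurable (borel \<Otimes>\<^sub>M borel)"
  unfolding inv_heat_def by measurable

lemma inv_heat_nonneg: "0 \<le> inv_heat u z"
  by (simp add: inv_heat_def)

lemma inv_heat_uminus: "inv_heat u (- z) = inv_heat u z"
  by (simp add: inv_heat_def)

text \<open>Here lies the use of the inverse time: for \<open>u \<le> U\<close> the kernels are
  uniformly bounded, because times below \<open>1 / U\<close>, where they concentrate, are
  excluded.\<close>

lemma inv_heat_le:
  fixes z :: "'a::euclidean_space"
  assumes "0 \<le> u" "u \<le> U"
  shows "inv_heat u z \<le> (U / (4 * pi)) powr (DIM('a) / 2)"
proof -
  have "inv_heat u z \<le> (U / (4 * pi)) powr (DIM('a) / 2) * 1"
    unfolding inv_heat_def using assms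
    by (intro mult_mono powr_mono2 divide_right_mono) (auto simp: mult_nonneg_nonneg)
  then show ?thesis by simp
qed

lemma integrable_inv_heat: "0 < u \<Longrightarrow> integrable lborel (inv_heat u)"
  unfolding inv_heat_def[abs_def] using integrable_gaussian[of "u / 4"]
  by (intro integrable_mult_right) simp

lemma inv_heat_fourier:
  fixes y :: "'a::euclidean_space"
  assumes u: "0 < u"
  shows "(\<integral>z. inv_heat u z * cos (z \<bullet> y) \<partial>lborel) = exp (- ((norm y)\<^sup>2 / u))"
proof -
  have "(\<integral>z. inv_heat u z * cos (z \<bullet> y) \<partial>lborel)
      = (u / (4 * pi)) powr (DIM('a) / 2) * (\<integral>z. exp (- (u / 4) * (norm z)\<^sup>2) * cos (z \<bullet> y) \<partial>lborel)"
    unfolding inv_heat_def mult.assoc by (rule integral_mult_right_zero)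
  also have "\<dots> = ((u / (4 * pi)) powr (DIM('a) / 2) * (pi / (u / 4)) powr (DIM('a) / 2)) * exp (- (norm y)\<^sup>2 / (4 * (u / 4)))"
    using u by (subst gaussian_cos_integral) auto
  also have "(u / (4 * pi)) powr (DIM('a) / 2) * (pi / (u / 4)) powr (DIM('a) / 2) = 1"
    using u by (subst powr_mult[symmetric]) auto
  finally show ?thesis by simp
qed

lemma nn_integral_inv_heat:
  assumes u: "0 < u"
  shows "(\<integral>\<^sup>+z. ennreal (inv_heat u (z::'a::euclidean_space)) \<partial>lborel) = 1"
  using inv_heat_fourier[OF u, of "0::'a"]
  by (subst nn_integral_eq_integral[OF integrable_inv_heat[OF u]]) (auto simp: inv_heat_nonneg)

text \<open>The Gaussian formula at \<open>a = 1 / u\<close>, read backwards: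
  \<open>(2 * pi) powr (- d)\<close> times \<open>(pi * u) powr (d / 2)\<close> is
  \<open>(u / (4 * pi)) powr (d / 2)\<close>.\<close>

lemma inv_heat_inverse_fourier:
  fixes y :: "'a::euclidean_space"
  assumes u: "0 < u"
  shows "inv_heat u y = (1 / (2 * pi) ^ DIM('a)) * (\<integral>x. exp (- (1 / u) * (norm x)\<^sup>2) * cos (x \<bullet> y) \<partial>lborel)"
proof -
  have "(1 / (2 * pi) ^ DIM('a)) = (1 / (2 * pi)\<^sup>2) powr (DIM('a) / 2)"
  proof -
    have "(1 / (2 * pi)\<^sup>2) powr (DIM('a) / 2) = ((1 / (2 * pi)) powr 2) powr (DIM('a) / 2)"
      by (simp add: power_divide)
    also have "\<dots> = (1 / (2 * pi)) powr DIM('a)"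
      by (simp only: powr_powr) simp
    also have "\<dots> = (1 / (2 * pi)) ^ DIM('a)"
      by (rule powr_realpow) simp
    finally show ?thesis by (simp add: power_one_over)
  qed
  then have "(1 / (2 * pi) ^ DIM('a)) * (pi / (1 / u)) powr (DIM('a) / 2) = (1 / (2 * pi)\<^sup>2 * (pi / (1 / u))) powr (DIM('a) / 2)"
    using u by (simp only: powr_mult)
  also have "1 / (2 * pi)\<^sup>2 * (pi / (1 / u)) = u / (4 * pi)"
    using u by (simp add: power2_eq_square)
  finally have *: "(1 / (2 * pi) ^ DIM('a)) * (pi / (1 / u)) powr (DIM('a) / 2) = (u / (4 * pi)) powr (DIM('a) / 2)" .
  have "(\<integral>x. exp (- (1 / u) * (norm x)\<^sup>2) * cos (x \<bullet> y) \<partial>lborel) = (pi / (1 / u)) powr (DIM('a) / 2) * exp (- (norm y)\<^sup>2 / (4 * (1 / u)))"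
    by (rule gaussian_cos_integral) (use u in simp)
  then show ?thesis
    unfolding inv_heat_def *[symmetric] by (simp add: mult.commute[of u])
qed

text \<open>Under this law the time \<open>1 / u\<close> has a Pareto distribution with exponent
  \<open>b\<close> and minimum \<open>1 / U\<close>: the law of a jump of the
  \<open>b\<close>-stable subordinator, given that its size exceeds \<open>1 / U\<close>.\<close>

definition mix_weight :: "real \<Rightarrow> real \<Rightarrow> real measure" where
  "mix_weight b U = density lborel (\<lambda>u. ennreal (b * U powr (- b) * u powr (b - 1)) * indicator {0..U} u)"

definition mix_kernel :: "real \<Rightarrow> real \<Rightarrow> 'a::euclidean_space \<Rightarrow> real" where
  "mix_kernel b U z = (\<integral>u. inv_heat u z \<partial>mix_weight b U)"

text \<open>The argument \<open>l\<close> stands for the squared norm of a frequency, since the heat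
  kernel at time \<open>1 / u\<close> has the transform
  \<open>exp (- ((norm y)\<^sup>2 / u))\<close>.\<close>

definition mix_symbol :: "real \<Rightarrow> real \<Rightarrow> real \<Rightarrow> real" where
  "mix_symbol b U l = (\<integral>u. exp (- (l / u)) \<partial>mix_weight b U)"

lemma sets_mix_weight[measurable_cong, simp]: "sets (mix_weight b U) = sets borel"
  by (simp add: mix_weight_def)

context
  fixes b U :: real
  assumes b: "0 < b" "b < 1" and U: "0 < U"
begin

lemma prob_space_mix_weight: "prob_space (mix_weight b U)"
proof
  have "emeasure (mix_weight b U) (space (mix_weight b U)) 
     = (\<integral>\<^sup>+u. ennreal (b * U powr (- b)) * (ennreal (u powr (b - 1)) * indicator {0..U} u) \<partial>lborel)"
    using b by (simp add: mix_weight_def emeasure_density ennreal_mult' mult.assoc)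
  also have "\<dots> = ennreal (b * U powr (- b)) * ennreal (U powr b / b)"
    by (subst nn_integral_cmult) (use b U in \<open>auto simp: nn_integral_powr_Icc\<close>)
  also have "\<dots> = 1"
    using b U by (simp add: ennreal_mult'[symmetric] powr_minus)
  finally show "emeasure (mix_weight b U) (space (mix_weight b U)) = 1" .
qed

interpretation W: prob_space "mix_weight b U" by (rule prob_space_mix_weight)

lemma AE_mix_weight: "AE u in mix_weight b U. 0 < u \<and> u \<le> U"
  unfolding mix_weight_def
  \<comment> \<open>At \<open>u = 0\<close> the density vanishes because
    \<open>0 powr (b - 1) = 0\<close>, so the claim holds at every point of positive
    density.\<close>
  by (subst AE_density) (auto simp: indicator_def intro!: AE_I2 elim!: order_le_neq_trans)

lemma mix_kernel_measurable[measurable]: "mix_kernel b U \<in> borel_measurable borel"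
  unfolding mix_kernel_def[abs_def] by measurable

lemma integrable_mix_weight_inv_heat: "integrable (mix_weight b U) (\<lambda>u. inv_heat u (z::'a::euclidean_space))"
proof (rule W.integrable_const_bound)
  show "AE u in mix_weight b U. norm (inv_heat u z) \<le> (U / (4 * pi)) powr (DIM('a) / 2)"
    using AE_mix_weight by eventually_elim (simp add: inv_heat_nonneg inv_heat_le)
qed measurable

lemma mix_kernel_nonneg: "0 \<le> mix_kernel b U z"
  unfolding mix_kernel_def by (intro Bochner_Integration.integral_nonneg inv_heat_nonneg)

lemma mix_kernel_uminus: "mix_kernel b U (- z) = mix_kernel b U z"
  by (simp add: mix_kernel_def inv_heat_uminus)

lemma nn_integral_mix_kernel: "(\<integral>\<^sup>+z. ennreal (mix_kernel b U (z::'a::euclidean_space)) \<partial>lborel) = 1"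
proof -
  interpret P: pair_sigma_finite "mix_weight b U" "lborel :: 'a measure" by standard
  have "(\<integral>\<^sup>+z. ennreal (mix_kernel b U (z::'a)) \<partial>lborel) = (\<integral>\<^sup>+z. \<integral>\<^sup>+u. ennreal (inv_heat u (z::'a)) \<partial>mix_weight b U \<partial>lborel)"
    unfolding mix_kernel_def
    by (intro nn_integral_cong nn_integral_eq_integral[symmetric] integrable_mix_weight_inv_heat) (simp add: inv_heat_nonneg)
  also have "\<dots> = (\<integral>\<^sup>+u. \<integral>\<^sup>+z. ennreal (inv_heat u (z::'a)) \<partial>lborel \<partial>mix_weight b U)"
    by (rule P.Fubini') measurable
  also have "\<dots> = (\<integral>\<^sup>+u. 1 \<partial>mix_weight b U)"
    by (intro nn_integral_cong_AE) (use AE_mix_weight in \<open>auto elim!: eventually_mono simp: nn_integral_inv_heat\<close>)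
  finally show ?thesis by (simp add: W.emeasure_space_1)
qed

lemma integrable_mix_kernel: "integrable lborel (mix_kernel b U :: 'a::euclidean_space \<Rightarrow> real)"
  by (rule integrableI_nonneg) (auto simp: mix_kernel_nonneg nn_integral_mix_kernel)

lemma mix_kernel_fourier:
  fixes y :: "'a::euclidean_space"
  shows "(\<integral>z. mix_kernel b U z * cos (z \<bullet> y) \<partial>lborel) = mix_symbol b U ((norm y)\<^sup>2)"
proof -
  interpret P: pair_sigma_finite "mix_weight b U" "lborel :: 'a measure" by standard
  have int: "integrable (mix_weight b U \<Otimes>\<^sub>M lborel) (\<lambda>(u, z). inv_heat u z * cos (z \<bullet> y))"
  proof (rule integrableI_bounded)
    have "(\<integral>\<^sup>+p. ennreal (norm (case p of (u, z) \<Rightarrow> inv_heat u z * cos (z \<bullet> y))) \<partial>(mix_weight b U \<Otimes>\<^sub>M lborel))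
      = (\<integral>\<^sup>+u. \<integral>\<^sup>+z. ennreal (norm (inv_heat u z * cos (z \<bullet> y))) \<partial>lborel \<partial>mix_weight b U)"
      by (subst lborel.nn_integral_fst[symmetric]) auto
    also have "\<dots> \<le> (\<integral>\<^sup>+u. \<integral>\<^sup>+z. ennreal (inv_heat u (z::'a)) \<partial>lborel \<partial>mix_weight b U)"
      by (intro nn_integral_mono) (auto simp: abs_mult inv_heat_nonneg intro!: ennreal_leI mult_left_le)
    also have "\<dots> = (\<integral>\<^sup>+u. 1 \<partial>mix_weight b U)"
      by (intro nn_integral_cong_AE) (use AE_mix_weight in \<open>auto elim!: eventually_mono simp: nn_integral_inv_heat\<close>)
    also have "\<dots> < \<infinity>" by (simp add: W.emeasure_space_1)
    finally show "(\<integral>\<^sup>+p. ennreal (norm (case p of (u, z) \<Rightarrow> inv_heat u z * cos (z \<bullet> y))) \<partial>(mix_weight b U \<Otimes>\<^sub>M lborel)) < \<infinity>" .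
  qed measurable
  have "(\<integral>z. mix_kernel b U z * cos (z \<bullet> y) \<partial>lborel) = (\<integral>z. (\<integral>u. inv_heat u z * cos (z \<bullet> y) \<partial>mix_weight b U) \<partial>lborel)"
    by (simp add: mix_kernel_def)
  also have "\<dots> = (\<integral>u. (\<integral>z. inv_heat u z * cos (z \<bullet> y) \<partial>lborel) \<partial>mix_weight b U)"
    by (rule P.Fubini_integral[OF int])
  also have "\<dots> = mix_symbol b U ((norm y)\<^sup>2)"
    unfolding mix_symbol_def
  proof (rule integral_cong_AE)
    show "(\<lambda>u. \<integral>z. inv_heat u z * cos (z \<bullet> y) \<partial>lborel) \<in> borel_measurable (mix_weight b U)" by measurable
    show "AE u in mix_weight b U. (\<integral>z. inv_heat u z * cos (z \<bullet> y) \<partial>lborel) = exp (- ((norm y)\<^sup>2 / u))"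
      using AE_mix_weight by eventually_elim (simp add: inv_heat_fourier)
  qed measurable
  finally show ?thesis .
qed

lemma mix_symbol_measurable[measurable]: "mix_symbol b U \<in> borel_measurable borel"
  unfolding mix_symbol_def[abs_def] by measurable

lemma integrable_mix_symbol: "0 \<le> l \<Longrightarrow> integrable (mix_weight b U) (\<lambda>u. exp (- (l / u)))"
  by (rule W.integrable_const_bound[where B=1])
     (use AE_mix_weight in \<open>auto elim!: eventually_mono\<close>)

lemma mix_symbol_bounds:
  assumes "0 \<le> l" shows "0 \<le> mix_symbol b U l" "mix_symbol b U l \<le> 1"
proof -
  show "0 \<le> mix_symbol b U l" unfolding mix_symbol_def by (intro Bochner_Integration.integral_nonneg) simp
  have "mix_symbol b U l \<le> (\<integral>u. 1 \<partial>mix_weight b U)"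
    unfolding mix_symbol_def
    by (intro integral_mono_AE integrable_mix_symbol assms)
       (use AE_mix_weight assms in \<open>auto elim!: eventually_mono\<close>)
  then show "mix_symbol b U l \<le> 1" by (simp add: W.prob_space)
qed

lemma mix_weight_eq:
  "mix_weight b U = density lborel (\<lambda>u. ennreal (b * U powr (- b) * u powr (b - 1) * indicator {0..U} u))"
  unfolding mix_weight_def by (intro arg_cong2[where f=density] refl ext) (auto simp: indicator_def)

text \<open>Together with \<open>mix_kernel_eq\<close> this gives both quantities the same shape,
  \<open>b * U powr (- b)\<close> times an integral over \<open>{0..U}\<close>. Only this factor and
  the domain depend on \<open>U\<close>, so \<open>tendsto_integral_cutoff\<close> serves both
  limits.\<close>

lemma one_minus_mix_symbol:
  assumes "0 \<le> l"
  shows "1 - mix_symbol b U l = b * U powr (- b) * (\<integral>u. (1 - exp (- (l / u))) * u powr (b - 1) * indicator {0..U} u \<partial>lborel)"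
proof -
  have "1 - mix_symbol b U l = (\<integral>u. 1 - exp (- (l / u)) \<partial>mix_weight b U)"
    unfolding mix_symbol_def
    by (subst Bochner_Integration.integral_diff) (auto simp: W.prob_space integrable_mix_symbol assms)
  also have "\<dots> = (\<integral>u. (b * U powr (- b) * u powr (b - 1) * indicator {0..U} u) *\<^sub>R (1 - exp (- (l / u))) \<partial>lborel)"
    using b mix_weight_eq by (simp only:) (subst integral_density, auto)
  also have "\<dots> = (\<integral>u. b * U powr (- b) * ((1 - exp (- (l / u))) * u powr (b - 1) * indicator {0..U} u) \<partial>lborel)"
    by (intro Bochner_Integration.integral_cong) auto
  finally show ?thesis by simp
qed

lemma mix_kernel_eq:
  "mix_kernel b U z = b * U powr (- b) * (\<integral>u. inv_heat u z * u powr (b - 1) * indicator {0..U} u \<partial>lborel)"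
proof -
  have "mix_kernel b U z = (\<integral>u. (b * U powr (- b) * u powr (b - 1) * indicator {0..U} u) *\<^sub>R inv_heat u z \<partial>lborel)"
    using b mix_weight_eq unfolding mix_kernel_def by (simp only:) (subst integral_density, auto)
  also have "\<dots> = (\<integral>u. b * U powr (- b) * (inv_heat u z * u powr (b - 1) * indicator {0..U} u) \<partial>lborel)"
    by (intro Bochner_Integration.integral_cong) auto
  finally show ?thesis by simp
qed

end

text \<open>\<open>Gamma (1 - \<alpha>/2) = - \<alpha>/2 * Gamma (- \<alpha>/2)\<close> removes the
  absolute value. What remains is the factor \<open>\<alpha>/2 / Gamma (1 - \<alpha>/2)\<close> of
  the subordination formula times the factor produced by integrating heat kernels over
  \<open>u\<close>.\<close>

lemma fractional_const_eq:
  assumes "0 < \<alpha>" "\<alpha> < 2"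
  shows "fractional_const d \<alpha> = 4 powr (\<alpha>/2) * Gamma (\<alpha>/2 + real d / 2) / pi powr (real d / 2) * ((\<alpha>/2) / Gamma (1 - \<alpha>/2))"
proof -
  let ?b = "\<alpha>/2"
  have "- ?b \<notin> \<int>\<^sub>\<le>\<^sub>0"
  proof
    assume "- ?b \<in> \<int>\<^sub>\<le>\<^sub>0"
    then obtain n :: nat where "- ?b = - real n" by (elim nonpos_Ints_cases') auto
    with assms show False by (cases n) auto
  qed
  then have G: "Gamma (1 - ?b) = - ?b * Gamma (- ?b)"
    using Gamma_plus1[of "- ?b"] by (simp add: add.commute)
  have "Gamma (1 - ?b) > 0" using assms by (intro Gamma_real_pos) auto
  then have A: "\<bar>Gamma (- \<alpha> / 2)\<bar> = Gamma (1 - ?b) / ?b"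
  proof -
    have "Gamma (- \<alpha> / 2) = - (Gamma (1 - ?b) / ?b)" using G assms by simp
    then show ?thesis using \<open>Gamma (1 - ?b) > 0\<close> assms by (simp only: abs_minus_cancel) simp
  qed
  have P: "(2::real) powr \<alpha> = 4 powr ?b"
    using powr_powr[of "2::real" 2 ?b] by simp
  show ?thesis
    unfolding fractional_const_def A P by (simp add: add_divide_distrib add.commute)
qed

text \<open>\<open>U = stable_cutoff b \<eta> n\<close> makes the mixing weight equal to \<open>\<eta> / n\<close> times the restriction to \<open>{0..U}\<close> of
  the measure \<open>b / \<Gamma> (1 - b) * u powr (b - 1) du\<close> that represents \<open>\<lambda> powr b\<close>.\<close>

definition stable_cutoff :: "real \<Rightarrow> real \<Rightarrow> nat \<Rightarrow> real" where
  "stable_cutoff b \<eta> n = (real n * Gamma (1 - b) / \<eta>) powr (1 / b)"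

context
  fixes b \<eta> :: real
  assumes b: "0 < b" "b < 1" and \<eta>: "0 < \<eta>"
begin

lemma Gamma_one_minus_pos: "Gamma (1 - b) > 0"
  using b by (intro Gamma_real_pos) auto

lemma Gamma_one_minus_neq_0: "Gamma (1 - b) \<noteq> 0"
  using Gamma_one_minus_pos by simp

lemma stable_cutoff_pos: "0 < n \<Longrightarrow> 0 < stable_cutoff b \<eta> n"
proof -
  assume "0 < n"
  then have "real n * Gamma (1 - b) / \<eta> > 0" using Gamma_one_minus_pos \<eta> by simp
  then show ?thesis unfolding stable_cutoff_def powr_gt_zero by (rule less_imp_neq[symmetric])
qed

lemma stable_cutoff_const: "0 < n \<Longrightarrow> real n * (b * stable_cutoff b \<eta> n powr (- b)) = \<eta> * (b / Gamma (1 - b))"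
proof -
  assume n: "0 < n"
  then have "0 \<le> real n * Gamma (1 - b) / \<eta>" using Gamma_one_minus_pos \<eta> by simp
  then have "stable_cutoff b \<eta> n powr (- b) = \<eta> / (real n * Gamma (1 - b))"
    using b \<eta> by (simp add: stable_cutoff_def powr_powr powr_minus_divide)
  then show ?thesis using n by simp
qed

lemma stable_cutoff_at_top: "filterlim (stable_cutoff b \<eta>) at_top sequentially"
proof -
  have "filterlim (\<lambda>n. real n * (Gamma (1 - b) / \<eta>)) at_top sequentially"
    using Gamma_one_minus_pos \<eta>
    by (intro filterlim_at_top_mult_tendsto_pos[OF tendsto_const _ filterlim_real_sequentially]) auto
  moreover have "filterlim (\<lambda>x::real. x powr (1 / b)) at_top at_top"
    using b by real_asymp
  ultimately show ?thesis
    unfolding stable_cutoff_def[abs_def] by (auto intro: filterlim_compose)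
qed

lemma tendsto_integral_cutoff:
  fixes h :: "real \<Rightarrow> real"
  assumes [measurable]: "h \<in> borel_measurable borel" and h: "\<And>u. 0 \<le> u \<Longrightarrow> 0 \<le> h u"
    and I: "(\<integral>\<^sup>+u. ennreal (h u) * indicator {0<..} u \<partial>lborel) = ennreal I" and "0 \<le> I"
  shows "(\<lambda>n. \<integral>u. h u * indicator {0..stable_cutoff b \<eta> n} u \<partial>lborel) \<longlonglongrightarrow> I"
proof -
  have "(\<integral>\<^sup>+u. ennreal (h u * indicator {0<..} u) \<partial>lborel) = ennreal I"
    unfolding I[symmetric] by (intro nn_integral_cong) (auto simp: indicator_def)
  then have hb: "has_bochner_integral lborel (\<lambda>u. h u * indicator {0<..} u) I"
    using assms(4) by (intro has_bochner_integral_nn_integral) (auto intro!: AE_I2 simp: h indicator_def)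
  have "(\<lambda>n. \<integral>u. h u * indicator {0..stable_cutoff b \<eta> n} u \<partial>lborel) \<longlonglongrightarrow> (\<integral>u. h u * indicator {0<..} u \<partial>lborel)"
  proof (rule integral_dominated_convergence)
    show "integrable lborel (\<lambda>u. h u * indicator {0<..} u)" using hb by (simp add: has_bochner_integral_iff)
    show "AE u in lborel. (\<lambda>n. h u * indicator {0..stable_cutoff b \<eta> n} u) \<longlonglongrightarrow> h u * indicator {0<..} u"
      using AE_lborel_singleton[of 0]
    proof eventually_elim
      fix u :: real assume "u \<noteq> 0"
      have "\<forall>\<^sub>F n in sequentially. u \<le> stable_cutoff b \<eta> n"
        using stable_cutoff_at_top by (auto simp: filterlim_at_top)
      then have "\<forall>\<^sub>F n in sequentially. h u * indicator {0..stable_cutoff b \<eta> n} u = h u * indicator {0<..} u"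
        by (rule eventually_mono) (use \<open>u \<noteq> 0\<close> in \<open>auto simp: indicator_def\<close>)
      then show "(\<lambda>n. h u * indicator {0..stable_cutoff b \<eta> n} u) \<longlonglongrightarrow> h u * indicator {0<..} u"
        by (rule tendsto_eventually)
    qed
    show "AE u in lborel. norm (h u * indicator {0..stable_cutoff b \<eta> n} u) \<le> h u * indicator {0<..} u" for n
      using AE_lborel_singleton[of 0] by eventually_elim (auto simp: indicator_def h)
  qed measurable
  with hb show ?thesis by (simp add: has_bochner_integral_iff)
qed

text \<open>By \<open>stable_cutoff_const\<close>, \<open>n\<close> times the factor in
  \<open>one_minus_mix_symbol\<close> is the same for every \<open>n > 0\<close>; only the domain
  grows, and the limit is the subordination integral.\<close>

lemma mix_symbol_tendsto:
  assumes l: "0 \<le> l"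
  shows "(\<lambda>n. real n * (1 - mix_symbol b (stable_cutoff b \<eta> n) l)) \<longlonglongrightarrow> \<eta> * l powr b"
proof -
  let ?h = "\<lambda>u. (1 - exp (- (l / u))) * u powr (b - 1)"
  have "(\<lambda>n. \<integral>u. ?h u * indicator {0..stable_cutoff b \<eta> n} u \<partial>lborel) \<longlonglongrightarrow> l powr b * Gamma (1 - b) / b"
    using b l Gamma_one_minus_pos nn_integral_one_minus_exp_powr[OF b l]
    by (intro tendsto_integral_cutoff) auto
  then have "(\<lambda>n. \<eta> * (b / Gamma (1 - b)) * (\<integral>u. ?h u * indicator {0..stable_cutoff b \<eta> n} u \<partial>lborel))
     \<longlonglongrightarrow> \<eta> * (b / Gamma (1 - b)) * (l powr b * Gamma (1 - b) / b)"
    by (intro tendsto_mult tendsto_const)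
  moreover have "\<eta> * (b / Gamma (1 - b)) * (l powr b * Gamma (1 - b) / b) = \<eta> * l powr b"
    using b Gamma_one_minus_neq_0 by simp
  moreover have "\<forall>\<^sub>F n in sequentially. \<eta> * (b / Gamma (1 - b)) * (\<integral>u. ?h u * indicator {0..stable_cutoff b \<eta> n} u \<partial>lborel)
      = real n * (1 - mix_symbol b (stable_cutoff b \<eta> n) l)"
    using eventually_gt_at_top[of 0]
    by eventually_elim (simp only: one_minus_mix_symbol[OF b stable_cutoff_pos l] stable_cutoff_const[symmetric] mult.assoc)
  ultimately show ?thesis by (simp only: Lim_transform_eventually)
qed

text \<open>The heat kernel contributes \<open>u powr (d / 2)\<close> and the exponential rate
  \<open>(norm z)\<^sup>2 / 4\<close>, so the integral over all \<open>u\<close> is of Gamma type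
  with exponent \<open>b + d / 2\<close>, and its rate yields the power of \<open>norm z\<close>.
  The limit is \<open>\<eta>\<close> times the Levy density of the isotropic stable process, which
  is singular at the origin.\<close>

lemma mix_kernel_tendsto:
  fixes z :: "'a::euclidean_space"
  assumes z: "z \<noteq> 0"
  shows "(\<lambda>n. real n * mix_kernel b (stable_cutoff b \<eta> n) z)
           \<longlonglongrightarrow> \<eta> * fractional_const DIM('a) (2 * b) / norm z powr (DIM('a) + 2 * b)"
proof -
  let ?h = "\<lambda>u. inv_heat u z * u powr (b - 1)"
  let ?d = "real DIM('a) / 2"
  define r where "r = norm z"
  have r: "r > 0" using z by (simp add: r_def)
  define I where "I = (1 / (4 * pi)) powr ?d * (Gamma (b + ?d) / (r\<^sup>2 / 4) powr (b + ?d))"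
  have I0: "0 \<le> I" using b by (auto simp: I_def intro!: mult_nonneg_nonneg divide_nonneg_nonneg Gamma_real_nonneg)
  have "(\<integral>\<^sup>+u. ennreal (?h u) * indicator {0<..} u \<partial>lborel)
     = (\<integral>\<^sup>+u. ennreal ((1 / (4 * pi)) powr ?d) * (ennreal (u powr ((b + ?d) - 1) * exp (- (r\<^sup>2 / 4) * u)) * indicator {0..} u) \<partial>lborel)"
    using AE_lborel_singleton[of 0]
  proof (intro nn_integral_cong_AE, eventually_elim)
    fix u :: real assume "u \<noteq> 0"
    show "ennreal (?h u) * indicator {0<..} u = ennreal ((1 / (4 * pi)) powr ?d) * (ennreal (u powr ((b + ?d) - 1) * exp (- (r\<^sup>2 / 4) * u)) * indicator {0..} u)"
    proof (cases "u > 0")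
      case True
      have "(u / (4 * pi)) powr ?d = (1 / (4 * pi)) powr ?d * u powr ?d"
        using True powr_mult[of "1 / (4 * pi)" u ?d] by simp
      moreover have "u powr ((b + ?d) - 1) = u powr ?d * u powr (b - 1)"
        using True by (simp add: powr_add[symmetric] algebra_simps)
      moreover have "- (u / 4) * (norm z)\<^sup>2 = - (r\<^sup>2 / 4) * u" by (simp add: r_def)
      ultimately have "?h u = (1 / (4 * pi)) powr ?d * (u powr ((b + ?d) - 1) * exp (- (r\<^sup>2 / 4) * u))"
        unfolding inv_heat_def by (simp only: mult_ac)
      then show ?thesis using True by (simp add: ennreal_mult')
    next
      case False
      with \<open>u \<noteq> 0\<close> have "u < 0" by simp
      then show ?thesis by simp
    qed
  qed
  also have "\<dots> = ennreal ((1 / (4 * pi)) powr ?d) * ennreal (Gamma (b + ?d) / (r\<^sup>2 / 4) powr (b + ?d))"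
    by (subst nn_integral_cmult, measurable, subst nn_integral_Gamma) (use b r in \<open>auto intro: add_pos_nonneg\<close>)
  also have "\<dots> = ennreal I" by (simp add: I_def ennreal_mult'[symmetric])
  finally have nn: "(\<integral>\<^sup>+u. ennreal (?h u) * indicator {0<..} u \<partial>lborel) = ennreal I" .
  have "(\<lambda>n. \<integral>u. ?h u * indicator {0..stable_cutoff b \<eta> n} u \<partial>lborel) \<longlonglongrightarrow> I"
    by (intro tendsto_integral_cutoff nn I0) (auto simp: inv_heat_nonneg)
  then have "(\<lambda>n. \<eta> * (b / Gamma (1 - b)) * (\<integral>u. ?h u * indicator {0..stable_cutoff b \<eta> n} u \<partial>lborel))
     \<longlonglongrightarrow> \<eta> * (b / Gamma (1 - b)) * I"
    by (intro tendsto_mult tendsto_const)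
  moreover have "\<eta> * (b / Gamma (1 - b)) * I = \<eta> * fractional_const DIM('a) (2 * b) / norm z powr (DIM('a) + 2 * b)"
  proof -
    have e1: "(1 / (4 * pi)) powr ?d = 1 / (4 powr ?d * pi powr ?d)"
      by (simp add: powr_divide powr_mult)
    have e2: "(r\<^sup>2 / 4) powr (b + ?d) = r powr (DIM('a) + 2 * b) / (4 powr b * 4 powr ?d)"
    proof -
      have "(r\<^sup>2) powr (b + ?d) = r powr (2 * (b + ?d))"
        using r powr_powr[of r 2 "b + ?d"] by simp
      also have "2 * (b + ?d) = DIM('a) + 2 * b" by simp
      finally show ?thesis using r by (simp add: powr_divide powr_add)
    qed
    have fc: "fractional_const DIM('a) (2 * b) = 4 powr b * Gamma (b + ?d) / pi powr ?d * (b / Gamma (1 - b))"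
      using fractional_const_eq[of "2 * b" "DIM('a)"] b by simp
    \<comment> \<open>\<open>x\<close> is \<open>4 powr ?d\<close>: it cancels between the
      normalisation of the heat kernel and the rate of the Gamma integral, while \<open>q\<close>,
      that is \<open>4 powr b\<close>, survives in the constant.\<close>
    have alg: "\<eta> * (b / G) * (1 / (x * p) * (g / (R / (q * x)))) = \<eta> * (q * g / p * (b / G)) / R" if "x \<noteq> 0" for G x p g R q :: real
      using that by (simp add: mult_ac)
    show ?thesis
      unfolding I_def e1 e2 fc r_def[symmetric] by (rule alg) simp
  qed
  moreover have "\<forall>\<^sub>F n in sequentially. \<eta> * (b / Gamma (1 - b)) * (\<integral>u. ?h u * indicator {0..stable_cutoff b \<eta> n} u \<partial>lborel)
      = real n * mix_kernel b (stable_cutoff b \<eta> n) z"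
    using eventually_gt_at_top[of 0]
    by eventually_elim (simp only: mix_kernel_eq[OF b stable_cutoff_pos] stable_cutoff_const[symmetric] mult.assoc)
  ultimately show ?thesis by (simp only: Lim_transform_eventually)
qed

end

section \<open>Variance of iterated convolutions\<close>

definition shift_mean :: "'a::euclidean_space measure \<Rightarrow> ('a \<Rightarrow> real) \<Rightarrow> 'a \<Rightarrow> real" where
  "shift_mean M u x = (\<integral>z. u (x + z) \<partial>M)"

definition bounded_borel :: "('a::euclidean_space \<Rightarrow> real) \<Rightarrow> bool" where
  "bounded_borel u \<longleftrightarrow> u \<in> borel_measurable borel \<and> (\<exists>B. \<forall>x. \<bar>u x\<bar> \<le> B)"

lemma bounded_borelI: "u \<in> borel_measurable borel \<Longrightarrow> (\<And>x. \<bar>u x\<bar> \<le> B) \<Longrightarrow> bounded_borel u"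
  by (auto simp: bounded_borel_def)

lemma bounded_borel_measurable[measurable_dest]: "bounded_borel u \<Longrightarrow> u \<in> borel_measurable borel"
  by (simp add: bounded_borel_def)

lemma bounded_borel_power2: 
  assumes "bounded_borel u" shows "bounded_borel (\<lambda>x. (u x)\<^sup>2)"
proof -
  obtain B where B: "\<And>x. \<bar>u x\<bar> \<le> B" using assms by (auto simp: bounded_borel_def)
  have "\<bar>(u x)\<^sup>2\<bar> \<le> B\<^sup>2" for x using power_mono[OF B[of x], of 2] by simp
  then show ?thesis using assms by (auto simp: bounded_borel_def)
qed

context
  fixes M :: "'a::euclidean_space measure"
  assumes M: "prob_space M" "sets M = sets borel"
begin

interpretation prob_space M by (rule M(1))

lemma integrable_bounded_borel:
  assumes "bounded_borel u" shows "integrable M (\<lambda>z. u (x + z))"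
proof -
  obtain B where B: "\<And>x. \<bar>u x\<bar> \<le> B" and [measurable]: "u \<in> borel_measurable borel"
    using assms by (auto simp: bounded_borel_def)
  note [measurable_cong] = M(2)
  from B show ?thesis by (intro integrable_const_bound[where B=B]) auto
qed

lemma bounded_borel_shift_mean:
  assumes u: "bounded_borel u" shows "bounded_borel (shift_mean M u)"
proof -
  note [measurable] = bounded_borel_measurable[OF u] and [measurable_cong] = M(2)
  obtain B where B: "\<And>x. \<bar>u x\<bar> \<le> B" using u by (auto simp: bounded_borel_def)
  have "\<bar>shift_mean M u x\<bar> \<le> B" for x
  proof -
    have "\<bar>shift_mean M u x\<bar> \<le> (\<integral>z. \<bar>u (x + z)\<bar> \<partial>M)"
      unfolding shift_mean_def by (rule integral_abs_bound)
    also have "\<dots> \<le> (\<integral>z. B \<partial>M)"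
      using B by (intro integral_mono integrable_abs integrable_bounded_borel[OF u]) auto
    finally show ?thesis by (simp add: prob_space)
  qed
  moreover have "shift_mean M u \<in> borel_measurable borel"
    unfolding shift_mean_def[abs_def] by measurable
  ultimately show ?thesis by (auto simp: bounded_borel_def)
qed

lemma bounded_borel_shift_mean_funpow:
  "bounded_borel u \<Longrightarrow> bounded_borel ((shift_mean M ^^ n) u)"
  by (induction n) (auto intro: bounded_borel_shift_mean)

lemma shift_mean_mono:
  "bounded_borel u \<Longrightarrow> bounded_borel v \<Longrightarrow> (\<And>x. u x \<le> v x) \<Longrightarrow> shift_mean M u x \<le> shift_mean M v x"
  unfolding shift_mean_def by (intro integral_mono integrable_bounded_borel) auto

definition shift_var :: "('a \<Rightarrow> real) \<Rightarrow> 'a \<Rightarrow> real" where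
  "shift_var u x = (\<integral>z. (u (x + z) - shift_mean M u x)\<^sup>2 \<partial>M)"

lemma shift_var_eq:
  assumes u: "bounded_borel u"
  shows "shift_var u x = shift_mean M (\<lambda>x. (u x)\<^sup>2) x - (shift_mean M u x)\<^sup>2"
proof -
  have "variance (\<lambda>z. u (x + z)) = expectation (\<lambda>z. (u (x + z))\<^sup>2) - (expectation (\<lambda>z. u (x + z)))\<^sup>2"
    using integrable_bounded_borel[OF bounded_borel_power2[OF u]]
    by (intro variance_eq integrable_bounded_borel[OF u]) auto
  then show ?thesis by (simp add: shift_var_def shift_mean_def)
qed

lemma shift_mean_power2_le:
  assumes u: "bounded_borel u"
  shows "(shift_mean M u x)\<^sup>2 \<le> shift_mean M (\<lambda>x. (u x)\<^sup>2) x"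
proof -
  have "0 \<le> shift_var u x" unfolding shift_var_def by simp
  then show ?thesis using shift_var_eq[OF u, of x] by simp
qed

lemma bounded_borel_shift_var:
  assumes u: "bounded_borel u" shows "bounded_borel (shift_var u)"
proof -
  obtain B where B: "\<And>x. \<bar>shift_mean M (\<lambda>x. (u x)\<^sup>2) x\<bar> \<le> B" 
    using bounded_borel_shift_mean[OF bounded_borel_power2[OF u]] by (auto simp: bounded_borel_def)
  have "\<bar>shift_var u x\<bar> \<le> B" for x
  proof -
    have "0 \<le> shift_var u x" unfolding shift_var_def by simp
    moreover have "shift_var u x \<le> shift_mean M (\<lambda>x. (u x)\<^sup>2) x"
      unfolding shift_var_eq[OF u] by simp
    ultimately show ?thesis using B[of x] by linarith
  qed
  moreover have "shift_var u \<in> borel_measurable borel"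
    unfolding shift_var_eq[OF u, abs_def]
    using bounded_borel_measurable[OF bounded_borel_shift_mean[OF u]] 
      bounded_borel_measurable[OF bounded_borel_shift_mean[OF bounded_borel_power2[OF u]]]
    by measurable
  ultimately show ?thesis by (auto simp: bounded_borel_def)
qed

text \<open>Averaging over an independent shift does not increase variance. For independent
  \<open>Z\<close> and \<open>W\<close>, the centred value of \<open>shift_mean M u (x + Z)\<close>
  is the mean over \<open>W\<close> of \<open>u (x + W + Z) - shift_mean M u (x + W)\<close>; Jensen
  moves the square inside the mean, and Fubini leaves the mean over \<open>W\<close> of the
  variances at \<open>x + W\<close>.\<close>

lemma shift_var_shift_mean_le:
  assumes u: "bounded_borel u"
  shows "shift_var (shift_mean M u) x \<le> shift_mean M (shift_var u) x"
proof -
  interpret P: pair_prob_space M M by standard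
  note [measurable] = bounded_borel_measurable[OF u] bounded_borel_measurable[OF bounded_borel_shift_mean[OF u]]
    and [measurable_cong] = M(2)
  let ?d = "\<lambda>z w. u (x + w + z) - shift_mean M u (x + w)"
  obtain B where B: "\<And>x. \<bar>u x\<bar> \<le> B" using u by (auto simp: bounded_borel_def)
  obtain B' where B': "\<And>x. \<bar>shift_mean M u x\<bar> \<le> B'" 
    using bounded_borel_shift_mean[OF u] by (auto simp: bounded_borel_def)
  have dB: "\<bar>?d z w\<bar> \<le> B + B'" for z w :: 'a using B[of "x + w + z"] B'[of "x + w"] by linarith
  have dB2: "(?d z w)\<^sup>2 \<le> (B + B')\<^sup>2" for z w
    using power_mono[OF dB[of w z], where n=2] by simp
  have i1: "integrable M (\<lambda>w. ?d z w)" for z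
    by (rule integrable_const_bound[where B="B+B'"]) (use dB in auto)
  have i2: "integrable M (\<lambda>w. (?d z w)\<^sup>2)" for z
    by (rule integrable_const_bound[where B="(B+B')\<^sup>2"]) (use dB2 in auto)
  have i3: "integrable (M \<Otimes>\<^sub>M M) (\<lambda>(z, w). (?d z w)\<^sup>2)"
    by (rule P.integrable_const_bound[where B="(B+B')\<^sup>2"]) (use dB2 in auto)
  have e: "shift_mean M u (x + z) - shift_mean M (shift_mean M u) x = (\<integral>w. ?d z w \<partial>M)" for z
  proof -
    have "integrable M (\<lambda>w. u (x + w + z))"
      using integrable_bounded_borel[OF u, of "x + z"] by (simp add: ac_simps)
    moreover have "integrable M (\<lambda>w. shift_mean M u (x + w))"
      by (rule integrable_bounded_borel[OF bounded_borel_shift_mean[OF u]])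
    ultimately show ?thesis
      unfolding shift_mean_def[of M u "x + z"] shift_mean_def[of M "shift_mean M u"]
      by (subst Bochner_Integration.integral_diff) (auto simp: ac_simps)
  qed
  have "shift_var (shift_mean M u) x = (\<integral>z. (\<integral>w. ?d z w \<partial>M)\<^sup>2 \<partial>M)"
    unfolding shift_var_def e ..
  also have "\<dots> \<le> (\<integral>z. (\<integral>w. (?d z w)\<^sup>2 \<partial>M) \<partial>M)"
  proof (rule integral_mono')
    show "integrable M (\<lambda>z. \<integral>w. (?d z w)\<^sup>2 \<partial>M)"
      using P.integrable_fst[OF i3] by simp
    show "(\<integral>w. ?d z w \<partial>M)\<^sup>2 \<le> (\<integral>w. (?d z w)\<^sup>2 \<partial>M)" for z
      using variance_positive[of "?d z"] variance_eq[OF i1 i2, of z] by simp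
  qed simp
  also have "\<dots> = (\<integral>w. (\<integral>z. (?d z w)\<^sup>2 \<partial>M) \<partial>M)"
    using P.Fubini_integral[OF i3] by simp
  also have "\<dots> = shift_mean M (shift_var u) x"
    by (simp add: shift_mean_def[of M "shift_var u"] shift_var_def)
  finally show ?thesis .
qed

text \<open>Only the part of the variance of \<open>u (x + Z\<^sub>1 + \<dots> + Z\<^sub>n)\<close> explained by each single summand is kept;
  by exchangeability all \<open>n\<close> summands explain the same amount.\<close>

lemma iterated_variance_ge:
  assumes u: "bounded_borel u" and w: "bounded_borel w" and uw: "\<And>x. (u x)\<^sup>2 \<le> w x"
  shows "real (Suc n) * shift_var ((shift_mean M ^^ n) u) x
           \<le> (shift_mean M ^^ Suc n) w x - ((shift_mean M ^^ Suc n) u x)\<^sup>2"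
proof (induction n arbitrary: x)
  case 0
  \<comment> \<open>In the application \<open>u\<close> is a smoothed function and \<open>w\<close>
    the smoothing of its square, so \<open>w\<close> dominates \<open>u\<^sup>2\<close> but differs
    from it; the domination enters only at this start of the induction.\<close>
  have "shift_mean M (\<lambda>x. (u x)\<^sup>2) x \<le> shift_mean M w x"
    by (intro shift_mean_mono bounded_borel_power2 u w uw)
  then show ?case by (simp add: shift_var_eq[OF u])
next
  case (Suc n)
  let ?A = "shift_mean M"
  let ?v = "(?A ^^ n) u" and ?w = "(?A ^^ Suc n) w"
  have v: "bounded_borel ?v" "bounded_borel (?A ?v)" and wb: "bounded_borel ?w"
    using bounded_borel_shift_mean_funpow[OF u, of n] bounded_borel_shift_mean_funpow[OF u, of "Suc n"] 
       bounded_borel_shift_mean_funpow[OF w, of "Suc n"] by auto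
  have "real (Suc n) * shift_var (?A ?v) x \<le> real (Suc n) * ?A (shift_var ?v) x"
    by (intro mult_left_mono shift_var_shift_mean_le v) auto
  also have "\<dots> = (\<integral>z. real (Suc n) * shift_var ?v (x + z) \<partial>M)"
    by (simp add: shift_mean_def)
  also have "\<dots> \<le> (\<integral>z. ?w (x + z) - (?A ?v (x + z))\<^sup>2 \<partial>M)"
  proof (rule integral_mono)
    show "integrable M (\<lambda>z. real (Suc n) * shift_var ?v (x + z))"
      by (intro integrable_mult_right integrable_bounded_borel bounded_borel_shift_var v)
    show "integrable M (\<lambda>z. ?w (x + z) - (?A ?v (x + z))\<^sup>2)"
      using integrable_bounded_borel[OF bounded_borel_power2[OF v(2)]]
      by (intro Bochner_Integration.integrable_diff integrable_bounded_borel[OF wb]) auto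
    show "real (Suc n) * shift_var ?v (x + z) \<le> ?w (x + z) - (?A ?v (x + z))\<^sup>2" for z
      using Suc.IH[of "x + z"] by simp
  qed
  also have "\<dots> = ?A ?w x - ?A (\<lambda>x. (?A ?v x)\<^sup>2) x"
    unfolding shift_mean_def[of M ?w] shift_mean_def[of M "\<lambda>x. (?A ?v x)\<^sup>2"]
    using integrable_bounded_borel[OF bounded_borel_power2[OF v(2)]] integrable_bounded_borel[OF wb]
    by (intro Bochner_Integration.integral_diff) auto
  \<comment> \<open>The mean of \<open>(?A ?v)\<^sup>2\<close> exceeds the square of the mean of
    \<open>?A ?v\<close> by one more copy of the variance, which raises the factor from
    \<open>Suc n\<close> to \<open>Suc (Suc n)\<close>.\<close>
  finally have "real (Suc n) * shift_var (?A ?v) x + shift_var (?A ?v) x \<le> ?A ?w x - (?A (?A ?v) x)\<^sup>2"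
    unfolding shift_var_eq[OF v(2)] by linarith
  moreover have "real (Suc (Suc n)) * shift_var (?A ?v) x = real (Suc n) * shift_var (?A ?v) x + shift_var (?A ?v) x"
    by (simp add: algebra_simps)
  ultimately show ?case by simp
qed

end

section \<open>Inverse Fourier transforms and limits of kernels\<close>

text \<open>The sine part of the integral is left out because every symbol below is a function of
  \<open>norm \<xi>\<close>, hence even.\<close>

definition inv_fourier :: "('a::euclidean_space \<Rightarrow> real) \<Rightarrow> 'a \<Rightarrow> real" where
  "inv_fourier f y = (1 / (2 * pi) ^ DIM('a)) * (\<integral>\<xi>. f \<xi> * cos (\<xi> \<bullet> y) \<partial>lborel)"

section \<open>Bounds, limits and convolution for inverse Fourier transforms\<close>

lemma measurable_of_integrable: "integrable lborel f \<Longrightarrow> f \<in> borel_measurable borel"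
  by (drule borel_measurable_integrable) simp

lemma integrable_mult_bounded:
  fixes f g :: "'a::euclidean_space \<Rightarrow> real"
  assumes f: "integrable lborel f" and [measurable]: "g \<in> borel_measurable borel" and g: "\<And>x. \<bar>g x\<bar> \<le> B"
  shows "integrable lborel (\<lambda>x. f x * g x)"
proof (rule Bochner_Integration.integrable_bound)
  note [measurable] = measurable_of_integrable[OF f]
  show "(\<lambda>x. f x * g x) \<in> borel_measurable lborel" by measurable
  show "integrable lborel (\<lambda>x. B * f x)" using f by simp
  have "\<bar>f x * g x\<bar> \<le> \<bar>B * f x\<bar>" for x
  proof -
    have "\<bar>f x\<bar> * \<bar>g x\<bar> \<le> \<bar>f x\<bar> * \<bar>B\<bar>" using g[of x] by (intro mult_left_mono) auto
    then show ?thesis by (simp add: abs_mult mult.commute)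
  qed
  then show "AE x in lborel. norm (f x * g x) \<le> norm (B * f x)" by simp
qed

lemma integrable_mult_cos:
  fixes f :: "'a::euclidean_space \<Rightarrow> real"
  shows "integrable lborel f \<Longrightarrow> integrable lborel (\<lambda>x. f x * cos (x \<bullet> y))"
  by (rule integrable_mult_bounded[where B=1]) auto

lemma inv_fourier_measurable[measurable]:
  assumes [measurable]: "f \<in> borel_measurable borel"
  shows "inv_fourier f \<in> borel_measurable borel"
  unfolding inv_fourier_def[abs_def] by measurable

lemma inv_fourier_uminus: "inv_fourier f (- y) = inv_fourier f y"
  by (simp add: inv_fourier_def)

lemma inv_fourier_le:
  fixes f g :: "'a::euclidean_space \<Rightarrow> real"
  assumes f: "integrable lborel f" and g: "integrable lborel g" and fg: "\<And>x. \<bar>f x\<bar> \<le> g x"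
  shows "\<bar>inv_fourier f y\<bar> \<le> (1 / (2 * pi) ^ DIM('a)) * (\<integral>x. g x \<partial>lborel)"
proof -
  have "\<bar>\<integral>x. f x * cos (x \<bullet> y) \<partial>lborel\<bar> \<le> (\<integral>x. \<bar>f x * cos (x \<bullet> y)\<bar> \<partial>lborel)"
    by (rule integral_abs_bound)
  also have "\<dots> \<le> (\<integral>x. g x \<partial>lborel)"
  proof (rule integral_mono)
    show "\<bar>f x * cos (x \<bullet> y)\<bar> \<le> g x" for x
      using mult_left_le[of "\<bar>cos (x \<bullet> y)\<bar>" "\<bar>f x\<bar>"] fg[of x] by (simp add: abs_mult)
  qed (use f g in \<open>auto intro: integrable_abs integrable_mult_cos\<close>)
  finally show ?thesis by (simp add: inv_fourier_def abs_mult divide_right_mono)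
qed

lemma inv_fourier_tendsto:
  fixes f :: "nat \<Rightarrow> 'a::euclidean_space \<Rightarrow> real"
  assumes [measurable]: "\<And>n. f n \<in> borel_measurable borel" "f' \<in> borel_measurable borel"
    and g: "integrable lborel g" and fg: "\<And>n x. \<bar>f n x\<bar> \<le> g x" and lim: "\<And>x. (\<lambda>n. f n x) \<longlonglongrightarrow> f' x"
  shows "(\<lambda>n. inv_fourier (f n) y) \<longlonglongrightarrow> inv_fourier f' y"
  unfolding inv_fourier_def
proof (intro tendsto_mult tendsto_const integral_dominated_convergence[where w=g])
  show "AE x in lborel. (\<lambda>n. f n x * cos (x \<bullet> y)) \<longlonglongrightarrow> f' x * cos (x \<bullet> y)"
    by (intro AE_I2 tendsto_mult lim tendsto_const)
  show "AE x in lborel. norm (f n x * cos (x \<bullet> y)) \<le> g x" for n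
  proof (intro AE_I2)
    show "norm (f n x * cos (x \<bullet> y)) \<le> g x" for x
      using mult_left_le[of "\<bar>cos (x \<bullet> y)\<bar>" "\<bar>f n x\<bar>"] fg[of n x] by (simp add: abs_mult)
  qed
qed (use g in auto)

lemma integral_odd:
  fixes f :: "'a::euclidean_space \<Rightarrow> real"
  assumes [measurable]: "f \<in> borel_measurable borel" and odd: "\<And>x. f (- x) = - f x"
  shows "(\<integral>x. f x \<partial>lborel) = 0"
  using integral_lborel_reflect[OF assms(1), of 0] by (simp add: odd)

lemma integrable_pair_mult:
  fixes f g :: "'a::euclidean_space \<Rightarrow> real"
  assumes f: "integrable lborel f" and g: "integrable lborel g"
  shows "integrable (lborel \<Otimes>\<^sub>M lborel) (\<lambda>(x, y). f x * g y)"
proof -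
  note [measurable] = measurable_of_integrable[OF f] measurable_of_integrable[OF g]
  show ?thesis
    using f g by (intro lborel_pair.Fubini_integrable) (auto simp: abs_mult)
qed

lemma integrable_pair_mult_bounded:
  fixes f g :: "'a::euclidean_space \<Rightarrow> real"
  assumes f: "integrable lborel f" and g: "integrable lborel g"
    and [measurable]: "h \<in> borel_measurable (lborel \<Otimes>\<^sub>M lborel)" and h: "\<And>p. \<bar>h p\<bar> \<le> B"
  shows "integrable (lborel \<Otimes>\<^sub>M lborel) (\<lambda>(x, y). f x * g y * h (x, y))"
proof (rule Bochner_Integration.integrable_bound)
  note [measurable] = measurable_of_integrable[OF f] measurable_of_integrable[OF g]
  show "integrable (lborel \<Otimes>\<^sub>M lborel) (\<lambda>p. B * (case p of (x, y) \<Rightarrow> f x * g y))"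
    by (intro integrable_mult_right integrable_pair_mult f g)
  show "AE p in lborel \<Otimes>\<^sub>M lborel. norm (case p of (x, y) \<Rightarrow> f x * g y * h (x, y)) \<le> norm (B * (case p of (x, y) \<Rightarrow> f x * g y))"
  proof (intro AE_I2)
    fix p :: "'a \<times> 'a"
    obtain x y where p: "p = (x, y)" by (cases p)
    have "\<bar>f x * g y\<bar> * \<bar>h p\<bar> \<le> \<bar>f x * g y\<bar> * \<bar>B\<bar>" using h[of p] by (intro mult_left_mono) auto
    then show "norm (case p of (x, y) \<Rightarrow> f x * g y * h (x, y)) \<le> norm (B * (case p of (x, y) \<Rightarrow> f x * g y))"
      by (simp add: p abs_mult mult_ac)
  qed
  show "(\<lambda>(x, y). f x * g y * h (x, y)) \<in> borel_measurable (lborel \<Otimes>\<^sub>M lborel)" by measurable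
qed

text \<open>The addition formula splits \<open>cos (\<xi> \<bullet> (y - z))\<close> into two
  products. As \<open>m\<close> is even, the one with \<open>sin (z \<bullet> \<xi>)\<close>
  integrates to 0, and the other gives the transform of \<open>m\<close>. Fubini applies because
  \<open>m z * f \<xi>\<close> is integrable on the product.\<close>

lemma inv_fourier_convolution:
  fixes f m :: "'a::euclidean_space \<Rightarrow> real"
  assumes f: "integrable lborel f" and m: "integrable lborel m" and even: "\<And>z. m (- z) = m z"
  shows "(\<integral>z. m z * inv_fourier f (y - z) \<partial>lborel)
           = inv_fourier (\<lambda>\<xi>. f \<xi> * (\<integral>z. m z * cos (z \<bullet> \<xi>) \<partial>lborel)) y"
proof -
  note [measurable] = measurable_of_integrable[OF f] measurable_of_integrable[OF m]
  have cosm: "(\<integral>z. m z * cos (\<xi> \<bullet> (y - z)) \<partial>lborel) = cos (\<xi> \<bullet> y) * (\<integral>z. m z * cos (z \<bullet> \<xi>) \<partial>lborel)" for \<xi>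
  proof -
    have "integrable lborel (\<lambda>z. m z * sin (z \<bullet> \<xi>))"
      by (rule integrable_mult_bounded[OF m, where B=1]) auto
    moreover have "(\<integral>z. m z * sin (z \<bullet> \<xi>) \<partial>lborel) = 0"
      by (rule integral_odd) (auto simp: even)
    moreover have "m z * cos (\<xi> \<bullet> (y - z)) = cos (\<xi> \<bullet> y) * (m z * cos (z \<bullet> \<xi>)) + sin (\<xi> \<bullet> y) * (m z * sin (z \<bullet> \<xi>))" for z
      by (simp add: inner_diff_right cos_diff inner_commute algebra_simps)
    ultimately show ?thesis
      using integrable_mult_cos[OF m, of \<xi>] by simp
  qed
  have "integrable (lborel \<Otimes>\<^sub>M lborel) (\<lambda>(z, \<xi>). m z * f \<xi> * (case (z, \<xi>) of (z, \<xi>) \<Rightarrow> cos (\<xi> \<bullet> (y - z))))"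
    by (rule integrable_pair_mult_bounded[where B=1]) (use m f in auto)
  then have int: "integrable (lborel \<Otimes>\<^sub>M lborel) (\<lambda>(z, \<xi>). m z * (f \<xi> * cos (\<xi> \<bullet> (y - z))))"
    by (simp add: mult.assoc)
  have "(\<integral>z. m z * (\<integral>\<xi>. f \<xi> * cos (\<xi> \<bullet> (y - z)) \<partial>lborel) \<partial>lborel)
     = (\<integral>z. \<integral>\<xi>. m z * (f \<xi> * cos (\<xi> \<bullet> (y - z))) \<partial>lborel \<partial>lborel)"
    by simp
  also have "\<dots> = (\<integral>\<xi>. \<integral>z. m z * (f \<xi> * cos (\<xi> \<bullet> (y - z))) \<partial>lborel \<partial>lborel)"
    by (rule lborel_pair.Fubini_integral[OF int, symmetric])
  also have "\<dots> = (\<integral>\<xi>. f \<xi> * (\<integral>z. m z * cos (\<xi> \<bullet> (y - z)) \<partial>lborel) \<partial>lborel)"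
    by (subst integral_mult_right_zero[symmetric]) (simp add: mult_ac)
  also have "\<dots> = (\<integral>\<xi>. f \<xi> * (\<integral>z. m z * cos (z \<bullet> \<xi>) \<partial>lborel) * cos (\<xi> \<bullet> y) \<partial>lborel)"
    by (simp add: cosm mult_ac)
  finally have *: "(\<integral>z. m z * (\<integral>\<xi>. f \<xi> * cos (\<xi> \<bullet> (y - z)) \<partial>lborel) \<partial>lborel) = \<dots>" .
  have "(\<integral>z. m z * inv_fourier f (y - z) \<partial>lborel)
      = (\<integral>z. (1 / (2 * pi) ^ DIM('a)) * (m z * (\<integral>\<xi>. f \<xi> * cos (\<xi> \<bullet> (y - z)) \<partial>lborel)) \<partial>lborel)"
    unfolding inv_fourier_def by (simp add: mult_ac)
  also have "\<dots> = (1 / (2 * pi) ^ DIM('a)) * (\<integral>z. m z * (\<integral>\<xi>. f \<xi> * cos (\<xi> \<bullet> (y - z)) \<partial>lborel) \<partial>lborel)"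
    by (rule integral_mult_right_zero)
  finally show ?thesis unfolding * inv_fourier_def .
qed

section \<open>Averages against a kernel and their limits\<close>

definition kernel_mean :: "('a::euclidean_space \<Rightarrow> real) \<Rightarrow> ('a \<Rightarrow> real) \<Rightarrow> 'a \<Rightarrow> real" where
  "kernel_mean K g x = (\<integral>z. K z * g (x + z) \<partial>lborel)"

lemma kernel_mean_measurable[measurable]:
  assumes [measurable]: "K \<in> borel_measurable borel" "g \<in> borel_measurable borel"
  shows "kernel_mean K g \<in> borel_measurable borel"
  unfolding kernel_mean_def[abs_def] by measurable

lemma integrable_translate:
  fixes g :: "'a::euclidean_space \<Rightarrow> real"
  shows "integrable lborel g \<Longrightarrow> integrable lborel (\<lambda>z. g (x + z))"
  using integrable_lborel_affine[of g 1 x] by simp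

lemma kernel_mean_tendsto:
  fixes K :: "nat \<Rightarrow> 'a::euclidean_space \<Rightarrow> real"
  assumes [measurable]: "\<And>n. K n \<in> borel_measurable borel" "K' \<in> borel_measurable borel"
    and bd: "\<And>n z. \<bar>K n z\<bar> \<le> B" and lim: "\<And>z. (\<lambda>n. K n z) \<longlonglongrightarrow> K' z"
    and g: "integrable lborel g"
  shows "(\<lambda>n. kernel_mean (K n) g x) \<longlonglongrightarrow> kernel_mean K' g x"
  unfolding kernel_mean_def
proof (rule integral_dominated_convergence[where w="\<lambda>z. B * \<bar>g (x + z)\<bar>"])
  note [measurable] = measurable_of_integrable[OF g]
  show "(\<lambda>z. K' z * g (x + z)) \<in> borel_measurable lborel" by measurable
  show "(\<lambda>z. K n z * g (x + z)) \<in> borel_measurable lborel" for n by measurable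
  show "integrable lborel (\<lambda>z. B * \<bar>g (x + z)\<bar>)"
    by (intro integrable_mult_right integrable_abs integrable_translate g)
  show "AE z in lborel. (\<lambda>n. K n z * g (x + z)) \<longlonglongrightarrow> K' z * g (x + z)"
    by (intro AE_I2 tendsto_mult lim tendsto_const)
  show "AE z in lborel. norm (K n z * g (x + z)) \<le> B * \<bar>g (x + z)\<bar>" for n
    by (intro AE_I2) (auto simp: abs_mult intro!: mult_right_mono bd)
qed

text \<open>Applied twice: as \<open>n\<close> grows at fixed Gaussian smoothing, and then to remove
  the smoothing. Two families \<open>K\<close> and \<open>K'\<close> occur because, with
  \<open>n + 1\<close> summands in all, the increments are those of an average over only
  \<open>n\<close> of them. The weights \<open>r n\<close> converge only pointwise, so the left side
  passes to the limit by Fatou; the right side converges.\<close>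

lemma reverse_poincare_limit:
  fixes K K' :: "nat \<Rightarrow> 'a::euclidean_space \<Rightarrow> real"
  assumes [measurable]: "\<And>n. K n \<in> borel_measurable borel" "\<And>n. K' n \<in> borel_measurable borel" "L \<in> borel_measurable borel"
      "\<And>n. r n \<in> borel_measurable borel" "R \<in> borel_measurable borel"
    and bd: "\<And>n z. \<bar>K n z\<bar> \<le> B" "\<And>n z. \<bar>K' n z\<bar> \<le> B"
    and lim: "\<And>z. (\<lambda>n. K n z) \<longlonglongrightarrow> L z" "\<And>z. (\<lambda>n. K' n z) \<longlonglongrightarrow> L z"
    and r: "\<And>z. z \<noteq> 0 \<Longrightarrow> (\<lambda>n. r n z) \<longlonglongrightarrow> R z"
    and g: "integrable lborel g" "integrable lborel (\<lambda>x. (g x)\<^sup>2)"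
    and ineq: "\<And>n. (\<integral>\<^sup>+z. ennreal ((kernel_mean (K' n) g (x + z) - kernel_mean (K n) g x)\<^sup>2 * r n z) \<partial>lborel)
                   \<le> ennreal (kernel_mean (K n) (\<lambda>x. (g x)\<^sup>2) x - (kernel_mean (K n) g x)\<^sup>2)"
  shows "(\<integral>\<^sup>+z. ennreal ((kernel_mean L g (x + z) - kernel_mean L g x)\<^sup>2 * R z) \<partial>lborel)
                   \<le> ennreal (kernel_mean L (\<lambda>x. (g x)\<^sup>2) x - (kernel_mean L g x)\<^sup>2)"
proof -
  note [measurable] = measurable_of_integrable[OF g(1)]
  let ?a = "\<lambda>n z. ennreal ((kernel_mean (K' n) g (x + z) - kernel_mean (K n) g x)\<^sup>2 * r n z)"
  have "(\<integral>\<^sup>+z. ennreal ((kernel_mean L g (x + z) - kernel_mean L g x)\<^sup>2 * R z) \<partial>lborel)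
      = (\<integral>\<^sup>+z. liminf (\<lambda>n. ?a n z) \<partial>lborel)"
    using AE_lborel_singleton[of 0]
  proof (intro nn_integral_cong_AE, eventually_elim)
    fix z :: 'a assume z: "z \<noteq> 0"
    have "(\<lambda>n. ?a n z) \<longlonglongrightarrow> ennreal ((kernel_mean L g (x + z) - kernel_mean L g x)\<^sup>2 * R z)"
      by (intro tendsto_ennrealI tendsto_intros r z kernel_mean_tendsto[where B=B] bd lim g(1)) measurable
    then show "ennreal ((kernel_mean L g (x + z) - kernel_mean L g x)\<^sup>2 * R z) = liminf (\<lambda>n. ?a n z)"
      by (simp add: lim_imp_Liminf)
  qed
  also have "\<dots> \<le> liminf (\<lambda>n. \<integral>\<^sup>+z. ?a n z \<partial>lborel)"
    by (rule nn_integral_liminf) measurable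
  also have "\<dots> \<le> liminf (\<lambda>n. ennreal (kernel_mean (K n) (\<lambda>x. (g x)\<^sup>2) x - (kernel_mean (K n) g x)\<^sup>2))"
    by (intro Liminf_mono always_eventually allI ineq)
  also have "\<dots> = ennreal (kernel_mean L (\<lambda>x. (g x)\<^sup>2) x - (kernel_mean L g x)\<^sup>2)"
    by (intro lim_imp_Liminf tendsto_ennrealI tendsto_intros kernel_mean_tendsto[where B=B] bd lim g) auto
  finally show ?thesis .
qed

text \<open>Avoids polar coordinates: the function is at most a multiple of
  \<open>(1 + (norm x)\<^sup>2) powr (- d)\<close>, which is a Gamma mixture of Gaussians, and after
  exchanging the integrals only Gaussian integrals over \<open>x\<close> remain.\<close>

lemma integrable_exp_powr_norm:
  assumes t: "0 < t" and \<alpha>: "0 < \<alpha>"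
  shows "integrable lborel (\<lambda>x::'a::euclidean_space. exp (- t * norm x powr \<alpha>))"
proof -
  let ?d = "real DIM('a)"
  have "((\<lambda>r::real. exp (- t * r powr \<alpha>) * (1 + r\<^sup>2) powr ?d) \<longlongrightarrow> 0) at_top"
    using t \<alpha> by real_asymp
  then have "\<forall>\<^sub>F r in at_top. exp (- t * r powr \<alpha>) * (1 + r\<^sup>2) powr ?d < 1"
    by (rule order_tendstoD) simp
  then obtain R where R: "\<And>r. r \<ge> R \<Longrightarrow> exp (- t * r powr \<alpha>) * (1 + r\<^sup>2) powr ?d < 1"
    by (auto simp: eventually_at_top_linorder)
  \<comment> \<open>The 1 covers \<open>r \<ge> R\<close>, where the product is below 1; the other
    term covers \<open>r < R\<close>.\<close>
  define C where "C = max 1 ((1 + R\<^sup>2) powr ?d)"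
  have C: "exp (- t * r powr \<alpha>) \<le> C / (1 + r\<^sup>2) powr ?d" if r: "r \<ge> 0" for r
  proof -
    have "exp (- t * r powr \<alpha>) * (1 + r\<^sup>2) powr ?d \<le> C"
    proof (cases "r \<ge> R")
      case True
      then show ?thesis using R[of r] by (auto simp: C_def)
    next
      case False
      have "exp (- t * r powr \<alpha>) * (1 + r\<^sup>2) powr ?d \<le> 1 * (1 + R\<^sup>2) powr ?d"
        using False r t by (intro mult_mono powr_mono2 add_left_mono power_mono) auto
      then show ?thesis by (auto simp: C_def)
    qed
    moreover have "(1 + r\<^sup>2) powr ?d > 0"
      by (smt (verit) powr_gt_zero zero_le_power2)
    ultimately show ?thesis by (simp add: pos_le_divide_eq)
  qed
  let ?h = "\<lambda>u (x::'a). ennreal (u powr (?d - 1) * exp (- (1 + (norm x)\<^sup>2) * u)) * indicator {0..} u"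
  have "(\<integral>\<^sup>+x. ennreal (exp (- t * norm (x::'a) powr \<alpha>)) \<partial>lborel)
      \<le> (\<integral>\<^sup>+x. ennreal (C / Gamma ?d) * (\<integral>\<^sup>+u. ?h u (x::'a) \<partial>lborel) \<partial>lborel)"
  proof (intro nn_integral_mono)
    fix x :: 'a
    have "Gamma ?d > 0" by (intro Gamma_real_pos) simp
    then have G: "Gamma ?d \<noteq> 0" by (rule less_imp_neq[symmetric])
    have "(\<integral>\<^sup>+u. ?h u x \<partial>lborel) = ennreal (Gamma ?d / (1 + (norm x)\<^sup>2) powr ?d)"
      by (rule nn_integral_Gamma) (auto simp: add_pos_nonneg)
    then have "ennreal (C / Gamma ?d) * (\<integral>\<^sup>+u. ?h u x \<partial>lborel) = ennreal (C / (1 + (norm x)\<^sup>2) powr ?d)"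
      using G by (simp add: C_def ennreal_mult'[symmetric])
    then show "ennreal (exp (- t * norm x powr \<alpha>)) \<le> ennreal (C / Gamma ?d) * (\<integral>\<^sup>+u. ?h u x \<partial>lborel)"
      using C[of "norm x"] by (simp add: ennreal_leI)
  qed
  also have "\<dots> = ennreal (C / Gamma ?d) * (\<integral>\<^sup>+x. \<integral>\<^sup>+u. ?h u (x::'a) \<partial>lborel \<partial>lborel)"
    by (rule nn_integral_cmult) measurable
  also have "(\<integral>\<^sup>+x. \<integral>\<^sup>+u. ?h u (x::'a) \<partial>lborel \<partial>lborel) = (\<integral>\<^sup>+u. \<integral>\<^sup>+x. ?h u (x::'a) \<partial>lborel \<partial>lborel)"
    by (rule lborel_pair.Fubini') measurable
  \<comment> \<open>The Gaussian integral gives \<open>(pi / u) powr (?d / 2)\<close> and lowers the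
    exponent from \<open>?d - 1\<close> to \<open>?d / 2 - 1\<close>, which is still above -1, so
    the integral converges at 0.\<close>
  also have "\<dots> = (\<integral>\<^sup>+u. ennreal (pi powr (?d / 2)) * (ennreal (u powr (?d / 2 - 1) * exp (- 1 * u)) * indicator {0..} u) \<partial>lborel)"
    using AE_lborel_singleton[of 0]
  proof (intro nn_integral_cong_AE, eventually_elim)
    fix u :: real assume "u \<noteq> 0"
    show "(\<integral>\<^sup>+x. ?h u (x::'a) \<partial>lborel) = ennreal (pi powr (?d / 2)) * (ennreal (u powr (?d / 2 - 1) * exp (- 1 * u)) * indicator {0..} u)"
    proof (cases "u > 0")
      case True
      have "(\<integral>\<^sup>+x. ?h u (x::'a) \<partial>lborel) = (\<integral>\<^sup>+x. ennreal (u powr (?d - 1) * exp (- u)) * ennreal (exp (- u * (norm (x::'a))\<^sup>2)) \<partial>lborel)"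
        using True by (intro nn_integral_cong) (auto simp: ennreal_mult'[symmetric] exp_add[symmetric] algebra_simps mult_exp_exp)
      also have "\<dots> = ennreal (u powr (?d - 1) * exp (- u)) * (\<integral>\<^sup>+x. ennreal (exp (- u * (norm (x::'a))\<^sup>2)) \<partial>lborel)"
        by (rule nn_integral_cmult) measurable
      also have "(\<integral>\<^sup>+x. ennreal (exp (- u * (norm (x::'a))\<^sup>2)) \<partial>lborel) = ennreal ((pi / u) powr (?d / 2))"
        using gaussian_cos_integral[OF True, of "0::'a"]
        by (subst nn_integral_eq_integral[OF integrable_gaussian[OF True]]) auto
      also have "ennreal (u powr (?d - 1) * exp (- u)) * ennreal ((pi / u) powr (?d / 2)) = ennreal (pi powr (?d / 2) * (u powr (?d / 2 - 1) * exp (- 1 * u)))"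
      proof -
        have "u powr (?d - 1) = u powr (?d / 2 - 1) * u powr (?d / 2)"
          using True by (simp add: powr_add[symmetric])
        then show ?thesis using True by (simp add: ennreal_mult'[symmetric] powr_divide)
      qed
      finally show ?thesis using True by (simp add: ennreal_mult')
    next
      case False
      with \<open>u \<noteq> 0\<close> have "u < 0" by simp
      then show ?thesis by simp
    qed
  qed
  also have "\<dots> = ennreal (pi powr (?d / 2)) * ennreal (Gamma (?d / 2) / 1 powr (?d / 2))"
    by (subst nn_integral_cmult, measurable, subst nn_integral_Gamma) auto
  finally have "(\<integral>\<^sup>+x. ennreal (exp (- t * norm (x::'a) powr \<alpha>)) \<partial>lborel) < \<infinity>"
    by (rule le_less_trans) (simp add: ennreal_mult_less_top)
  then show ?thesis
    by (intro integrableI_nonneg) auto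
qed

section \<open>Finitely many mixture steps after a Gaussian smoothing\<close>

lemma inv_heat_eq_inv_fourier:
  assumes "0 < v"
  shows "inv_heat v = inv_fourier (\<lambda>\<xi>::'a::euclidean_space. exp (- (1 / v) * (norm \<xi>)\<^sup>2))"
  using inv_heat_inverse_fourier[OF assms] by (auto simp: inv_fourier_def fun_eq_iff)

context
  fixes b U v :: real
  assumes b: "0 < b" "b < 1" and U: "0 < U" and v: "0 < v"
begin

text \<open>By \<open>approx_kernel_Suc\<close>, the density of a Gaussian variable with density
  \<open>inv_heat v\<close> plus \<open>j\<close> independent variables with density
  \<open>mix_kernel b U\<close>. It is introduced on the Fourier side because the limit is taken
  there; the Gaussian factor dominates the symbols for all \<open>j\<close> and
  \<open>U\<close>.\<close>

definition approx_kernel :: "nat \<Rightarrow> 'a::euclidean_space \<Rightarrow> real" where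
  "approx_kernel j = inv_fourier (\<lambda>\<xi>. exp (- (1 / v) * (norm \<xi>)\<^sup>2) * mix_symbol b U ((norm \<xi>)\<^sup>2) ^ j)"

lemma approx_symbol_le:
  "\<bar>exp (- (1 / v) * (norm \<xi>)\<^sup>2) * mix_symbol b U ((norm \<xi>)\<^sup>2) ^ j\<bar> \<le> exp (- (1 / v) * (norm (\<xi>::'a::euclidean_space))\<^sup>2)"
  using mix_symbol_bounds[OF b U, of "(norm \<xi>)\<^sup>2"] 
  by (auto simp: abs_mult power_le_one intro!: mult_left_le)

lemma mix_symbol_comp_measurable[measurable]:
  "(\<lambda>\<xi>::'a::euclidean_space. mix_symbol b U ((norm \<xi>)\<^sup>2)) \<in> borel_measurable borel"
  by (rule measurable_compose[OF _ mix_symbol_measurable[OF b U]]) measurable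

lemma integrable_approx_symbol:
  "integrable lborel (\<lambda>\<xi>::'a::euclidean_space. exp (- (1 / v) * (norm \<xi>)\<^sup>2) * mix_symbol b U ((norm \<xi>)\<^sup>2) ^ j)"
proof (rule Bochner_Integration.integrable_bound[OF integrable_gaussian[of "1 / v"]])
  show "AE \<xi>::'a in lborel. norm (exp (- (1 / v) * (norm \<xi>)\<^sup>2) * mix_symbol b U ((norm \<xi>)\<^sup>2) ^ j) \<le> norm (exp (- (1 / v) * (norm \<xi>)\<^sup>2))"
    using approx_symbol_le by (intro AE_I2) simp
  show "(\<lambda>\<xi>::'a. exp (- (1 / v) * (norm \<xi>)\<^sup>2) * mix_symbol b U ((norm \<xi>)\<^sup>2) ^ j) \<in> borel_measurable lborel"
    by measurable
qed (use v in auto)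

lemma approx_kernel_measurable[measurable]: "approx_kernel j \<in> borel_measurable borel"
  unfolding approx_kernel_def by (rule inv_fourier_measurable) measurable

lemma approx_kernel_0: "approx_kernel 0 = inv_heat v"
  by (simp add: approx_kernel_def inv_heat_eq_inv_fourier[OF v])

lemma approx_kernel_Suc: "approx_kernel (Suc j) y = (\<integral>z. mix_kernel b U z * approx_kernel j (y - z) \<partial>lborel)"
  unfolding approx_kernel_def
  by (subst inv_fourier_convolution[OF integrable_approx_symbol integrable_mix_kernel[OF b U]])
     (auto simp: mix_kernel_uminus[OF b U] mix_kernel_fourier[OF b U] mult_ac)

text \<open>Positivity cannot be read off the oscillating Fourier integral; it comes from the
  convolution recursion. This is also the source of the positivity of the stable density.\<close>

lemma approx_kernel_nonneg: "0 \<le> approx_kernel j y"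
proof (induction j arbitrary: y)
  case 0
  then show ?case by (simp add: approx_kernel_0 inv_heat_nonneg)
next
  case (Suc j)
  then show ?case
    unfolding approx_kernel_Suc by (intro Bochner_Integration.integral_nonneg mult_nonneg_nonneg mix_kernel_nonneg[OF b U])
qed

text \<open>The right side depends only on \<open>v\<close> and the dimension, so it can serve as
  the constant \<open>B\<close> of \<open>reverse_poincare_limit\<close> while \<open>j\<close> and
  \<open>U\<close> both vary with \<open>n\<close>.\<close>

lemma approx_kernel_le:
  "\<bar>approx_kernel j (y::'a::euclidean_space)\<bar> \<le> (1 / (2 * pi) ^ DIM('a)) * (\<integral>\<xi>. exp (- (1 / v) * (norm (\<xi>::'a))\<^sup>2) \<partial>lborel)"
  unfolding approx_kernel_def
  by (rule inv_fourier_le[OF integrable_approx_symbol integrable_gaussian approx_symbol_le]) (use v in auto)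

definition mix_law :: "'a::euclidean_space measure" where
  "mix_law = density lborel (\<lambda>z. ennreal (mix_kernel b U z))"

lemma mix_kernel_measurable'[measurable]: "mix_kernel b U \<in> borel_measurable borel"
  by (rule mix_kernel_measurable[OF b U])

lemma mix_law_prob: "prob_space mix_law" and mix_law_sets: "sets (mix_law :: 'a::euclidean_space measure) = sets borel"
proof -
  show "prob_space mix_law"
    by (rule prob_spaceI) (simp add: mix_law_def emeasure_density nn_integral_mix_kernel[OF b U])
  show "sets (mix_law :: 'a measure) = sets borel" by (simp add: mix_law_def)
qed

lemma integral_mix_law:
  fixes f :: "'a::euclidean_space \<Rightarrow> real"
  assumes [measurable]: "f \<in> borel_measurable borel"
  shows "(\<integral>z. f z \<partial>mix_law) = (\<integral>z. mix_kernel b U z * f z \<partial>lborel)"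
  unfolding mix_law_def by (subst integral_density) (auto simp: mix_kernel_nonneg[OF b U])

lemma kernel_mean_approx_kernel_Suc:
  fixes g :: "'a::euclidean_space \<Rightarrow> real"
  assumes g: "integrable lborel g"
  shows "kernel_mean (approx_kernel (Suc j)) g = shift_mean mix_law (kernel_mean (approx_kernel j) g)"
proof
  fix x :: 'a
  note [measurable] = measurable_of_integrable[OF g]
  define B where "B = (1 / (2 * pi) ^ DIM('a)) * (\<integral>\<xi>. exp (- (1 / v) * (norm (\<xi>::'a))\<^sup>2) \<partial>lborel)"
  have Bd: "\<bar>approx_kernel j y\<bar> \<le> B" for y :: 'a
    unfolding B_def by (rule approx_kernel_le)
  have "integrable (lborel \<Otimes>\<^sub>M lborel) (\<lambda>(y, z). g (x + y) * mix_kernel b U z * (case (y, z) of (y, z) \<Rightarrow> approx_kernel j (y - z)))"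
    by (rule integrable_pair_mult_bounded[where B=B, OF integrable_translate[OF g] integrable_mix_kernel[OF b U]])
       (auto simp: Bd split: prod.splits)
  then have int: "integrable (lborel \<Otimes>\<^sub>M lborel) (\<lambda>(y, z). mix_kernel b U z * approx_kernel j (y - z) * g (x + y))"
    by (simp add: mult_ac)
  have "kernel_mean (approx_kernel (Suc j)) g x
      = (\<integral>y. (\<integral>z. mix_kernel b U z * approx_kernel j (y - z) * g (x + y) \<partial>lborel) \<partial>lborel)"
    unfolding kernel_mean_def approx_kernel_Suc by simp
  also have "\<dots> = (\<integral>z. (\<integral>y. mix_kernel b U z * approx_kernel j (y - z) * g (x + y) \<partial>lborel) \<partial>lborel)"
    by (rule lborel_pair.Fubini_integral[OF int, symmetric])
  also have "\<dots> = (\<integral>z. mix_kernel b U z * kernel_mean (approx_kernel j) g (x + z) \<partial>lborel)"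
  proof (intro Bochner_Integration.integral_cong refl)
    fix z :: 'a
    have "(\<integral>y. mix_kernel b U z * approx_kernel j (y - z) * g (x + y) \<partial>lborel)
        = mix_kernel b U z * (\<integral>y. approx_kernel j (y - z) * g (x + y) \<partial>lborel)"
      by (simp add: mult.assoc)
    \<comment> \<open>Translating \<open>y\<close> by \<open>z\<close> moves the shift from the
      kernel to the argument of \<open>g\<close>.\<close>
    also have "(\<integral>y. approx_kernel j (y - z) * g (x + y) \<partial>lborel) = (\<integral>y. approx_kernel j ((z + y) - z) * g (x + (z + y)) \<partial>lborel)"
      by (rule integral_lborel_translate[symmetric]) measurable
    finally show "(\<integral>y. mix_kernel b U z * approx_kernel j (y - z) * g (x + y) \<partial>lborel) = mix_kernel b U z * kernel_mean (approx_kernel j) g (x + z)"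
      by (simp add: kernel_mean_def add.assoc)
  qed
  also have "\<dots> = shift_mean mix_law (kernel_mean (approx_kernel j) g) x"
    unfolding shift_mean_def by (rule integral_mix_law[symmetric]) measurable
  finally show "kernel_mean (approx_kernel (Suc j)) g x = shift_mean mix_law (kernel_mean (approx_kernel j) g) x" .
qed

lemma kernel_mean_approx_kernel:
  fixes g :: "'a::euclidean_space \<Rightarrow> real"
  assumes g: "integrable lborel g"
  shows "kernel_mean (approx_kernel j) g = (shift_mean mix_law ^^ j) (kernel_mean (inv_heat v) g)"
  by (induction j) (auto simp: approx_kernel_0 kernel_mean_approx_kernel_Suc[OF g])

text \<open>\<open>inv_heat v\<close> is a probability density, so both claims are instances of
  facts about \<open>shift_mean\<close> under the Gaussian law \<open>H\<close>. They provide the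
  \<open>u\<close> and \<open>w\<close> of \<open>iterated_variance_ge\<close>.\<close>

lemma bounded_borel_kernel_mean_inv_heat:
  fixes g :: "'a::euclidean_space \<Rightarrow> real"
  assumes g: "bounded_borel g"
  shows "bounded_borel (kernel_mean (inv_heat v) g)"
    and "(kernel_mean (inv_heat v) g x)\<^sup>2 \<le> kernel_mean (inv_heat v) (\<lambda>x. (g x)\<^sup>2) x"
proof -
  define H :: "'a measure" where "H = density lborel (\<lambda>z. ennreal (inv_heat v z))"
  have H: "prob_space H" "sets H = sets borel"
    by (auto intro!: prob_spaceI simp: H_def emeasure_density nn_integral_inv_heat[OF v])
  have eq: "shift_mean H u = kernel_mean (inv_heat v) u" if "bounded_borel u" for u
    using bounded_borel_measurable[OF that] unfolding shift_mean_def kernel_mean_def fun_eq_iff H_def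
    by (subst integral_density) (auto simp: inv_heat_nonneg)
  show "bounded_borel (kernel_mean (inv_heat v) g)"
    using bounded_borel_shift_mean[OF H g] unfolding eq[OF g] .
  show "(kernel_mean (inv_heat v) g x)\<^sup>2 \<le> kernel_mean (inv_heat v) (\<lambda>x. (g x)\<^sup>2) x"
    using shift_mean_power2_le[OF H g, of x] unfolding eq[OF g] eq[OF bounded_borel_power2[OF g]] .
qed

text \<open>Under \<open>mix_law\<close>, the single-summand variance in
  \<open>iterated_variance_ge\<close> is an integral of squared increments against
  \<open>mix_kernel\<close>. The number of summands joins that density as a weight, which is the
  combination that has a limit in \<open>mix_kernel_tendsto\<close>. The centre carries
  \<open>Suc n\<close> because it is the mean of the \<open>n\<close>-step average over one more
  shift.\<close>

lemma approx_kernel_reverse_poincare: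
  fixes g :: "'a::euclidean_space \<Rightarrow> real"
  assumes g: "bounded_borel g" "integrable lborel g" "integrable lborel (\<lambda>x. (g x)\<^sup>2)"
  shows "(\<integral>\<^sup>+z. ennreal ((kernel_mean (approx_kernel n) g (x + z) - kernel_mean (approx_kernel (Suc n)) g x)\<^sup>2
            * (real (Suc n) * mix_kernel b U z)) \<partial>lborel)
         \<le> ennreal (kernel_mean (approx_kernel (Suc n)) (\<lambda>x. (g x)\<^sup>2) x - (kernel_mean (approx_kernel (Suc n)) g x)\<^sup>2)"
proof -
  note [measurable] = bounded_borel_measurable[OF g(1)]
  let ?A = "shift_mean mix_law :: ('a \<Rightarrow> real) \<Rightarrow> 'a \<Rightarrow> real"
  let ?u = "kernel_mean (inv_heat v) g" and ?w = "kernel_mean (inv_heat v) (\<lambda>x. (g x)\<^sup>2)"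
  let ?d = "\<lambda>z. (kernel_mean (approx_kernel n) g (x + z) - kernel_mean (approx_kernel (Suc n)) g x)\<^sup>2"
  have u: "bounded_borel ?u" by (rule bounded_borel_kernel_mean_inv_heat[OF g(1)])
  have w: "bounded_borel ?w" by (rule bounded_borel_kernel_mean_inv_heat[OF bounded_borel_power2[OF g(1)]])
  have un: "bounded_borel ((?A ^^ n) ?u)" by (rule bounded_borel_shift_mean_funpow[OF mix_law_prob mix_law_sets u])
  have "real (Suc n) * shift_var mix_law ((?A ^^ n) ?u) x \<le> (?A ^^ Suc n) ?w x - ((?A ^^ Suc n) ?u x)\<^sup>2"
    by (rule iterated_variance_ge[OF mix_law_prob mix_law_sets u w bounded_borel_kernel_mean_inv_heat(2)[OF g(1)]])
  then have *: "real (Suc n) * shift_var mix_law ((?A ^^ n) ?u) x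
      \<le> kernel_mean (approx_kernel (Suc n)) (\<lambda>x. (g x)\<^sup>2) x - (kernel_mean (approx_kernel (Suc n)) g x)\<^sup>2"
    unfolding kernel_mean_approx_kernel[OF g(2)] kernel_mean_approx_kernel[OF g(3)] .
  have d: "shift_var mix_law ((?A ^^ n) ?u) x = (\<integral>z. ?d z \<partial>mix_law)"
    unfolding shift_var_def[OF mix_law_prob mix_law_sets] kernel_mean_approx_kernel[OF g(2)] by simp
  have "integrable mix_law ?d"
  proof -
    have "bounded_borel (\<lambda>y. (?A ^^ n) ?u y - (?A ^^ Suc n) ?u x)"
    proof -
      obtain B where B: "\<And>y. \<bar>(?A ^^ n) ?u y\<bar> \<le> B" using un by (auto simp: bounded_borel_def)
      have "\<bar>(?A ^^ n) ?u y - (?A ^^ Suc n) ?u x\<bar> \<le> B + \<bar>(?A ^^ Suc n) ?u x\<bar>" for y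
        by (rule order_trans[OF abs_triangle_ineq4 add_right_mono[OF B]])
      then show ?thesis using bounded_borel_measurable[OF un] by (auto intro!: bounded_borelI)
    qed
    from integrable_bounded_borel[OF mix_law_prob mix_law_sets bounded_borel_power2[OF this], of x]
    show ?thesis unfolding kernel_mean_approx_kernel[OF g(2)] .
  qed
  then have "ennreal (\<integral>z. ?d z \<partial>mix_law) = (\<integral>\<^sup>+z. ennreal (?d z) \<partial>mix_law)"
    by (intro nn_integral_eq_integral[symmetric]) auto
  also have "\<dots> = (\<integral>\<^sup>+z. ennreal (mix_kernel b U z) * ennreal (?d z) \<partial>lborel)"
    unfolding mix_law_def by (rule nn_integral_density) measurable
  finally have e: "ennreal (\<integral>z. ?d z \<partial>mix_law) = (\<integral>\<^sup>+z. ennreal (mix_kernel b U z) * ennreal (?d z) \<partial>lborel)" .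
  have "(\<integral>\<^sup>+z. ennreal (?d z * (real (Suc n) * mix_kernel b U z)) \<partial>lborel)
      = (\<integral>\<^sup>+z. ennreal (real (Suc n)) * (ennreal (mix_kernel b U z) * ennreal (?d z)) \<partial>lborel)"
    by (intro nn_integral_cong) (simp add: ennreal_mult'[symmetric] mix_kernel_nonneg[OF b U] mult_ac del: of_nat_Suc)
  also have "\<dots> = ennreal (real (Suc n)) * ennreal (\<integral>z. ?d z \<partial>mix_law)"
    unfolding e by (rule nn_integral_cmult) measurable
  also have "\<dots> = ennreal (real (Suc n) * (\<integral>z. ?d z \<partial>mix_law))"
    by (rule ennreal_mult'[symmetric]) simp
  also have "\<dots> \<le> ennreal (kernel_mean (approx_kernel (Suc n)) (\<lambda>x. (g x)\<^sup>2) x - (kernel_mean (approx_kernel (Suc n)) g x)\<^sup>2)"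
    using * unfolding d by (rule ennreal_leI)
  finally show ?thesis .
qed

end

text \<open>Compare \<open>a n\<close> with \<open>exp (- x)\<close> for \<open>x = 1 - a n\<close>:
  they differ by at most \<open>x\<^sup>2\<close>, because \<open>1 - x \<le> exp (- x) \<le> 1 / (1
  + x) \<le> 1 - x + x\<^sup>2\<close>. So the \<open>k\<close>-th powers differ by at most
  \<open>k * x\<^sup>2\<close>, and for \<open>k\<close> near \<open>n\<close> this is a convergent
  factor times one tending to 0. The second limit is for the family with one summand fewer.\<close>

lemma power_tendsto_exp:
  fixes a :: "nat \<Rightarrow> real"
  assumes a: "\<And>n. 0 \<le> a n" "\<And>n. a n \<le> 1" and lim: "(\<lambda>n. real n * (1 - a n)) \<longlonglongrightarrow> L"
  shows "(\<lambda>n. a n ^ n) \<longlonglongrightarrow> exp (- L)" "(\<lambda>n. a (Suc n) ^ n) \<longlonglongrightarrow> exp (- L)"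
proof -
  have a1: "(\<lambda>n. 1 - a n) \<longlonglongrightarrow> 0"
  proof -
    have "(\<lambda>n. (real n * (1 - a n)) * (1 / real n)) \<longlonglongrightarrow> L * 0"
      by (intro tendsto_mult lim) real_asymp
    moreover have "\<forall>\<^sub>F n in sequentially. (real n * (1 - a n)) * (1 / real n) = 1 - a n"
      using eventually_gt_at_top[of 0] by eventually_elim simp
    ultimately show ?thesis by (simp add: filterlim_cong[OF refl refl])
  qed
  have bd: "\<bar>a n ^ k - exp (- (real k * (1 - a n)))\<bar> \<le> real k * (1 - a n)\<^sup>2" for n k
  proof -
    let ?x = "1 - a n"
    have x: "0 \<le> ?x" "?x \<le> 1" using a[of n] by auto
    have "\<bar>a n ^ k - exp (- ?x) ^ k\<bar> \<le> real k * \<bar>a n - exp (- ?x)\<bar>"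
      using norm_power_diff[of "a n" "exp (- ?x)" k] a[of n] by auto
    moreover have "\<bar>a n - exp (- ?x)\<bar> \<le> ?x\<^sup>2"
    proof -
      have "1 - ?x \<le> exp (- ?x)" using exp_ge_add_one_self[of "- ?x"] by simp
      moreover have "exp (- ?x) \<le> 1 - ?x + ?x\<^sup>2"
      proof -
        have "exp (- ?x) \<le> 1 / (1 + ?x)"
          unfolding exp_minus inverse_eq_divide using exp_ge_add_one_self[of ?x] x
          by (intro divide_left_mono) auto
        also have "\<dots> \<le> 1 - ?x + ?x\<^sup>2"
        proof -
          have "(1 - ?x + ?x\<^sup>2) * (1 + ?x) = 1 + ?x ^ 3" by (simp add: algebra_simps power2_eq_square power3_eq_cube)
          then show ?thesis using x by (simp add: pos_divide_le_eq)
        qed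
        finally show ?thesis .
      qed
      ultimately show ?thesis by simp
    qed
    ultimately have "\<bar>a n ^ k - exp (- ?x) ^ k\<bar> \<le> real k * ?x\<^sup>2"
      by (meson mult_left_mono of_nat_0_le_iff order_trans)
    then show ?thesis by (metis exp_of_nat_mult mult_minus_right)
  qed
  have gen: "(\<lambda>n. a (f n) ^ n) \<longlonglongrightarrow> exp (- L)"
    if f: "(\<lambda>n. real n * (1 - a (f n))) \<longlonglongrightarrow> L" "(\<lambda>n. 1 - a (f n)) \<longlonglongrightarrow> 0" for f
  proof -
    have "(\<lambda>n. (real n * (1 - a (f n))) * (1 - a (f n))) \<longlonglongrightarrow> L * 0"
      by (intro tendsto_mult f)
    then have z: "(\<lambda>n. real n * (1 - a (f n))\<^sup>2) \<longlonglongrightarrow> 0" by (simp add: power2_eq_square mult.assoc)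
    have "(\<lambda>n. a (f n) ^ n - exp (- (real n * (1 - a (f n))))) \<longlonglongrightarrow> 0"
      by (rule Lim_null_comparison[OF _ z]) (simp add: bd)
    moreover have "(\<lambda>n. exp (- (real n * (1 - a (f n))))) \<longlonglongrightarrow> exp (- L)"
      by (intro tendsto_intros f)
    ultimately have "(\<lambda>n. (a (f n) ^ n - exp (- (real n * (1 - a (f n))))) + exp (- (real n * (1 - a (f n))))) \<longlonglongrightarrow> 0 + exp (- L)"
      by (rule tendsto_add)
    then show ?thesis by simp
  qed
  show "(\<lambda>n. a n ^ n) \<longlonglongrightarrow> exp (- L)" by (rule gen[OF lim a1])
  have "(\<lambda>n. real (Suc n) * (1 - a (Suc n)) - (1 - a (Suc n))) \<longlonglongrightarrow> L - 0"
    by (intro tendsto_diff LIMSEQ_Suc[OF lim] LIMSEQ_Suc[OF a1])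
  then have "(\<lambda>n. real n * (1 - a (Suc n))) \<longlonglongrightarrow> L" by (simp add: algebra_simps)
  then show "(\<lambda>n. a (Suc n) ^ n) \<longlonglongrightarrow> exp (- L)" by (rule gen[OF _ LIMSEQ_Suc[OF a1]])
qed

section \<open>The isotropic stable density\<close>

context
  fixes \<alpha> \<eta> :: real
  assumes \<alpha>: "0 < \<alpha>" "\<alpha> < 2" and \<eta>: "0 < \<eta>"
begin

lemma integrable_stable_symbol: "integrable lborel (\<lambda>\<xi>::'a::euclidean_space. exp (- \<eta> * norm \<xi> powr \<alpha>))"
  by (rule integrable_exp_powr_norm[OF \<eta> \<alpha>(1)])

lemma stable_density_eq_inv_fourier:
  "(stable_density \<alpha> \<eta> :: 'a::euclidean_space \<Rightarrow> real) = inv_fourier (\<lambda>\<xi>. exp (- \<eta> * norm \<xi> powr \<alpha>))"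
proof
  fix y :: 'a
  let ?f = "\<lambda>\<xi>::'a. complex_of_real (exp (- \<eta> * norm \<xi> powr \<alpha>)) * exp (- \<i> * complex_of_real (\<xi> \<bullet> y))"
  have e: "exp (- \<i> * complex_of_real t) = cis (- t)" for t by (simp add: cis_conv_exp)
  have "integrable lborel ?f"
  proof (rule Bochner_Integration.integrable_bound[OF integrable_stable_symbol])
    show "AE \<xi> in lborel. norm (?f \<xi>) \<le> norm (exp (- \<eta> * norm \<xi> powr \<alpha>))"
      by (intro AE_I2) (simp add: e norm_mult)
  qed measurable
  then have "Re (\<integral>\<xi>. ?f \<xi> \<partial>lborel) = (\<integral>\<xi>. Re (?f \<xi>) \<partial>lborel)" by (rule integral_Re[symmetric])
  also have "(\<lambda>\<xi>. Re (?f \<xi>)) = (\<lambda>\<xi>. exp (- \<eta> * norm \<xi> powr \<alpha>) * cos (\<xi> \<bullet> y))"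
    unfolding e by (simp add: fun_eq_iff)
  finally show "stable_density \<alpha> \<eta> y = inv_fourier (\<lambda>\<xi>. exp (- \<eta> * norm \<xi> powr \<alpha>)) y"
    unfolding stable_density_def inv_fourier_def by (simp only: Re_complex_of_real times_complex.sel Im_complex_of_real)
qed

text \<open>The stable density smoothed by a Gaussian of density \<open>inv_heat v\<close>: the
  limit of the kernels \<open>approx_kernel\<close> as the number of steps grows.\<close>

definition smooth_kernel :: "real \<Rightarrow> 'a::euclidean_space \<Rightarrow> real" where
  "smooth_kernel v = inv_fourier (\<lambda>\<xi>. exp (- (1 / v) * (norm \<xi>)\<^sup>2) * exp (- \<eta> * norm \<xi> powr \<alpha>))"

lemma smooth_kernel_measurable[measurable]: "smooth_kernel v \<in> borel_measurable borel"
  unfolding smooth_kernel_def by (rule inv_fourier_measurable) measurable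

lemma stable_density_measurable[measurable]: "(stable_density \<alpha> \<eta> :: 'a::euclidean_space \<Rightarrow> real) \<in> borel_measurable borel"
  unfolding stable_density_eq_inv_fourier by (rule inv_fourier_measurable) measurable

lemma stable_density_uminus: "stable_density \<alpha> \<eta> (- y :: 'a::euclidean_space) = stable_density \<alpha> \<eta> y"
  by (simp add: stable_density_eq_inv_fourier inv_fourier_uminus)

lemma stable_density_bounded: "\<exists>B. \<forall>y. \<bar>stable_density \<alpha> \<eta> (y :: 'a::euclidean_space)\<bar> \<le> B"
  unfolding stable_density_eq_inv_fourier
  using inv_fourier_le[OF integrable_stable_symbol integrable_stable_symbol] by force

abbreviation "\<beta> \<equiv> \<alpha> / 2"
abbreviation "cutoff \<equiv> stable_cutoff \<beta> \<eta>"

lemma beta: "0 < \<beta>" "\<beta> < 1" using \<alpha> by auto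

lemma approx_kernel_tendsto:
  assumes v: "0 < v"
  shows "(\<lambda>n. approx_kernel \<beta> (cutoff (Suc n)) v (Suc n) (y::'a::euclidean_space)) \<longlonglongrightarrow> smooth_kernel v y"
    and "(\<lambda>n. approx_kernel \<beta> (cutoff (Suc n)) v n (y::'a::euclidean_space)) \<longlonglongrightarrow> smooth_kernel v y"
proof -
  have U: "0 < cutoff (Suc n)" for n by (rule stable_cutoff_pos[OF beta \<eta>]) simp
  note def = approx_kernel_def[OF beta U v] smooth_kernel_def
  have lim: "(\<lambda>n. mix_symbol \<beta> (cutoff (Suc n)) ((norm x)\<^sup>2) ^ Suc n) \<longlonglongrightarrow> exp (- \<eta> * norm x powr \<alpha>)"
       "(\<lambda>n. mix_symbol \<beta> (cutoff (Suc n)) ((norm x)\<^sup>2) ^ n) \<longlonglongrightarrow> exp (- \<eta> * norm x powr \<alpha>)" for x :: 'a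
  proof -
    \<comment> \<open>At \<open>n = 0\<close> the cutoff is 0 and \<open>mix_symbol_bounds\<close>
      does not apply. The value 1 keeps every term in the unit interval and leaves the product with
      \<open>real n\<close> unchanged.\<close>
    let ?a = "\<lambda>n. if n = 0 then 1 else mix_symbol \<beta> (cutoff n) ((norm x)\<^sup>2)"
    have "0 \<le> ?a n" "?a n \<le> 1" for n
      using mix_symbol_bounds[OF beta stable_cutoff_pos[OF beta \<eta>], of n "(norm x)\<^sup>2"] by auto
    moreover have "(\<lambda>n. real n * (1 - ?a n)) \<longlonglongrightarrow> \<eta> * ((norm x)\<^sup>2) powr \<beta>"
    proof -
      have "(\<lambda>n. real n * (1 - mix_symbol \<beta> (cutoff n) ((norm x)\<^sup>2))) \<longlonglongrightarrow> \<eta> * ((norm x)\<^sup>2) powr \<beta>"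
        by (rule mix_symbol_tendsto[OF beta \<eta>]) simp
      moreover have "(\<lambda>n. real n * (1 - mix_symbol \<beta> (cutoff n) ((norm x)\<^sup>2))) = (\<lambda>n. real n * (1 - ?a n))" by auto
      ultimately show ?thesis by simp
    qed
    moreover have "((norm x)\<^sup>2) powr \<beta> = norm x powr \<alpha>"
      using powr_powr[of "norm x" 2 \<beta>] by simp
    ultimately have "(\<lambda>n. ?a n ^ n) \<longlonglongrightarrow> exp (- (\<eta> * norm x powr \<alpha>))" "(\<lambda>n. ?a (Suc n) ^ n) \<longlonglongrightarrow> exp (- (\<eta> * norm x powr \<alpha>))"
      using power_tendsto_exp[of ?a "\<eta> * norm x powr \<alpha>"] by auto
    from LIMSEQ_Suc[OF this(1)] this(2)
    show "(\<lambda>n. mix_symbol \<beta> (cutoff (Suc n)) ((norm x)\<^sup>2) ^ Suc n) \<longlonglongrightarrow> exp (- \<eta> * norm x powr \<alpha>)"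
       "(\<lambda>n. mix_symbol \<beta> (cutoff (Suc n)) ((norm x)\<^sup>2) ^ n) \<longlonglongrightarrow> exp (- \<eta> * norm x powr \<alpha>)" by simp_all
  qed
  have gint: "integrable lborel (\<lambda>\<xi>::'a. exp (- (1 / v) * (norm \<xi>)\<^sup>2))"
    by (rule integrable_gaussian) (use v in simp)
  note m = measurable_of_integrable[OF integrable_approx_symbol[OF beta U v]]
  show "(\<lambda>n. approx_kernel \<beta> (cutoff (Suc n)) v (Suc n) y) \<longlonglongrightarrow> smooth_kernel v y"
    unfolding def
    by (rule inv_fourier_tendsto[OF m _ gint approx_symbol_le[OF beta U v]], measurable, intro tendsto_mult tendsto_const lim)
  show "(\<lambda>n. approx_kernel \<beta> (cutoff (Suc n)) v n y) \<longlonglongrightarrow> smooth_kernel v y"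
    unfolding def
    by (rule inv_fourier_tendsto[OF m _ gint approx_symbol_le[OF beta U v]], measurable, intro tendsto_mult tendsto_const lim)
qed

lemma smooth_kernel_tendsto:
  "(\<lambda>n. smooth_kernel (real (Suc n)) (y::'a::euclidean_space)) \<longlonglongrightarrow> stable_density \<alpha> \<eta> y"
  unfolding stable_density_eq_inv_fourier smooth_kernel_def
proof (rule inv_fourier_tendsto[OF _ _ integrable_stable_symbol])
  fix \<xi> :: 'a
  have "(\<lambda>n. exp (- (1 / real (Suc n)) * (norm \<xi>)\<^sup>2)) \<longlonglongrightarrow> exp (- 0 * (norm \<xi>)\<^sup>2)"
    by (intro tendsto_intros LIMSEQ_Suc[OF lim_1_over_n])
  then have "(\<lambda>n. exp (- (1 / real (Suc n)) * (norm \<xi>)\<^sup>2) * exp (- \<eta> * norm \<xi> powr \<alpha>)) \<longlonglongrightarrow> 1 * exp (- \<eta> * norm \<xi> powr \<alpha>)"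
    by (intro tendsto_mult tendsto_const) simp
  then show "(\<lambda>n. exp (- (1 / real (Suc n)) * (norm \<xi>)\<^sup>2) * exp (- \<eta> * norm \<xi> powr \<alpha>)) \<longlonglongrightarrow> exp (- \<eta> * norm \<xi> powr \<alpha>)"
    by simp
next
  show "\<bar>exp (- (1 / real (Suc n)) * (norm \<xi>)\<^sup>2) * exp (- \<eta> * norm \<xi> powr \<alpha>)\<bar> \<le> exp (- \<eta> * norm \<xi> powr \<alpha>)" for n and \<xi> :: 'a
    by (simp add: abs_mult mult_le_cancel_right1)
qed measurable

lemma smooth_kernel_nonneg:
  assumes v: "0 < v" shows "0 \<le> smooth_kernel v (y::'a::euclidean_space)"
proof (rule LIMSEQ_le_const[OF approx_kernel_tendsto(1)[OF v, of y]], intro exI allI impI)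
  show "0 \<le> approx_kernel \<beta> (cutoff (Suc n)) v (Suc n) y" for n
    by (rule approx_kernel_nonneg[OF beta _ v]) (rule stable_cutoff_pos[OF beta \<eta>], simp)
qed

lemma stable_density_nonneg: "0 \<le> stable_density \<alpha> \<eta> (y::'a::euclidean_space)"
  by (rule LIMSEQ_le_const[OF smooth_kernel_tendsto]) (intro exI allI impI smooth_kernel_nonneg of_nat_0_less_iff[THEN iffD2] zero_less_Suc)

text \<open>Integrating the density against the Gaussian \<open>exp (- |y|\<^sup>2 / k)\<close> and exchanging the order of
  integration gives the mean of \<open>exp (- \<eta> |\<xi>| powr \<alpha>)\<close> under a Gaussian that concentrates at \<open>0\<close>.\<close>

lemma nn_integral_stable_density: "(\<integral>\<^sup>+y. ennreal (stable_density \<alpha> \<eta> (y::'a::euclidean_space)) \<partial>lborel) = 1"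
proof -
  let ?p = "stable_density \<alpha> \<eta> :: 'a \<Rightarrow> real"
  let ?\<phi> = "\<lambda>\<xi>::'a. exp (- \<eta> * norm \<xi> powr \<alpha>)"
  let ?g = "\<lambda>k (y::'a). exp (- (1 / real (Suc k)) * (norm y)\<^sup>2)"
  \<comment> \<open>The scale for which \<open>\<xi> = s k *\<^sub>R \<zeta>\<close> turns
    \<open>real (Suc k) * (norm \<xi>)\<^sup>2 / 4\<close> into
    \<open>(norm \<zeta>)\<^sup>2\<close>, so that \<open>k\<close> is left only in the stable
    symbol.\<close>
  define s where "s k = 2 / sqrt (real (Suc k))" for k
  have s: "s k > 0" "(s k)\<^sup>2 = 4 / real (Suc k)" for k by (auto simp: s_def power_divide)
  have gauss: "integrable lborel (\<lambda>\<zeta>::'a. exp (- (norm \<zeta>)\<^sup>2))"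
    using integrable_gaussian[of 1] by simp
  define E where "E k = (1 / pi powr (DIM('a) / 2)) * (\<integral>\<zeta>. exp (- (norm \<zeta>)\<^sup>2) * exp (- \<eta> * norm (s k *\<^sub>R (\<zeta>::'a)) powr \<alpha>) \<partial>lborel)" for k
  obtain B where B: "\<And>y. \<bar>?p y\<bar> \<le> B" using stable_density_bounded by blast
  have gint: "integrable lborel (?g k)" for k by (rule integrable_gaussian) simp
  have pg: "integrable lborel (\<lambda>y. ?g k y * ?p y)" for k
    by (rule integrable_mult_bounded[OF gint _ B]) measurable
  have pgE: "(\<integral>y. ?g k y * ?p y \<partial>lborel) = E k" for k
  proof -
    \<comment> \<open>By evenness the pairing is a convolution evaluated at 0, which
      \<open>inv_fourier_convolution\<close> rewrites on the Fourier side.\<close>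
    have "(\<integral>y. ?g k y * ?p y \<partial>lborel) = (\<integral>y. ?g k y * inv_fourier ?\<phi> (0 - y) \<partial>lborel)"
      by (simp add: stable_density_eq_inv_fourier inv_fourier_uminus)
    also have "\<dots> = inv_fourier (\<lambda>\<xi>. ?\<phi> \<xi> * (\<integral>y. ?g k y * cos (y \<bullet> \<xi>) \<partial>lborel)) 0"
      by (rule inv_fourier_convolution[OF integrable_stable_symbol gint]) simp
    also have "\<dots> = (1 / (2 * pi) ^ DIM('a)) * (\<integral>\<xi>. (pi * real (Suc k)) powr (DIM('a) / 2) * (?\<phi> \<xi> * exp (- (real (Suc k) * (norm \<xi>)\<^sup>2 / 4))) \<partial>lborel)"
      unfolding inv_fourier_def
      by (subst gaussian_cos_integral) (auto simp: mult_ac simp del: of_nat_Suc)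
    also have "\<dots> = (1 / (2 * pi) ^ DIM('a)) * ((pi * real (Suc k)) powr (DIM('a) / 2) * (\<integral>\<xi>. (?\<phi> \<xi> * exp (- (real (Suc k) * (norm \<xi>)\<^sup>2 / 4))) \<partial>lborel))"
      by (simp only: integral_mult_right_zero)
    also have "(\<integral>\<xi>. (?\<phi> \<xi> * exp (- (real (Suc k) * (norm \<xi>)\<^sup>2 / 4))) \<partial>lborel)
        = s k ^ DIM('a) * (\<integral>\<zeta>. (?\<phi> (s k *\<^sub>R \<zeta>) * exp (- (real (Suc k) * (norm (s k *\<^sub>R \<zeta>))\<^sup>2 / 4))) \<partial>lborel)"
      using s(1)[of k] integral_lborel_affine[of "\<lambda>\<xi>::'a. ?\<phi> \<xi> * exp (- (real (Suc k) * (norm \<xi>)\<^sup>2 / 4))" "s k" 0]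
      by (simp del: of_nat_Suc)
    also have "(\<lambda>\<zeta>::'a. ?\<phi> (s k *\<^sub>R \<zeta>) * exp (- (real (Suc k) * (norm (s k *\<^sub>R \<zeta>))\<^sup>2 / 4))) = (\<lambda>\<zeta>. exp (- (norm \<zeta>)\<^sup>2) * ?\<phi> (s k *\<^sub>R \<zeta>))"
      by (auto simp: power_mult_distrib s(2) simp del: of_nat_Suc)
    finally have 1: "(\<integral>y. ?g k y * ?p y \<partial>lborel) = ((1 / (2 * pi) ^ DIM('a)) * (pi * real (Suc k)) powr (DIM('a) / 2) * s k ^ DIM('a)) * (\<integral>\<zeta>. exp (- (norm \<zeta>)\<^sup>2) * ?\<phi> (s k *\<^sub>R \<zeta>) \<partial>lborel)"
      by (simp only: mult.assoc)
    have "(1 / (2 * pi) ^ DIM('a)) * (pi * real (Suc k)) powr (DIM('a) / 2) * s k ^ DIM('a) = 1 / pi powr (DIM('a) / 2)"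
    proof -
      have h: "x powr (DIM('a) / 2) = sqrt x ^ DIM('a)" if "x > 0" for x
        using that by (simp add: powr_half_sqrt[symmetric] powr_powr powr_realpow[symmetric])
      have "(1 / (2 * pi)) * sqrt (pi * real (Suc k)) * s k = 1 / sqrt pi"
        by (simp add: s_def real_sqrt_mult divide_simps del: of_nat_Suc)
      then have "((1 / (2 * pi)) * sqrt (pi * real (Suc k)) * s k) ^ DIM('a) = (1 / sqrt pi) ^ DIM('a)" by (simp only:)
      then show ?thesis
        unfolding power_mult_distrib by (subst (1 2) h) (simp_all add: power_one_over del: of_nat_Suc)
    qed
    then show ?thesis unfolding 1 E_def by (simp only:)
  qed
  have "E \<longlonglongrightarrow> (1 / pi powr (DIM('a) / 2)) * (\<integral>\<zeta>. exp (- (norm (\<zeta>::'a))\<^sup>2) * 1 \<partial>lborel)"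
    unfolding E_def
  proof (intro tendsto_mult tendsto_const integral_dominated_convergence[where w="\<lambda>\<zeta>. exp (- (norm \<zeta>)\<^sup>2)"] gauss AE_I2)
    fix \<zeta> :: 'a
    have s0: "s \<longlonglongrightarrow> 0" unfolding s_def by real_asymp
    have "(\<lambda>k. exp (- \<eta> * norm (s k *\<^sub>R \<zeta>) powr \<alpha>)) \<longlonglongrightarrow> exp (- \<eta> * 0)"
    proof (intro tendsto_intros)
      have "(\<lambda>k. norm (s k *\<^sub>R \<zeta>)) \<longlonglongrightarrow> norm (0 *\<^sub>R \<zeta>)" by (intro tendsto_intros s0)
      then show "(\<lambda>k. norm (s k *\<^sub>R \<zeta>) powr \<alpha>) \<longlonglongrightarrow> 0"
        using \<alpha> by (intro tendsto_zero_powrI[where b=\<alpha>]) auto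
    qed
    then show "(\<lambda>k. exp (- \<eta> * norm (s k *\<^sub>R \<zeta>) powr \<alpha>)) \<longlonglongrightarrow> 1" by simp
    show "norm (exp (- (norm \<zeta>)\<^sup>2) * exp (- \<eta> * norm (s k *\<^sub>R \<zeta>) powr \<alpha>)) \<le> exp (- (norm \<zeta>)\<^sup>2)" for k
      using \<eta> by (simp add: norm_mult mult_le_cancel_left1)
  qed auto
  also have "(\<integral>\<zeta>. exp (- (norm (\<zeta>::'a))\<^sup>2) * 1 \<partial>lborel) = pi powr (DIM('a) / 2)"
    using gaussian_cos_integral[of 1 "0::'a"] by simp
  finally have E1: "E \<longlonglongrightarrow> 1" by simp
  have "(\<integral>\<^sup>+y. ennreal (?p y) \<partial>lborel) = (\<integral>\<^sup>+y. (SUP k. ennreal (?g k y * ?p y)) \<partial>lborel)"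
  proof (intro nn_integral_cong)
    fix y :: 'a
    have "(\<lambda>k. ?g k y) \<longlonglongrightarrow> exp (- 0 * (norm y)\<^sup>2)"
      by (intro tendsto_intros LIMSEQ_Suc[OF lim_1_over_n])
    then have "(\<lambda>k. ?g k y * ?p y) \<longlonglongrightarrow> 1 * ?p y" by (intro tendsto_mult tendsto_const) simp
    then have "(\<lambda>k. ennreal (?g k y * ?p y)) \<longlonglongrightarrow> ennreal (?p y)" by (intro tendsto_ennrealI) simp
    moreover have "incseq (\<lambda>k. ennreal (?g k y * ?p y))"
      by (intro monoI ennreal_leI mult_right_mono stable_density_nonneg) (auto intro!: mult_right_mono divide_left_mono simp: frac_le)
    ultimately show "ennreal (?p y) = (SUP k. ennreal (?g k y * ?p y))"
      using LIMSEQ_SUP LIMSEQ_unique by blast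
  qed
  also have "\<dots> = (SUP k. \<integral>\<^sup>+y. ennreal (?g k y * ?p y) \<partial>lborel)"
  proof (rule nn_integral_monotone_convergence_SUP)
    show "incseq (\<lambda>k y. ennreal (?g k y * ?p y))"
      by (intro monoI le_funI ennreal_leI mult_right_mono stable_density_nonneg) (auto intro!: mult_right_mono divide_left_mono simp: frac_le)
  qed measurable
  also have "\<dots> = (SUP k. ennreal (E k))"
  proof -
    have "(\<integral>\<^sup>+y. ennreal (?g k y * ?p y) \<partial>lborel) = ennreal (E k)" for k
      unfolding pgE[symmetric] by (rule nn_integral_eq_integral[OF pg]) (simp add: stable_density_nonneg)
    then show ?thesis by (simp only:)
  qed
  also have "\<dots> = 1"
  proof -
    have "incseq (\<lambda>k. ennreal (E k))"
    proof (rule monoI)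
      fix i j :: nat assume "i \<le> j"
      have "E i \<le> E j"
        unfolding pgE[symmetric]
        by (intro integral_mono pg mult_right_mono stable_density_nonneg) (use \<open>i \<le> j\<close> in \<open>auto intro!: mult_right_mono divide_left_mono simp: frac_le\<close>)
      then show "ennreal (E i) \<le> ennreal (E j)" by (rule ennreal_leI)
    qed
    moreover have "(\<lambda>k. ennreal (E k)) \<longlonglongrightarrow> ennreal 1" by (intro tendsto_ennrealI E1)
    ultimately show ?thesis using LIMSEQ_SUP LIMSEQ_unique by fastforce
  qed
  finally show ?thesis .
qed

text \<open>A reverse Poincare inequality: a local variance bounds an energy from above. It is the
  limit of \<open>approx_kernel_reverse_poincare\<close>, where \<open>n\<close> times the mixture
  density becomes the stable jump density; a second limit, with the weight now fixed, removes the
  Gaussian smoothing.\<close>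

theorem stable_reverse_poincare:
  fixes g :: "'a::euclidean_space \<Rightarrow> real"
  assumes g: "bounded_borel g" "integrable lborel g" "integrable lborel (\<lambda>x. (g x)\<^sup>2)"
  defines "P \<equiv> kernel_mean (stable_density \<alpha> \<eta>)"
  shows "(\<integral>\<^sup>+z. ennreal ((P g (x + z) - P g x)\<^sup>2 * (\<eta> * fractional_const DIM('a) \<alpha> / norm z powr (DIM('a) + \<alpha>))) \<partial>lborel)
           \<le> ennreal (P (\<lambda>x. (g x)\<^sup>2) x - (P g x)\<^sup>2)"
proof -
  let ?R = "\<lambda>z::'a. \<eta> * fractional_const DIM('a) \<alpha> / norm z powr (DIM('a) + \<alpha>)"
  have U: "0 < cutoff (Suc n)" for n by (rule stable_cutoff_pos[OF beta \<eta>]) simp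
  have smooth: "(\<integral>\<^sup>+z. ennreal ((kernel_mean (smooth_kernel v) g (x + z) - kernel_mean (smooth_kernel v) g x)\<^sup>2 * ?R z) \<partial>lborel)
           \<le> ennreal (kernel_mean (smooth_kernel v) (\<lambda>x. (g x)\<^sup>2) x - (kernel_mean (smooth_kernel v) g x)\<^sup>2)" if v: "0 < v" for v
  proof -
  define B where "B = (1 / (2 * pi) ^ DIM('a)) * (\<integral>\<xi>. exp (- (1 / v) * (norm (\<xi>::'a))\<^sup>2) \<partial>lborel)"
  have B: "\<bar>approx_kernel \<beta> (cutoff (Suc n)) v j y\<bar> \<le> B" for n j and y :: 'a
    unfolding B_def by (rule approx_kernel_le[OF beta U v])
  show ?thesis
  \<comment> \<open>The index is shifted by \<open>Suc\<close> because the cutoff vanishes at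
    0.\<close>
  proof (rule reverse_poincare_limit[where K="\<lambda>n. approx_kernel \<beta> (cutoff (Suc n)) v (Suc n)" and K'="\<lambda>n. approx_kernel \<beta> (cutoff (Suc n)) v n"
        and r="\<lambda>n z. real (Suc n) * mix_kernel \<beta> (cutoff (Suc n)) z" and B=B])
    fix z :: 'a assume "z \<noteq> 0"
    from LIMSEQ_Suc[OF mix_kernel_tendsto[OF beta \<eta> this]]
    show "(\<lambda>n. real (Suc n) * mix_kernel \<beta> (cutoff (Suc n)) z) \<longlonglongrightarrow> ?R z"
      by (simp del: of_nat_Suc)
  next
    show "(\<lambda>z::'a. real (Suc n) * mix_kernel \<beta> (cutoff (Suc n)) z) \<in> borel_measurable borel" for n
      using mix_kernel_measurable[OF beta U] by measurable
  qed (use g in \<open>auto intro!: approx_kernel_measurable[OF beta U v] B approx_kernel_tendsto[OF v]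
        approx_kernel_reverse_poincare[OF beta U v] simp del: of_nat_Suc\<close>)
  qed
  obtain B where B: "\<And>n y. \<bar>smooth_kernel (real (Suc n)) (y::'a)\<bar> \<le> B"
  proof
    show "\<bar>smooth_kernel (real (Suc n)) (y::'a)\<bar> \<le> (1 / (2 * pi) ^ DIM('a)) * (\<integral>\<xi>. exp (- \<eta> * norm (\<xi>::'a) powr \<alpha>) \<partial>lborel)" for n y
      unfolding smooth_kernel_def
    proof (rule inv_fourier_le[OF _ integrable_stable_symbol])
      show le: "\<bar>exp (- (1 / real (Suc n)) * (norm \<xi>)\<^sup>2) * exp (- \<eta> * norm \<xi> powr \<alpha>)\<bar> \<le> exp (- \<eta> * norm \<xi> powr \<alpha>)" for \<xi> :: 'a
        by (simp add: abs_mult mult_le_cancel_right1)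
      show "integrable lborel (\<lambda>\<xi>::'a. exp (- (1 / real (Suc n)) * (norm \<xi>)\<^sup>2) * exp (- \<eta> * norm \<xi> powr \<alpha>))"
        by (rule Bochner_Integration.integrable_bound[OF integrable_stable_symbol]) (use le in auto)
    qed
  qed
  show ?thesis
    unfolding P_def
  proof (rule reverse_poincare_limit[where K="\<lambda>n. smooth_kernel (real (Suc n))" and K'="\<lambda>n. smooth_kernel (real (Suc n))" and r="\<lambda>_. ?R" and B=B])
    show "(\<integral>\<^sup>+z. ennreal ((kernel_mean (smooth_kernel (real (Suc n))) g (x + z) - kernel_mean (smooth_kernel (real (Suc n))) g x)\<^sup>2 * ?R z) \<partial>lborel)
           \<le> ennreal (kernel_mean (smooth_kernel (real (Suc n))) (\<lambda>x. (g x)\<^sup>2) x - (kernel_mean (smooth_kernel (real (Suc n))) g x)\<^sup>2)" for n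
      by (rule smooth) simp
  qed (use g in \<open>auto intro!: B smooth_kernel_tendsto simp del: of_nat_Suc\<close>)
qed

end

section \<open>Total variation and Markov kernels\<close>

text \<open>Mass at most 1, because the normalising integral of the exact oracle is not shown to be
  positive: where it vanishes, \<open>x / 0 = 0\<close> makes the oracle the zero density.\<close>

definition borel_subprob :: "'a::euclidean_space measure \<Rightarrow> bool" where
  "borel_subprob M \<longleftrightarrow> subprob_space M \<and> sets M = sets borel"

section \<open>Total variation as a supremum over Borel sets\<close>

lemma abs_measure_diff_le_1:
  assumes "borel_subprob M" "borel_subprob N"
  shows "\<bar>measure M A - measure N A\<bar> \<le> 1"
proof -
  have "measure M A \<le> 1" "measure N A \<le> 1"
    using assms by (auto simp: borel_subprob_def intro: subprob_space.subprob_measure_le_1)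
  then show ?thesis using measure_nonneg[of M A] measure_nonneg[of N A] by linarith
qed

lemma tv_dist_upper:
  assumes "borel_subprob M" "borel_subprob N" "A \<in> sets borel"
  shows "\<bar>measure M A - measure N A\<bar> \<le> tv_dist M N"
  unfolding tv_dist_def
  by (rule cSUP_upper[OF assms(3)]) (use abs_measure_diff_le_1[OF assms(1,2)] in \<open>auto intro!: bdd_aboveI2\<close>)

lemma tv_dist_least:
  assumes "\<And>A. A \<in> sets borel \<Longrightarrow> \<bar>measure M A - measure N A\<bar> \<le> c"
  shows "tv_dist M N \<le> c"
  unfolding tv_dist_def by (rule cSUP_least) (use assms in auto)

lemma tv_dist_nonneg:
  assumes "borel_subprob M" "borel_subprob N" shows "0 \<le> tv_dist M N"
  using tv_dist_upper[OF assms, of "{}"] by simp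

lemma tv_dist_self: "tv_dist M M \<le> 0"
  by (rule tv_dist_least) simp

lemma tv_dist_triangle:
  assumes "borel_subprob L" "borel_subprob M" "borel_subprob N"
  shows "tv_dist L N \<le> tv_dist L M + tv_dist M N"
proof (rule tv_dist_least)
  fix A :: "'a set" assume A: "A \<in> sets borel"
  show "\<bar>measure L A - measure N A\<bar> \<le> tv_dist L M + tv_dist M N"
    using tv_dist_upper[OF assms(1,2) A] tv_dist_upper[OF assms(2,3) A] by linarith
qed

text \<open>\<open>f x\<close> is the length of \<open>{0..<f x}\<close>; Fubini on the region
  \<open>t < f x\<close> exchanges the level \<open>t\<close> with the point
  \<open>x\<close>.\<close>

lemma integral_layer_cake:
  fixes f :: "'a::euclidean_space \<Rightarrow> real"
  assumes M: "borel_subprob M" and [measurable]: "f \<in> borel_measurable borel" and f: "\<And>x. 0 \<le> f x" "\<And>x. f x \<le> 1"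
  shows "(\<integral>x. f x \<partial>M) = (\<integral>t. measure M {x. t < f x} * indicator {0..1} t \<partial>lborel)"
    and "integrable lborel (\<lambda>t. measure M {x. t < f x} * indicator {0..1} t)"
proof -
  interpret subprob_space M using M by (simp add: borel_subprob_def)
  note [measurable_cong] = M[unfolded borel_subprob_def, THEN conjunct2]
  have space: "space M = UNIV" using M sets_eq_imp_space_eq[of M borel] by (simp add: borel_subprob_def)
  interpret P: pair_sigma_finite M "lborel :: real measure" by standard
  let ?h = "\<lambda>(x, t). indicator {0..1} t * (if t < f x then 1 else 0 :: real)"
  have int: "integrable (M \<Otimes>\<^sub>M lborel) ?h"
  proof (rule integrableI_bounded)
    have "(\<integral>\<^sup>+p. ennreal (norm (?h p)) \<partial>(M \<Otimes>\<^sub>M lborel)) = (\<integral>\<^sup>+x. \<integral>\<^sup>+t. ennreal (norm (?h (x, t))) \<partial>lborel \<partial>M)"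
      by (rule lborel.nn_integral_fst[symmetric]) measurable
    also have "\<dots> \<le> (\<integral>\<^sup>+x. \<integral>\<^sup>+t. indicator {0..1::real} t \<partial>lborel \<partial>M)"
      by (intro nn_integral_mono) (auto simp: indicator_def)
    also have "\<dots> < \<infinity>" using emeasure_space_le_1 by (simp add: le_less_trans)
    finally show "(\<integral>\<^sup>+p. ennreal (norm (?h p)) \<partial>(M \<Otimes>\<^sub>M lborel)) < \<infinity>" .
  qed measurable
  have i1: "(\<integral>t. ?h (x, t) \<partial>lborel) = f x" for x
  proof -
    have "(\<integral>t. ?h (x, t) \<partial>lborel) = (\<integral>t. indicator {0..<f x} t \<partial>lborel)"
      using f[of x] by (intro Bochner_Integration.integral_cong) (auto simp: indicator_def)
    then show ?thesis using f[of x] by simp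
  qed
  have i2: "(\<integral>x. ?h (x, t) \<partial>M) = measure M {x. t < f x} * indicator {0..1} t" for t
  proof -
    have "(\<integral>x. ?h (x, t) \<partial>M) = (\<integral>x. indicator {0..1} t * indicator {x. t < f x} x \<partial>M)"
      by (intro Bochner_Integration.integral_cong) (auto simp: indicator_def)
    also have "\<dots> = indicator {0..1} t * measure M ({x. t < f x} \<inter> space M)"
      by simp
    finally show ?thesis by (simp add: space mult.commute)
  qed
  show "(\<integral>x. f x \<partial>M) = (\<integral>t. measure M {x. t < f x} * indicator {0..1} t \<partial>lborel)"
    using P.Fubini_integral[of "\<lambda>x t. ?h (x, t)"] int by (simp only: i1 i2 case_prod_eta)
  show "integrable lborel (\<lambda>t. measure M {x. t < f x} * indicator {0..1} t)"
    using P.integrable_snd[of "\<lambda>x t. ?h (x, t)"] int by (simp only: i2 case_prod_eta)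
qed

text \<open>Each level set of \<open>f\<close> is a set tested by \<open>tv_dist\<close>, and
  averaging over levels in \<open>{0..1}\<close> costs no constant, even when the two masses
  differ.\<close>

lemma integral_diff_le_tv_dist:
  fixes f :: "'a::euclidean_space \<Rightarrow> real"
  assumes M: "borel_subprob M" and N: "borel_subprob N"
    and [measurable]: "f \<in> borel_measurable borel" and f: "\<And>x. 0 \<le> f x" "\<And>x. f x \<le> 1"
  shows "\<bar>(\<integral>x. f x \<partial>M) - (\<integral>x. f x \<partial>N)\<bar> \<le> tv_dist M N"
proof -
  note lM = integral_layer_cake[OF M assms(3) f] and lN = integral_layer_cake[OF N assms(3) f]
  have "\<bar>(\<integral>x. f x \<partial>M) - (\<integral>x. f x \<partial>N)\<bar>
      = \<bar>\<integral>t. measure M {x. t < f x} * indicator {0..1} t - measure N {x. t < f x} * indicator {0..1} t \<partial>lborel\<bar>"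
    unfolding lM(1) lN(1) by (subst Bochner_Integration.integral_diff[OF lM(2) lN(2)]) simp
  also have "\<dots> \<le> (\<integral>t. \<bar>measure M {x. t < f x} * indicator {0..1} t - measure N {x. t < f x} * indicator {0..1} t\<bar> \<partial>lborel)"
    by (rule integral_abs_bound)
  also have "\<dots> \<le> (\<integral>t. tv_dist M N * indicator {0..1::real} t \<partial>lborel)"
  proof (rule integral_mono)
    show "integrable lborel (\<lambda>t. \<bar>measure M {x. t < f x} * indicator {0..1} t - measure N {x. t < f x} * indicator {0..1} t\<bar>)"
      by (intro integrable_abs Bochner_Integration.integrable_diff lM lN)
    show "integrable lborel (\<lambda>t. tv_dist M N * indicator {0..1::real} t)" by simp
    fix t :: real
    have "{x. t < f x} \<in> sets borel" by measurable
    from tv_dist_upper[OF M N this]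
    show "\<bar>measure M {x. t < f x} * indicator {0..1} t - measure N {x. t < f x} * indicator {0..1} t\<bar> \<le> tv_dist M N * indicator {0..1} t"
      by (auto simp: indicator_def)
  qed
  also have "\<dots> = tv_dist M N" by simp
  finally show ?thesis .
qed

section \<open>Sub-Markov kernels and their densities\<close>

lemma borel_subprob_kernel:
  assumes "K \<in> borel \<rightarrow>\<^sub>M subprob_algebra borel"
  shows "borel_subprob (K x)"
  using subprob_space_kernel[OF assms, of x] sets_kernel[OF assms, of x] by (simp add: borel_subprob_def)

lemma measurable_borel_subprob:
  assumes "borel_subprob M" "K \<in> borel \<rightarrow>\<^sub>M L" shows "K \<in> M \<rightarrow>\<^sub>M L"
  using assms measurable_cong_sets[of M borel L L] by (simp add: borel_subprob_def)

lemma borel_subprob_bind: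
  fixes K :: "'a::euclidean_space \<Rightarrow> 'a measure"
  assumes M: "borel_subprob M" and K: "K \<in> borel \<rightarrow>\<^sub>M subprob_algebra borel"
  shows "borel_subprob (Giry_Monad.bind M K)"
proof -
  have "space M \<noteq> {}" using M sets_eq_imp_space_eq[of M borel] by (simp add: borel_subprob_def)
  then have "sets (Giry_Monad.bind M K) = sets borel"
    by (intro sets_bind) (auto simp: sets_kernel[OF K])
  moreover have "subprob_space (Giry_Monad.bind M K)"
    using M by (intro subprob_space_bind[OF _ measurable_borel_subprob[OF M K]]) (simp add: borel_subprob_def)
  ultimately show ?thesis by (simp add: borel_subprob_def)
qed

text \<open>Passes through \<open>N\<close> followed by \<open>K\<close>. Replacing \<open>M\<close>
  by \<open>N\<close> under the test function \<open>measure (K y) A\<close> costs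
  \<open>tv_dist M N\<close>; replacing \<open>K\<close> by \<open>L\<close> under \<open>N\<close>
  costs at most \<open>c\<close>. With \<open>K = L\<close> and \<open>c = 0\<close> this is the
  contraction property.\<close>

lemma tv_dist_bind_le:
  fixes K L :: "'a::euclidean_space \<Rightarrow> 'a measure"
  assumes M: "borel_subprob M" and N: "borel_subprob N"
    and K: "K \<in> borel \<rightarrow>\<^sub>M subprob_algebra borel" and L: "L \<in> borel \<rightarrow>\<^sub>M subprob_algebra borel"
    and KL: "\<And>y. tv_dist (K y) (L y) \<le> c"
  shows "tv_dist (Giry_Monad.bind M K) (Giry_Monad.bind N L) \<le> tv_dist M N + c"
proof (rule tv_dist_least)
  fix A :: "'a set" assume A: "A \<in> sets borel"
  interpret M: subprob_space M using M by (simp add: borel_subprob_def)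
  interpret N: subprob_space N using N by (simp add: borel_subprob_def)
  note [measurable_cong] = M[unfolded borel_subprob_def, THEN conjunct2] N[unfolded borel_subprob_def, THEN conjunct2]
  have mK: "(\<lambda>y. measure (K y) A) \<in> borel_measurable borel" and mL: "(\<lambda>y. measure (L y) A) \<in> borel_measurable borel"
    using measurable_compose[OF K measurable_measure_subprob_algebra[OF A]]
       measurable_compose[OF L measurable_measure_subprob_algebra[OF A]] by auto
  note [measurable] = mK mL
  have K1: "measure (K y) A \<le> 1" and L1: "measure (L y) A \<le> 1" for y
    using borel_subprob_kernel[OF K, of y] borel_subprob_kernel[OF L, of y]
    by (auto simp: borel_subprob_def intro: subprob_space.subprob_measure_le_1)
  have c: "0 \<le> c"
    using tv_dist_nonneg[OF borel_subprob_kernel[OF K] borel_subprob_kernel[OF L]] KL by (rule order_trans)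
  have iK: "integrable N (\<lambda>y. measure (K y) A)" and iL: "integrable N (\<lambda>y. measure (L y) A)"
    by (rule N.integrable_const_bound[where B=1], use K1 L1 in auto)+
  have "\<bar>(\<integral>y. measure (K y) A \<partial>N) - (\<integral>y. measure (L y) A \<partial>N)\<bar> = \<bar>\<integral>y. measure (K y) A - measure (L y) A \<partial>N\<bar>"
    by (subst Bochner_Integration.integral_diff[OF iK iL]) simp
  also have "\<dots> \<le> (\<integral>y. \<bar>measure (K y) A - measure (L y) A\<bar> \<partial>N)"
    by (rule integral_abs_bound)
  also have "\<dots> \<le> (\<integral>y. c \<partial>N)"
    by (intro integral_mono integrable_abs Bochner_Integration.integrable_diff iK iL)
       (auto intro: order_trans[OF tv_dist_upper[OF borel_subprob_kernel[OF K] borel_subprob_kernel[OF L] A] KL])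
  also have "\<dots> \<le> c"
    using c N.subprob_measure_le_1[of "space N"] by (simp add: mult_left_le_one_le)
  finally have 1: "\<bar>(\<integral>y. measure (K y) A \<partial>N) - (\<integral>y. measure (L y) A \<partial>N)\<bar> \<le> c" .
  have 2: "\<bar>(\<integral>y. measure (K y) A \<partial>M) - (\<integral>y. measure (K y) A \<partial>N)\<bar> \<le> tv_dist M N"
    by (rule integral_diff_le_tv_dist[OF M N mK]) (use K1 in auto)
  have 3: "measure (Giry_Monad.bind M K) A = (\<integral>y. measure (K y) A \<partial>M)"
    by (rule M.measure_bind[OF measurable_borel_subprob[OF M K] A])
  have 4: "measure (Giry_Monad.bind N L) A = (\<integral>y. measure (L y) A \<partial>N)"
    by (rule N.measure_bind[OF measurable_borel_subprob[OF N L] A])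
  show "\<bar>measure (Giry_Monad.bind M K) A - measure (Giry_Monad.bind N L) A\<bar> \<le> tv_dist M N + c"
    unfolding 3 4 using 1 2 by linarith
qed

lemma measurable_density_kernel:
  fixes f :: "'a::euclidean_space \<Rightarrow> 'a \<Rightarrow> real"
  assumes [measurable]: "(\<lambda>(x, y). f x y) \<in> borel_measurable (borel \<Otimes>\<^sub>M borel)"
    and f: "\<And>x. (\<integral>\<^sup>+y. ennreal (f x y) \<partial>lborel) \<le> 1"
  shows "(\<lambda>x. law_of (f x)) \<in> borel \<rightarrow>\<^sub>M subprob_algebra borel"
proof (rule measurable_subprob_algebra)
  show "subprob_space (law_of (f x))" for x
    by (rule subprob_spaceI) (use f[of x] in \<open>auto simp: law_of_def emeasure_density\<close>)
  show "sets (law_of (f x)) = sets borel" for x by (simp add: law_of_def)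
  show "(\<lambda>x. emeasure (law_of (f x)) A) \<in> borel_measurable borel" if [measurable]: "A \<in> sets borel" for A
  proof -
    have "emeasure (law_of (f x)) A = (\<integral>\<^sup>+y. ennreal (f x y) * indicator A y \<partial>lborel)" for x
      unfolding law_of_def by (rule emeasure_density) auto
    then show ?thesis by simp
  qed
qed

lemma bind_density_kernel:
  fixes f :: "'a::euclidean_space \<Rightarrow> 'a \<Rightarrow> real"
  assumes f[measurable]: "(\<lambda>(x, y). f x y) \<in> borel_measurable (borel \<Otimes>\<^sub>M borel)"
    and f1: "\<And>x. (\<integral>\<^sup>+y. ennreal (f x y) \<partial>lborel) \<le> 1"
    and [measurable]: "h \<in> borel_measurable borel"
  shows "Giry_Monad.bind (density lborel h) (\<lambda>x. law_of (f x))
           = density lborel (\<lambda>y. \<integral>\<^sup>+x. h x * ennreal (f x y) \<partial>lborel)"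
proof (rule measure_eqI)
  have K: "(\<lambda>x. law_of (f x)) \<in> density lborel h \<rightarrow>\<^sub>M subprob_algebra borel"
    using measurable_density_kernel[OF f f1] measurable_cong_sets[of "density lborel h" borel "subprob_algebra borel" "subprob_algebra borel"] by simp
  show sets: "sets (Giry_Monad.bind (density lborel h) (\<lambda>x. law_of (f x))) = sets (density lborel (\<lambda>y. \<integral>\<^sup>+x. h x * ennreal (f x y) \<partial>lborel))"
    by (subst sets_bind[where N=borel]) (auto simp: law_of_def)
  fix A assume "A \<in> sets (Giry_Monad.bind (density lborel h) (\<lambda>x. law_of (f x)))"
  then have A[measurable]: "A \<in> sets borel" unfolding sets by simp
  have "emeasure (Giry_Monad.bind (density lborel h) (\<lambda>x. law_of (f x))) A
     = (\<integral>\<^sup>+x. emeasure (law_of (f x)) A \<partial>density lborel h)"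
    by (rule emeasure_bind[OF _ K A]) simp
  also have "\<dots> = (\<integral>\<^sup>+x. (\<integral>\<^sup>+y. ennreal (f x y) * indicator A y \<partial>lborel) \<partial>density lborel h)"
    unfolding law_of_def by (intro nn_integral_cong emeasure_density) auto
  also have "\<dots> = (\<integral>\<^sup>+x. h x * (\<integral>\<^sup>+y. ennreal (f x y) * indicator A y \<partial>lborel) \<partial>lborel)"
    by (rule nn_integral_density) measurable
  also have "\<dots> = (\<integral>\<^sup>+x. (\<integral>\<^sup>+y. h x * ennreal (f x y) * indicator A y \<partial>lborel) \<partial>lborel)"
    by (intro nn_integral_cong, subst nn_integral_cmult[symmetric]) (auto simp: mult.assoc)
  also have "\<dots> = (\<integral>\<^sup>+y. (\<integral>\<^sup>+x. h x * ennreal (f x y) * indicator A y \<partial>lborel) \<partial>lborel)"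
    by (rule lborel_pair.Fubini'[symmetric]) measurable
  also have "\<dots> = (\<integral>\<^sup>+y. (\<integral>\<^sup>+x. h x * ennreal (f x y) \<partial>lborel) * indicator A y \<partial>lborel)"
    by (intro nn_integral_cong nn_integral_multc) measurable
  also have "\<dots> = emeasure (density lborel (\<lambda>y. \<integral>\<^sup>+x. h x * ennreal (f x y) \<partial>lborel)) A"
    by (rule emeasure_density[symmetric]) measurable
  finally show "emeasure (Giry_Monad.bind (density lborel h) (\<lambda>x. law_of (f x))) A
     = emeasure (density lborel (\<lambda>y. \<integral>\<^sup>+x. h x * ennreal (f x y) \<partial>lborel)) A" .
qed

section \<open>Contraction of the exact sampler\<close>

locale stable_proximal =
  fixes \<alpha> \<eta> :: real and \<pi>X :: "'a::euclidean_space \<Rightarrow> real"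
  assumes \<alpha>: "0 < \<alpha>" "\<alpha> < 2" and \<eta>: "0 < \<eta>" and \<pi>X: "prob_density \<pi>X"
begin

section \<open>The target, its noised marginal and the two kernels\<close>

abbreviation "p \<equiv> (stable_density \<alpha> \<eta> :: 'a \<Rightarrow> real)"

lemma p_measurable[measurable]: "p \<in> borel_measurable borel"
  by (rule stable_density_measurable[OF \<alpha> \<eta>])

lemma \<pi>_measurable[measurable]: "\<pi>X \<in> borel_measurable borel"
  using \<pi>X by (simp add: prob_density_def)

lemma p_nonneg: "0 \<le> p z" by (rule stable_density_nonneg[OF \<alpha> \<eta>])

lemma \<pi>_nonneg: "0 \<le> \<pi>X x" using \<pi>X by (simp add: prob_density_def)

lemma nn_integral_\<pi>: "(\<integral>\<^sup>+x. ennreal (\<pi>X x) \<partial>lborel) = 1" using \<pi>X by (simp add: prob_density_def)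

lemma nn_integral_p: "(\<integral>\<^sup>+y. ennreal (p (y - x)) \<partial>lborel) = 1" "(\<integral>\<^sup>+x. ennreal (p (y - x)) \<partial>lborel) = 1"
  using nn_integral_lborel_translate[of "\<lambda>z. ennreal (p z)" "- x"] nn_integral_lborel_reflect[of "\<lambda>z. ennreal (p z)" y]
    nn_integral_stable_density[OF \<alpha> \<eta>] by simp_all

lemma integrable_\<pi>: "integrable lborel \<pi>X"
  by (rule integrableI_nonneg) (auto simp: \<pi>_nonneg nn_integral_\<pi>)

definition \<pi>Y :: "'a \<Rightarrow> real" where
  "\<pi>Y y = (\<integral>x. \<pi>X x * p (y - x) \<partial>lborel)"

lemma \<pi>Y_measurable[measurable]: "\<pi>Y \<in> borel_measurable borel"
  unfolding \<pi>Y_def[abs_def] by measurable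

lemma \<pi>Y_nonneg: "0 \<le> \<pi>Y y"
  unfolding \<pi>Y_def by (intro Bochner_Integration.integral_nonneg mult_nonneg_nonneg \<pi>_nonneg p_nonneg)

lemma \<pi>Y_eq: "ennreal (\<pi>Y y) = (\<integral>\<^sup>+x. ennreal (\<pi>X x) * ennreal (p (y - x)) \<partial>lborel)"
proof -
  obtain B where B: "\<And>z. \<bar>p z\<bar> \<le> B" using stable_density_bounded[OF \<alpha> \<eta>] by blast
  have "integrable lborel (\<lambda>x. \<pi>X x * p (y - x))"
    by (rule integrable_mult_bounded[OF integrable_\<pi> _ B]) measurable
  then show ?thesis
    unfolding \<pi>Y_def by (subst nn_integral_eq_integral[symmetric]) (auto simp: \<pi>_nonneg p_nonneg ennreal_mult)
qed

lemma oracle_eq: "restricted_stable_oracle \<alpha> \<eta> \<pi>X y x = \<pi>X x * p (y - x) / \<pi>Y y"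
  by (simp add: restricted_stable_oracle_def stable_transition_def \<pi>Y_def)

lemma transition_measurable: "(\<lambda>(x, y). stable_transition \<alpha> \<eta> x (y::'a)) \<in> borel_measurable (borel \<Otimes>\<^sub>M borel)"
  unfolding stable_transition_def by measurable

lemma nn_integral_transition: "(\<integral>\<^sup>+y. ennreal (stable_transition \<alpha> \<eta> x (y::'a)) \<partial>lborel) \<le> 1"
  unfolding stable_transition_def by (simp add: nn_integral_p)

lemma oracle_measurable: "(\<lambda>(y, x). restricted_stable_oracle \<alpha> \<eta> \<pi>X y x) \<in> borel_measurable (borel \<Otimes>\<^sub>M borel)"
  unfolding oracle_eq by measurable

lemma ennreal_oracle:
  "ennreal (restricted_stable_oracle \<alpha> \<eta> \<pi>X y x) = ennreal (1 / \<pi>Y y) * (ennreal (\<pi>X x) * ennreal (p (y - x)))"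
  unfolding oracle_eq using \<pi>Y_nonneg[of y] \<pi>_nonneg[of x] p_nonneg[of "y - x"]
  by (simp add: ennreal_mult[symmetric])

lemma nn_integral_oracle: "(\<integral>\<^sup>+x. ennreal (restricted_stable_oracle \<alpha> \<eta> \<pi>X y x) \<partial>lborel) \<le> 1"
proof -
  have "(\<integral>\<^sup>+x. ennreal (restricted_stable_oracle \<alpha> \<eta> \<pi>X y x) \<partial>lborel) = ennreal (1 / \<pi>Y y) * ennreal (\<pi>Y y)"
    unfolding ennreal_oracle \<pi>Y_eq by (rule nn_integral_cmult) measurable
  \<comment> \<open>Equality holds unless \<open>\<pi>Y y = 0\<close>, where the left side is
    0.\<close>
  also have "\<dots> \<le> 1" using \<pi>Y_nonneg[of y] by (cases "\<pi>Y y = 0") (auto simp: ennreal_mult[symmetric])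
  finally show ?thesis .
qed

lemmas transition_kernel = measurable_density_kernel[OF transition_measurable nn_integral_transition]
lemmas exact_oracle_kernel = measurable_density_kernel[OF oracle_measurable nn_integral_oracle]

text \<open>With \<open>F\<close> the density of \<open>x\<^sub>k\<close> relative to \<open>\<pi>X\<close>, \<open>backward F\<close> is the density of \<open>y\<^sub>k\<close> relative to \<open>\<pi>Y\<close>
  and \<open>forward (backward F)\<close> that of \<open>x\<^sub>k\<^sub>+\<^sub>1\<close> relative to \<open>\<pi>X\<close>.\<close>

definition backward :: "('a \<Rightarrow> ennreal) \<Rightarrow> 'a \<Rightarrow> ennreal" where
  "backward F y = (\<integral>\<^sup>+x. ennreal (\<pi>X x) * F x * ennreal (p (y - x)) \<partial>lborel) * ennreal (1 / \<pi>Y y)"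

definition forward :: "('a \<Rightarrow> ennreal) \<Rightarrow> 'a \<Rightarrow> ennreal" where
  "forward G x = (\<integral>\<^sup>+y. G y * ennreal (p (y - x)) \<partial>lborel)"

lemma backward_measurable[measurable]:
  assumes [measurable]: "F \<in> borel_measurable borel" shows "backward F \<in> borel_measurable borel"
  unfolding backward_def[abs_def] by measurable

lemma forward_measurable[measurable]:
  assumes [measurable]: "G \<in> borel_measurable borel" shows "forward G \<in> borel_measurable borel"
  unfolding forward_def[abs_def] by measurable

text \<open>The oracle density carries the factor \<open>\<pi>X x\<close>, which leaves the integral
  over \<open>y\<close>; so the law keeps the form of \<open>\<pi>X\<close> times a relative
  density.\<close>

lemma exact_step:
  assumes [measurable]: "F \<in> borel_measurable borel"
  shows "Giry_Monad.bind (Giry_Monad.bind (density lborel (\<lambda>x. ennreal (\<pi>X x) * F x)) (\<lambda>x. law_of (stable_transition \<alpha> \<eta> x)))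
            (\<lambda>y. law_of (restricted_stable_oracle \<alpha> \<eta> \<pi>X y))
          = density lborel (\<lambda>x. ennreal (\<pi>X x) * forward (backward F) x)"
proof -
  let ?N = "\<lambda>y. \<integral>\<^sup>+x. ennreal (\<pi>X x) * F x * ennreal (stable_transition \<alpha> \<eta> x y) \<partial>lborel"
  note [measurable] = transition_measurable
  have "Giry_Monad.bind (Giry_Monad.bind (density lborel (\<lambda>x. ennreal (\<pi>X x) * F x)) (\<lambda>x. law_of (stable_transition \<alpha> \<eta> x)))
            (\<lambda>y. law_of (restricted_stable_oracle \<alpha> \<eta> \<pi>X y))
      = Giry_Monad.bind (density lborel ?N) (\<lambda>y. law_of (restricted_stable_oracle \<alpha> \<eta> \<pi>X y))"
    by (subst bind_density_kernel[OF transition_measurable nn_integral_transition]) auto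
  also have "\<dots> = density lborel (\<lambda>x. \<integral>\<^sup>+y. ?N y * ennreal (restricted_stable_oracle \<alpha> \<eta> \<pi>X y x) \<partial>lborel)"
    by (rule bind_density_kernel[OF oracle_measurable nn_integral_oracle]) measurable
  also have "(\<lambda>x. \<integral>\<^sup>+y. ?N y * ennreal (restricted_stable_oracle \<alpha> \<eta> \<pi>X y x) \<partial>lborel) = (\<lambda>x. ennreal (\<pi>X x) * forward (backward F) x)"
  proof
    fix x
    have "(\<integral>\<^sup>+y. ?N y * ennreal (restricted_stable_oracle \<alpha> \<eta> \<pi>X y x) \<partial>lborel)
        = (\<integral>\<^sup>+y. ennreal (\<pi>X x) * (backward F y * ennreal (p (y - x))) \<partial>lborel)"
      unfolding ennreal_oracle backward_def stable_transition_def by (intro nn_integral_cong) (simp add: mult_ac)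
    also have "\<dots> = ennreal (\<pi>X x) * forward (backward F) x"
      unfolding forward_def by (rule nn_integral_cmult) measurable
    finally show "(\<integral>\<^sup>+y. ?N y * ennreal (restricted_stable_oracle \<alpha> \<eta> \<pi>X y x) \<partial>lborel) = ennreal (\<pi>X x) * forward (backward F) x" .
  qed
  finally show ?thesis .
qed

text \<open>Dividing by \<open>\<pi>Y y\<close> and multiplying back is harmless where it vanishes:
  there \<open>\<pi>X x * p (y - x)\<close> is 0 for almost every \<open>x\<close>, so the right
  side is 0 as well, even for infinite \<open>F\<close>, since
  \<open>\<infinity> * 0 = 0\<close>.\<close>

lemma backward_\<pi>Y:
  assumes [measurable]: "F \<in> borel_measurable borel"
  shows "backward F y * ennreal (\<pi>Y y) = (\<integral>\<^sup>+x. ennreal (\<pi>X x) * F x * ennreal (p (y - x)) \<partial>lborel)"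
proof (cases "\<pi>Y y = 0")
  case True
  then have "(\<integral>\<^sup>+x. ennreal (\<pi>X x) * ennreal (p (y - x)) \<partial>lborel) = 0" using \<pi>Y_eq[of y] by simp
  then have "AE x in lborel. ennreal (\<pi>X x) * ennreal (p (y - x)) = 0"
    by (subst (asm) nn_integral_0_iff_AE) auto
  then have "AE x in lborel. ennreal (\<pi>X x) * F x * ennreal (p (y - x)) = 0"
    by eventually_elim auto
  then have "(\<integral>\<^sup>+x. ennreal (\<pi>X x) * F x * ennreal (p (y - x)) \<partial>lborel) = 0"
    by (subst nn_integral_0_iff_AE) auto
  with True show ?thesis by simp
next
  case False
  then have "ennreal (1 / \<pi>Y y) * ennreal (\<pi>Y y) = 1" using \<pi>Y_nonneg[of y] by (simp add: ennreal_mult[symmetric])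
  then show ?thesis unfolding backward_def mult.assoc by simp
qed

lemma nn_integral_backward:
  assumes [measurable]: "F \<in> borel_measurable borel"
  shows "(\<integral>\<^sup>+y. backward F y * ennreal (\<pi>Y y) \<partial>lborel) = (\<integral>\<^sup>+x. F x * ennreal (\<pi>X x) \<partial>lborel)"
proof -
  have "(\<integral>\<^sup>+y. backward F y * ennreal (\<pi>Y y) \<partial>lborel) = (\<integral>\<^sup>+y. (\<integral>\<^sup>+x. ennreal (\<pi>X x) * F x * ennreal (p (y - x)) \<partial>lborel) \<partial>lborel)"
    by (simp add: backward_\<pi>Y)
  also have "\<dots> = (\<integral>\<^sup>+x. (\<integral>\<^sup>+y. ennreal (\<pi>X x) * F x * ennreal (p (y - x)) \<partial>lborel) \<partial>lborel)"
    by (rule lborel_pair.Fubini') measurable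
  also have "\<dots> = (\<integral>\<^sup>+x. F x * ennreal (\<pi>X x) \<partial>lborel)"
    by (intro nn_integral_cong, subst nn_integral_cmult) (auto simp: nn_integral_p mult.commute)
  finally show ?thesis .
qed

lemma nn_integral_forward:
  assumes [measurable]: "G \<in> borel_measurable borel"
  shows "(\<integral>\<^sup>+x. forward G x * ennreal (\<pi>X x) \<partial>lborel) = (\<integral>\<^sup>+y. G y * ennreal (\<pi>Y y) \<partial>lborel)"
proof -
  have "(\<integral>\<^sup>+x. forward G x * ennreal (\<pi>X x) \<partial>lborel) = (\<integral>\<^sup>+x. (\<integral>\<^sup>+y. G y * (ennreal (\<pi>X x) * ennreal (p (y - x))) \<partial>lborel) \<partial>lborel)"
    unfolding forward_def by (intro nn_integral_cong, subst nn_integral_multc[symmetric]) (auto simp: mult_ac)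
  also have "\<dots> = (\<integral>\<^sup>+y. (\<integral>\<^sup>+x. G y * (ennreal (\<pi>X x) * ennreal (p (y - x))) \<partial>lborel) \<partial>lborel)"
    by (rule lborel_pair.Fubini'[symmetric]) measurable
  also have "\<dots> = (\<integral>\<^sup>+y. G y * ennreal (\<pi>Y y) \<partial>lborel)"
    unfolding \<pi>Y_eq by (intro nn_integral_cong nn_integral_cmult) measurable
  finally show ?thesis .
qed

text \<open>\<open>backward F y\<close> is the mean of \<open>F\<close> under the law of
  \<open>x\<close> given \<open>y\<close>. Jensen, in the form of Cauchy-Schwarz for the
  unnormalised law \<open>?M\<close> of mass \<open>\<pi>Y y\<close>, bounds its square by the mean
  of the squares, and \<open>nn_integral_backward\<close> integrates this over
  \<open>y\<close>.\<close>

lemma nn_integral_backward_power2_le: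
  assumes [measurable]: "F \<in> borel_measurable borel"
  shows "(\<integral>\<^sup>+y. (backward F y)\<^sup>2 * ennreal (\<pi>Y y) \<partial>lborel) \<le> (\<integral>\<^sup>+x. (F x)\<^sup>2 * ennreal (\<pi>X x) \<partial>lborel)"
proof -
  have "(\<integral>\<^sup>+y. (backward F y)\<^sup>2 * ennreal (\<pi>Y y) \<partial>lborel) \<le> (\<integral>\<^sup>+y. backward (\<lambda>x. (F x)\<^sup>2) y * ennreal (\<pi>Y y) \<partial>lborel)"
  proof (intro nn_integral_mono)
    fix y
    let ?M = "density lborel (\<lambda>x. ennreal (\<pi>X x) * ennreal (p (y - x)))"
    have I: "(\<integral>\<^sup>+x. ennreal (\<pi>X x) * h x * ennreal (p (y - x)) \<partial>lborel) = (\<integral>\<^sup>+x. h x \<partial>?M)" if [measurable]: "h \<in> borel_measurable borel" for h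
      by (subst nn_integral_density) (auto simp: mult_ac)
    show "(backward F y)\<^sup>2 * ennreal (\<pi>Y y) \<le> backward (\<lambda>x. (F x)\<^sup>2) y * ennreal (\<pi>Y y)"
    proof (cases "\<pi>Y y = 0")
      case False
      then have c: "ennreal (\<pi>Y y) * ennreal (1 / \<pi>Y y) = 1" using \<pi>Y_nonneg[of y] by (simp add: ennreal_mult[symmetric])
      have "(\<integral>\<^sup>+x. F x * 1 \<partial>?M)\<^sup>2 \<le> (\<integral>\<^sup>+x. (F x)\<^sup>2 \<partial>?M) * (\<integral>\<^sup>+x. 1\<^sup>2 \<partial>?M)"
        by (rule Cauchy_Schwarz_nn_integral) auto
      also have "(\<integral>\<^sup>+x. 1\<^sup>2 \<partial>?M) = ennreal (\<pi>Y y)"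
        unfolding \<pi>Y_eq by (subst nn_integral_density) auto
      finally have "(\<integral>\<^sup>+x. F x \<partial>?M)\<^sup>2 * ennreal (1 / \<pi>Y y) \<le> ((\<integral>\<^sup>+x. (F x)\<^sup>2 \<partial>?M) * ennreal (\<pi>Y y)) * ennreal (1 / \<pi>Y y)"
        by (intro mult_right_mono) auto
      also have "\<dots> = (\<integral>\<^sup>+x. (F x)\<^sup>2 \<partial>?M)" unfolding mult.assoc c by simp
      finally have *: "(\<integral>\<^sup>+x. F x \<partial>?M)\<^sup>2 * ennreal (1 / \<pi>Y y) \<le> (\<integral>\<^sup>+x. (F x)\<^sup>2 \<partial>?M)" .
      have "(backward F y)\<^sup>2 * ennreal (\<pi>Y y) = ((\<integral>\<^sup>+x. F x \<partial>?M)\<^sup>2 * ennreal (1 / \<pi>Y y)) * (ennreal (\<pi>Y y) * ennreal (1 / \<pi>Y y))"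
        unfolding backward_def I[OF assms] by (simp add: power2_eq_square mult_ac)
      also have "\<dots> \<le> (\<integral>\<^sup>+x. (F x)\<^sup>2 \<partial>?M)" unfolding c using * by simp
      also have "\<dots> = backward (\<lambda>x. (F x)\<^sup>2) y * ennreal (\<pi>Y y)"
        by (subst backward_\<pi>Y) (auto simp: I)
      finally show ?thesis .
    qed simp
  qed
  also have "\<dots> = (\<integral>\<^sup>+x. (F x)\<^sup>2 * ennreal (\<pi>X x) \<partial>lborel)"
    by (rule nn_integral_backward) measurable
  finally show ?thesis .
qed

section \<open>Energy, variance and contraction under the target\<close>

lemma prob_law_of: "prob_space (law_of \<pi>X)"
  by (rule prob_spaceI) (simp add: law_of_def emeasure_density nn_integral_\<pi>)

lemma law_of_integral:
  fixes h :: "'a \<Rightarrow> real"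
  assumes [measurable]: "h \<in> borel_measurable borel" and h: "\<And>x. 0 \<le> h x" "\<And>x. h x \<le> B"
  shows "ennreal (\<integral>x. h x \<partial>law_of \<pi>X) = (\<integral>\<^sup>+x. ennreal (h x) * ennreal (\<pi>X x) \<partial>lborel)"
proof -
  interpret P: prob_space "law_of \<pi>X" by (rule prob_law_of)
  have [measurable_cong]: "sets (law_of \<pi>X) = sets borel" by (simp add: law_of_def)
  have "integrable (law_of \<pi>X) h"
    by (rule P.integrable_const_bound[where B=B]) (use h in auto)
  then have "ennreal (\<integral>x. h x \<partial>law_of \<pi>X) = (\<integral>\<^sup>+x. ennreal (h x) \<partial>law_of \<pi>X)"
    by (intro nn_integral_eq_integral[symmetric]) (auto simp: h)
  also have "\<dots> = (\<integral>\<^sup>+x. ennreal (\<pi>X x) * ennreal (h x) \<partial>lborel)"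
    unfolding law_of_def by (rule nn_integral_density) measurable
  finally show ?thesis by (simp add: mult.commute)
qed

text \<open>The substitution \<open>x = y + z\<close> brings the energy to the form of
  \<open>stable_reverse_poincare\<close>. The restriction to \<open>x \<noteq> y\<close> disappears
  because the integrand is 0 on the diagonal.\<close>

lemma fractional_energy_eq:
  assumes [measurable]: "\<phi> \<in> borel_measurable borel"
  shows "fractional_energy \<alpha> \<pi>X \<phi> = (\<integral>\<^sup>+y. (\<integral>\<^sup>+z. ennreal ((\<phi> (y + z) - \<phi> y)\<^sup>2 * (fractional_const DIM('a) \<alpha> / norm z powr (DIM('a) + \<alpha>))) \<partial>lborel) * ennreal (\<pi>X y) \<partial>lborel)"
proof -
  let ?c = "fractional_const DIM('a) \<alpha>"
  have c: "0 \<le> ?c" unfolding fractional_const_def using \<alpha> by (auto intro!: divide_nonneg_nonneg mult_nonneg_nonneg Gamma_real_nonneg)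
  have in1: "(\<integral>\<^sup>+x\<in>{x. x \<noteq> y}. ennreal ((\<phi> x - \<phi> y)\<^sup>2 / norm (x - y) powr (real DIM('a) + \<alpha>)) \<partial>lborel)
     = (\<integral>\<^sup>+z. ennreal ((\<phi> (y + z) - \<phi> y)\<^sup>2 / norm z powr (real DIM('a) + \<alpha>)) \<partial>lborel)" for y
  proof -
    have "(\<integral>\<^sup>+x\<in>{x. x \<noteq> y}. ennreal ((\<phi> x - \<phi> y)\<^sup>2 / norm (x - y) powr (real DIM('a) + \<alpha>)) \<partial>lborel)
        = (\<integral>\<^sup>+x. ennreal ((\<phi> x - \<phi> y)\<^sup>2 / norm (x - y) powr (real DIM('a) + \<alpha>)) \<partial>lborel)"
      by (intro nn_integral_cong) (auto simp: indicator_def)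
    also have "\<dots> = (\<integral>\<^sup>+z. ennreal ((\<phi> (y + z) - \<phi> y)\<^sup>2 / norm ((y + z) - y) powr (real DIM('a) + \<alpha>)) \<partial>lborel)"
      by (rule nn_integral_lborel_translate[symmetric]) measurable
    finally show ?thesis by simp
  qed
  have in2: "ennreal ?c * ((\<integral>\<^sup>+z. ennreal ((\<phi> (y + z) - \<phi> y)\<^sup>2 / norm z powr (real DIM('a) + \<alpha>)) \<partial>lborel) * ennreal (\<pi>X y))
      = (\<integral>\<^sup>+z. ennreal ((\<phi> (y + z) - \<phi> y)\<^sup>2 * (?c / norm z powr (DIM('a) + \<alpha>))) \<partial>lborel) * ennreal (\<pi>X y)" for y
  proof -
    have "ennreal ?c * (\<integral>\<^sup>+z. ennreal ((\<phi> (y + z) - \<phi> y)\<^sup>2 / norm z powr (real DIM('a) + \<alpha>)) \<partial>lborel)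
       = (\<integral>\<^sup>+z. ennreal ?c * ennreal ((\<phi> (y + z) - \<phi> y)\<^sup>2 / norm z powr (real DIM('a) + \<alpha>)) \<partial>lborel)"
      by (rule nn_integral_cmult[symmetric]) measurable
    also have "\<dots> = (\<integral>\<^sup>+z. ennreal ((\<phi> (y + z) - \<phi> y)\<^sup>2 * (?c / norm z powr (DIM('a) + \<alpha>))) \<partial>lborel)"
      by (intro nn_integral_cong) (simp add: ennreal_mult'[symmetric] c mult_ac)
    finally show ?thesis by (simp add: mult.assoc[symmetric])
  qed
  show ?thesis
    unfolding fractional_energy_def in1 by (subst nn_integral_cmult[symmetric]) (auto simp: in2)
qed

lemma forward_ennreal:
  assumes g: "integrable lborel g" "\<And>x. 0 \<le> g x"
  shows "forward (\<lambda>y. ennreal (g y)) x = ennreal (kernel_mean p g x)"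
proof -
  note [measurable] = measurable_of_integrable[OF g(1)]
  obtain B where B: "\<And>z. \<bar>p z\<bar> \<le> B" using stable_density_bounded[OF \<alpha> \<eta>] by blast
  have "integrable lborel (\<lambda>z. g (x + z) * p z)"
    by (rule integrable_mult_bounded[OF integrable_translate[OF g(1)] _ B]) measurable
  then have "ennreal (kernel_mean p g x) = (\<integral>\<^sup>+z. ennreal (p z * g (x + z)) \<partial>lborel)"
    unfolding kernel_mean_def by (subst nn_integral_eq_integral) (auto simp: g p_nonneg mult.commute)
  also have "\<dots> = (\<integral>\<^sup>+z. (\<lambda>y. ennreal (g y) * ennreal (p (y - x))) (x + z) \<partial>lborel)"
    by (intro nn_integral_cong) (simp add: ennreal_mult g p_nonneg mult.commute)
  also have "\<dots> = forward (\<lambda>y. ennreal (g y)) x"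
    unfolding forward_def by (rule nn_integral_lborel_translate) measurable
  finally show ?thesis ..
qed

text \<open>Let \<open>A\<close>, \<open>S\<close>, \<open>m\<close> be the integrals of
  \<open>P (g\<^sup>2)\<close>, \<open>(P g)\<^sup>2\<close>, \<open>P g\<close> under the target,
  and \<open>E\<close> the energy of \<open>P g\<close>. The reverse Poincare inequality gives
  \<open>\<eta> * E \<le> A - S\<close>, the fractional one
  \<open>S - m\<^sup>2 \<le> C * E\<close>; eliminating \<open>E\<close> gives the claim, as
  \<open>A\<close> and \<open>m\<close> are also the moments of \<open>g\<close> under
  \<open>\<pi>Y\<close>. Moments are left uncentred so that only sums of nonnegative terms occur,
  which suits infinite values.\<close>

lemma forward_contraction_bounded:
  assumes fp: "fractional_poincare \<alpha> \<pi>X C"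
    and g: "integrable lborel g" "\<And>x. 0 \<le> g x" "\<And>x. g x \<le> B" and B: "0 \<le> B"
  shows "ennreal (1 + \<eta> / C) * (\<integral>\<^sup>+x. (forward (\<lambda>y. ennreal (g y)) x)\<^sup>2 * ennreal (\<pi>X x) \<partial>lborel)
     \<le> (\<integral>\<^sup>+y. (ennreal (g y))\<^sup>2 * ennreal (\<pi>Y y) \<partial>lborel) + ennreal (\<eta> / C) * (\<integral>\<^sup>+y. ennreal (g y) * ennreal (\<pi>Y y) \<partial>lborel)\<^sup>2"
proof -
  note [measurable] = measurable_of_integrable[OF g(1)]
  have C: "C > 0" using fp by (simp add: fractional_poincare_def)
  have [measurable_cong]: "sets (law_of \<pi>X) = sets borel" by (simp add: law_of_def)
  interpret P: prob_space "law_of \<pi>X" by (rule prob_law_of)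
  have bb: "bounded_borel g" by (rule bounded_borelI[where B=B]) (use g in auto)
  have g2: "integrable lborel (\<lambda>x. (g x)\<^sup>2)"
    unfolding power2_eq_square by (rule integrable_mult_bounded[OF g(1), where B=B]) (use g in auto)
  let ?P = "kernel_mean p g" and ?Q = "kernel_mean p (\<lambda>x. (g x)\<^sup>2)"
  let ?h = "\<lambda>z. norm (z::'a) powr (DIM('a) + \<alpha>)" and ?c = "fractional_const DIM('a) \<alpha>"
  have fw: "forward (\<lambda>y. ennreal (g y)) x = ennreal (?P x)" "forward (\<lambda>y. ennreal ((g y)\<^sup>2)) x = ennreal (?Q x)" for x
    using forward_ennreal[OF g(1,2)] forward_ennreal[OF g2] by auto
  have P0: "0 \<le> ?P x" "0 \<le> ?Q x" for x
    unfolding kernel_mean_def by (auto intro!: Bochner_Integration.integral_nonneg mult_nonneg_nonneg p_nonneg g)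
  have fB: "forward (\<lambda>y. ennreal (k y)) x \<le> ennreal b" if k: "\<And>y. k y \<le> b" and b: "0 \<le> b" for k x b
  proof -
    have "forward (\<lambda>y. ennreal (k y)) x \<le> (\<integral>\<^sup>+y. ennreal b * ennreal (p (y - x)) \<partial>lborel)"
      unfolding forward_def by (intro nn_integral_mono mult_right_mono ennreal_leI k) auto
    also have "\<dots> = ennreal b" by (subst nn_integral_cmult) (auto simp: nn_integral_p)
    finally show ?thesis .
  qed
  have PB: "?P x \<le> B" for x
  proof -
    have "forward (\<lambda>y. ennreal (g y)) x \<le> ennreal B" by (rule fB[OF g(3) B])
    then show ?thesis using B unfolding fw by (simp add: ennreal_le_iff)
  qed
  have gB2: "(g y)\<^sup>2 \<le> B\<^sup>2" for y using g(2,3) by (intro power_mono) auto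
  have QB: "?Q x \<le> B\<^sup>2" for x
  proof -
    have "forward (\<lambda>y. ennreal ((g y)\<^sup>2)) x \<le> ennreal (B\<^sup>2)" by (rule fB[OF gB2]) simp
    then show ?thesis unfolding fw by (simp add: ennreal_le_iff)
  qed
  have PB2: "(?P x)\<^sup>2 \<le> B\<^sup>2" for x using P0 PB by (intro power_mono)
  have iP: "integrable (law_of \<pi>X) ?P" and iP2: "integrable (law_of \<pi>X) (\<lambda>x. (?P x)\<^sup>2)" and iQ: "integrable (law_of \<pi>X) ?Q"
    by (rule P.integrable_const_bound[where B=B], use P0 PB in auto)
       (rule P.integrable_const_bound[where B="B\<^sup>2"], use P0 PB2 QB in auto)+
  define A S m where "A = (\<integral>x. ?Q x \<partial>law_of \<pi>X)" and "S = (\<integral>x. (?P x)\<^sup>2 \<partial>law_of \<pi>X)" and "m = (\<integral>x. ?P x \<partial>law_of \<pi>X)"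
  have rp: "(\<integral>\<^sup>+z. ennreal ((?P (x + z) - ?P x)\<^sup>2 * (\<eta> * ?c / ?h z)) \<partial>lborel) \<le> ennreal (?Q x - (?P x)\<^sup>2)" for x
    by (rule stable_reverse_poincare[OF \<alpha> \<eta> bb g(1) g2])
  \<comment> \<open>\<open>ennreal\<close> sends negative numbers to 0, so the sign has to be known
    before the integral of the difference can be split.\<close>
  have pos: "0 \<le> ?Q x - (?P x)\<^sup>2" for x
  proof -
    have "(\<integral>\<^sup>+y. ennreal (g y) * 1 \<partial>density lborel (\<lambda>y. ennreal (p (y - x))))\<^sup>2
        \<le> (\<integral>\<^sup>+y. (ennreal (g y))\<^sup>2 \<partial>density lborel (\<lambda>y. ennreal (p (y - x)))) * (\<integral>\<^sup>+y. 1\<^sup>2 \<partial>density lborel (\<lambda>y. ennreal (p (y - x))))"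
      by (rule Cauchy_Schwarz_nn_integral) auto
    then have "(forward (\<lambda>y. ennreal (g y)) x)\<^sup>2 \<le> forward (\<lambda>y. ennreal ((g y)\<^sup>2)) x"
      by (simp add: forward_def nn_integral_density nn_integral_p emeasure_density mult.commute ennreal_power g)
    then show ?thesis unfolding fw using P0 by (simp add: ennreal_power ennreal_le_iff)
  qed
  have "ennreal \<eta> * fractional_energy \<alpha> \<pi>X ?P
      = (\<integral>\<^sup>+x. ennreal \<eta> * ((\<integral>\<^sup>+z. ennreal ((?P (x + z) - ?P x)\<^sup>2 * (?c / ?h z)) \<partial>lborel) * ennreal (\<pi>X x)) \<partial>lborel)"
    by (subst fractional_energy_eq, measurable, subst nn_integral_cmult) auto
  also have "\<dots> = (\<integral>\<^sup>+x. (\<integral>\<^sup>+z. ennreal ((?P (x + z) - ?P x)\<^sup>2 * (\<eta> * ?c / ?h z)) \<partial>lborel) * ennreal (\<pi>X x) \<partial>lborel)"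
  proof (intro nn_integral_cong)
    fix x
    have "ennreal \<eta> * (\<integral>\<^sup>+z. ennreal ((?P (x + z) - ?P x)\<^sup>2 * (?c / ?h z)) \<partial>lborel)
       = (\<integral>\<^sup>+z. ennreal \<eta> * ennreal ((?P (x + z) - ?P x)\<^sup>2 * (?c / ?h z)) \<partial>lborel)"
      by (rule nn_integral_cmult[symmetric]) measurable
    also have "\<dots> = (\<integral>\<^sup>+z. ennreal ((?P (x + z) - ?P x)\<^sup>2 * (\<eta> * ?c / ?h z)) \<partial>lborel)"
      using \<eta> by (intro nn_integral_cong) (simp add: ennreal_mult'[symmetric] mult_ac)
    finally show "ennreal \<eta> * ((\<integral>\<^sup>+z. ennreal ((?P (x + z) - ?P x)\<^sup>2 * (?c / ?h z)) \<partial>lborel) * ennreal (\<pi>X x))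
        = (\<integral>\<^sup>+z. ennreal ((?P (x + z) - ?P x)\<^sup>2 * (\<eta> * ?c / ?h z)) \<partial>lborel) * ennreal (\<pi>X x)"
      by (simp add: mult.assoc[symmetric])
  qed
  also have "\<dots> \<le> (\<integral>\<^sup>+x. ennreal (?Q x - (?P x)\<^sup>2) * ennreal (\<pi>X x) \<partial>lborel)"
    by (intro nn_integral_mono mult_right_mono rp) auto
  also have "\<dots> = ennreal (\<integral>x. ?Q x - (?P x)\<^sup>2 \<partial>law_of \<pi>X)"
  proof (rule law_of_integral[symmetric, where B="B\<^sup>2"])
    show "?Q x - (?P x)\<^sup>2 \<le> B\<^sup>2" for x using QB[of x] zero_le_power2[of "?P x"] by linarith
  qed (use pos in auto)
  also have "(\<integral>x. ?Q x - (?P x)\<^sup>2 \<partial>law_of \<pi>X) = A - S"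
    unfolding A_def S_def by (rule Bochner_Integration.integral_diff[OF iQ iP2])
  finally have en: "ennreal \<eta> * fractional_energy \<alpha> \<pi>X ?P \<le> ennreal (A - S)" .
  have AS: "0 \<le> A - S"
    unfolding A_def S_def by (subst Bochner_Integration.integral_diff[symmetric, OF iQ iP2]) (intro Bochner_Integration.integral_nonneg pos)
  \<comment> \<open>The Poincare inequality is available only on its domain; the reverse inequality
    supplies the finite energy that membership requires.\<close>
  have "ennreal \<eta> * fractional_energy \<alpha> \<pi>X ?P < \<infinity>" by (rule le_less_trans[OF en]) simp
  then have "fractional_energy \<alpha> \<pi>X ?P < \<infinity>"
    using \<eta> by (auto simp: ennreal_mult_less_top)
  then have "?P \<in> fractional_domain \<alpha> \<pi>X"
    unfolding fractional_domain_def using iP2 by simp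
  then have "ennreal (P.variance ?P) \<le> ennreal C * fractional_energy \<alpha> \<pi>X ?P"
    using fp by (simp add: fractional_poincare_def)
  then have "ennreal \<eta> * ennreal (P.variance ?P) \<le> ennreal C * (ennreal \<eta> * fractional_energy \<alpha> \<pi>X ?P)"
    using mult_left_mono[of "ennreal (P.variance ?P)" "ennreal C * fractional_energy \<alpha> \<pi>X ?P" "ennreal \<eta>"] by (simp add: mult_ac)
  also have "\<dots> \<le> ennreal C * ennreal (A - S)" by (intro mult_left_mono en) simp
  finally have "ennreal (\<eta> * P.variance ?P) \<le> ennreal (C * (A - S))"
    using \<eta> C by (simp add: ennreal_mult')
  then have "\<eta> * P.variance ?P \<le> C * (A - S)"
    using C AS by (simp add: ennreal_le_iff)
  moreover have "P.variance ?P = S - m\<^sup>2"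
    unfolding S_def m_def by (rule P.variance_eq[OF iP iP2])
  ultimately have "\<eta> * (S - m\<^sup>2) \<le> C * (A - S)" by simp
  then have "\<eta> / C * (S - m\<^sup>2) \<le> A - S" using C by (simp add: field_simps)
  then have main: "(1 + \<eta> / C) * S \<le> A + \<eta> / C * m\<^sup>2" by (simp add: algebra_simps)
  have eS: "(\<integral>\<^sup>+x. (forward (\<lambda>y. ennreal (g y)) x)\<^sup>2 * ennreal (\<pi>X x) \<partial>lborel) = ennreal S"
    unfolding S_def fw ennreal_power[OF P0(1)] by (rule law_of_integral[symmetric, where B="B\<^sup>2"]) (use PB2 in auto)
  have eA: "(\<integral>\<^sup>+y. (ennreal (g y))\<^sup>2 * ennreal (\<pi>Y y) \<partial>lborel) = ennreal A"
    unfolding A_def ennreal_power[OF g(2)]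
    by (subst nn_integral_forward[symmetric], measurable, unfold fw, rule law_of_integral[symmetric, where B="B\<^sup>2"]) (use QB P0 in auto)
  have em: "(\<integral>\<^sup>+y. ennreal (g y) * ennreal (\<pi>Y y) \<partial>lborel) = ennreal m"
    unfolding m_def
    by (subst nn_integral_forward[symmetric], measurable, unfold fw, rule law_of_integral[symmetric, where B=B]) (use PB P0 in auto)
  have S0: "0 \<le> S" unfolding S_def by (intro Bochner_Integration.integral_nonneg) simp
  have m0: "0 \<le> m" unfolding m_def by (intro Bochner_Integration.integral_nonneg P0)
  have A0: "0 \<le> A" unfolding A_def by (intro Bochner_Integration.integral_nonneg P0)
  have "ennreal (1 + \<eta> / C) * ennreal S = ennreal ((1 + \<eta> / C) * S)"
    using C \<eta> by (simp add: ennreal_mult S0)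
  also have "\<dots> \<le> ennreal (A + \<eta> / C * m\<^sup>2)" using main by (rule ennreal_leI)
  also have "\<dots> = ennreal A + ennreal (\<eta> / C) * (ennreal m)\<^sup>2"
  proof -
    have q: "0 \<le> \<eta> / C" using C \<eta> by simp
    have "ennreal (A + \<eta> / C * m\<^sup>2) = ennreal A + ennreal (\<eta> / C * m\<^sup>2)"
      by (intro ennreal_plus A0 mult_nonneg_nonneg q zero_le_power2)
    then show ?thesis by (simp only: ennreal_mult[OF q zero_le_power2] ennreal_power[OF m0])
  qed
  finally show ?thesis unfolding eS eA em .
qed

text \<open>\<open>g n\<close> cuts \<open>G\<close> off at height \<open>n\<close> and outside the
  ball of radius \<open>n\<close>; it is bounded, integrable and increases to \<open>G\<close>. The
  left side passes to the limit by Fatou, and the right side is monotone in \<open>G\<close> because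
  no mean is subtracted.\<close>

lemma forward_contraction:
  assumes fp: "fractional_poincare \<alpha> \<pi>X C" and G[measurable]: "G \<in> borel_measurable borel"
  shows "ennreal (1 + \<eta> / C) * (\<integral>\<^sup>+x. (forward G x)\<^sup>2 * ennreal (\<pi>X x) \<partial>lborel)
     \<le> (\<integral>\<^sup>+y. (G y)\<^sup>2 * ennreal (\<pi>Y y) \<partial>lborel) + ennreal (\<eta> / C) * (\<integral>\<^sup>+y. G y * ennreal (\<pi>Y y) \<partial>lborel)\<^sup>2" (is "_ \<le> ?R")
proof -
  define g where "g n y = enn2real (min (G y) (of_nat n)) * indicator (cball 0 (real n)) y" for n y
  have [measurable]: "cball 0 (real n) \<in> sets (borel :: 'a measure)" for n by simp
  have [measurable]: "g n \<in> borel_measurable borel" for n unfolding g_def by measurable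
  have ge: "ennreal (g n y) = min (G y) (of_nat n) * indicator (cball 0 (real n)) y" for n y
    unfolding g_def by (auto simp: indicator_def min_less_iff_disj of_nat_less_top intro!: ennreal_enn2real)
  have gG: "ennreal (g n y) \<le> G y" for n y unfolding ge by (auto simp: indicator_def)
  have g0: "0 \<le> g n y" for n y by (simp add: g_def)
  have gn: "g n y \<le> real n" for n y
  proof -
    have "ennreal (g n y) \<le> ennreal (real n)" unfolding ge by (auto simp: indicator_def ennreal_of_nat_eq_real_of_nat)
    then show ?thesis by (simp add: ennreal_le_iff)
  qed
  have gint: "integrable lborel (g n)" for n
  proof (rule Bochner_Integration.integrable_bound)
    show "integrable lborel (\<lambda>y::'a. real n * indicator (cball 0 (real n)) y)"
      by (intro integrable_mult_right integrable_real_indicator) (auto intro: emeasure_lborel_cball_finite[unfolded infinity_ennreal_def])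
    show "AE y in lborel. norm (g n y) \<le> norm (real n * indicator (cball 0 (real n)) y)"
    proof (intro AE_I2)
      fix y show "norm (g n y) \<le> norm (real n * indicator (cball 0 (real n)) y)"
        by (cases "y \<in> cball 0 (real n)") (use gn[of n y] g0[of n y] in simp, simp add: g_def)
    qed
  qed measurable
  have ginc: "incseq (\<lambda>n. ennreal (g n y))" for y
    unfolding ge by (rule monoI) (auto simp: indicator_def intro: min.mono order_trans[OF min.cobounded1] intro!: min.coboundedI2)
  have glim: "(\<lambda>n. ennreal (g n y)) \<longlonglongrightarrow> G y" for y
  proof -
    have "\<forall>\<^sub>F n in sequentially. ennreal (g n y) = min (G y) (of_nat n)"
      unfolding ge using eventually_ge_at_top[of "nat \<lceil>norm y\<rceil>"]
      by eventually_elim (auto simp: indicator_def nat_le_iff ceiling_le_iff)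
    moreover have "(\<lambda>n. min (G y) (of_nat n)) \<longlonglongrightarrow> min (G y) \<infinity>"
      by (intro tendsto_min tendsto_const) (use of_nat_tendsto_top_ennreal in simp)
    ultimately show ?thesis by (simp add: tendsto_cong)
  qed
  have flim: "(\<lambda>n. forward (\<lambda>y. ennreal (g n y)) x) \<longlonglongrightarrow> forward G x" for x
    unfolding forward_def
  proof (rule nn_integral_LIMSEQ)
    show "incseq (\<lambda>n y. ennreal (g n y) * ennreal (p (y - x)))"
      using ginc by (intro monoI le_funI mult_right_mono) (auto simp: incseq_def)
    show "(\<lambda>n. ennreal (g n y) * ennreal (p (y - x))) \<longlonglongrightarrow> G y * ennreal (p (y - x))" for y
    \<comment> \<open>Multiplication on \<open>ennreal\<close> is not continuous at
      \<open>\<infinity> * 0\<close>, so the factor 0 is treated apart.\<close>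
    proof (cases "ennreal (p (y - x)) = 0")
      case False
      then show ?thesis by (intro tendsto_mult_ennreal glim tendsto_const) auto
    qed (simp only: mult_zero_right tendsto_const)
  qed measurable
  have f2lim: "(\<lambda>n. (forward (\<lambda>y. ennreal (g n y)) x)\<^sup>2) \<longlonglongrightarrow> (forward G x)\<^sup>2" for x
    unfolding power2_eq_square by (intro tendsto_mult_ennreal flim) auto
  have "(\<integral>\<^sup>+x. (forward G x)\<^sup>2 * ennreal (\<pi>X x) \<partial>lborel) = (\<integral>\<^sup>+x. liminf (\<lambda>n. (forward (\<lambda>y. ennreal (g n y)) x)\<^sup>2 * ennreal (\<pi>X x)) \<partial>lborel)"
  proof (intro nn_integral_cong)
    fix x
    have "(\<lambda>n. (forward (\<lambda>y. ennreal (g n y)) x)\<^sup>2 * ennreal (\<pi>X x)) \<longlonglongrightarrow> (forward G x)\<^sup>2 * ennreal (\<pi>X x)"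
    proof (cases "ennreal (\<pi>X x) = 0")
      case False
      then show ?thesis by (intro tendsto_mult_ennreal f2lim tendsto_const) auto
    qed (simp only: mult_zero_right tendsto_const)
    then show "(forward G x)\<^sup>2 * ennreal (\<pi>X x) = liminf (\<lambda>n. (forward (\<lambda>y. ennreal (g n y)) x)\<^sup>2 * ennreal (\<pi>X x))"
      by (simp add: lim_imp_Liminf)
  qed
  also have "\<dots> \<le> liminf (\<lambda>n. \<integral>\<^sup>+x. (forward (\<lambda>y. ennreal (g n y)) x)\<^sup>2 * ennreal (\<pi>X x) \<partial>lborel)"
    by (rule nn_integral_liminf) measurable
  also have "\<dots> \<le> liminf (\<lambda>n. ennreal (1 / (1 + \<eta> / C)) * ?R)"
  proof (intro Liminf_mono always_eventually allI)
    fix n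
    have c: "1 + \<eta> / C > 0" using fp \<eta> by (auto simp: fractional_poincare_def intro!: add_pos_pos)
    have "ennreal (1 + \<eta> / C) * (\<integral>\<^sup>+x. (forward (\<lambda>y. ennreal (g n y)) x)\<^sup>2 * ennreal (\<pi>X x) \<partial>lborel)
       \<le> (\<integral>\<^sup>+y. (ennreal (g n y))\<^sup>2 * ennreal (\<pi>Y y) \<partial>lborel) + ennreal (\<eta> / C) * (\<integral>\<^sup>+y. ennreal (g n y) * ennreal (\<pi>Y y) \<partial>lborel)\<^sup>2"
      by (rule forward_contraction_bounded[OF fp gint g0 gn]) simp
    also have "\<dots> \<le> ?R"
      by (intro add_mono nn_integral_mono mult_mono power_mono mult_left_mono gG) auto
    finally have "ennreal (1 / (1 + \<eta> / C)) * (ennreal (1 + \<eta> / C) * (\<integral>\<^sup>+x. (forward (\<lambda>y. ennreal (g n y)) x)\<^sup>2 * ennreal (\<pi>X x) \<partial>lborel)) \<le> ennreal (1 / (1 + \<eta> / C)) * ?R"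
      by (intro mult_left_mono) auto
    moreover have "ennreal (1 / (1 + \<eta> / C)) * ennreal (1 + \<eta> / C) = 1"
      using c by (simp add: ennreal_mult[symmetric])
    ultimately show "(\<integral>\<^sup>+x. (forward (\<lambda>y. ennreal (g n y)) x)\<^sup>2 * ennreal (\<pi>X x) \<partial>lborel) \<le> ennreal (1 / (1 + \<eta> / C)) * ?R"
      by (simp add: mult.assoc[symmetric])
  qed
  also have "\<dots> = ennreal (1 / (1 + \<eta> / C)) * ?R" by (simp add: Liminf_const)
  finally have "ennreal (1 + \<eta> / C) * (\<integral>\<^sup>+x. (forward G x)\<^sup>2 * ennreal (\<pi>X x) \<partial>lborel) \<le> ennreal (1 + \<eta> / C) * (ennreal (1 / (1 + \<eta> / C)) * ?R)"
    by (intro mult_left_mono) auto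
  moreover have "ennreal (1 + \<eta> / C) * ennreal (1 / (1 + \<eta> / C)) = 1"
  proof -
    have "1 + \<eta> / C > 0" using fp \<eta> by (auto simp: fractional_poincare_def intro!: add_pos_pos)
    then show ?thesis by (simp add: ennreal_mult[symmetric])
  qed
  ultimately show ?thesis by (simp add: mult.assoc[symmetric])
qed

end

section \<open>Convergence\<close>

context stable_proximal
begin

text \<open>The set where \<open>\<pi>X\<close> vanishes is null for the target, hence for
  \<open>\<rho>0\<close>; so the value 0 of the quotient there is right almost everywhere.\<close>

lemma absolutely_continuous_density:
  fixes \<rho>0 :: "'a \<Rightarrow> real"
  assumes \<rho>: "prob_density \<rho>0" and ac: "absolutely_continuous (law_of \<pi>X) (law_of \<rho>0)"
  shows "AE x in lborel. ennreal (\<rho>0 x) = ennreal (\<pi>X x) * ennreal (\<rho>0 x / \<pi>X x)"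
proof -
  have [measurable]: "\<rho>0 \<in> borel_measurable borel" using \<rho> by (simp add: prob_density_def)
  let ?Z = "{x. \<pi>X x = 0}"
  have [measurable]: "?Z \<in> sets borel" by measurable
  have "emeasure (law_of \<pi>X) ?Z = (\<integral>\<^sup>+x. 0 \<partial>(lborel :: 'a measure))"
  proof -
    have "(\<integral>\<^sup>+x. ennreal (\<pi>X x) * indicator ?Z x \<partial>lborel) = (\<integral>\<^sup>+x. 0 \<partial>(lborel :: 'a measure))"
      by (intro nn_integral_cong) (auto simp: indicator_def)
    moreover have "emeasure (law_of \<pi>X) ?Z = (\<integral>\<^sup>+x. ennreal (\<pi>X x) * indicator ?Z x \<partial>lborel)"
      unfolding law_of_def by (rule emeasure_density) measurable
    ultimately show ?thesis by (simp only:)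
  qed
  then have "?Z \<in> null_sets (law_of \<pi>X)" by (auto simp: null_sets_def law_of_def)
  then have "?Z \<in> null_sets (law_of \<rho>0)" using ac by (auto simp: absolutely_continuous_def)
  then have "(\<integral>\<^sup>+x. ennreal (\<rho>0 x) * indicator ?Z x \<partial>lborel) = 0"
    by (simp add: null_sets_def law_of_def emeasure_density)
  then have "AE x in lborel. ennreal (\<rho>0 x) * indicator ?Z x = 0"
    by (subst (asm) nn_integral_0_iff_AE) auto
  then show ?thesis
  proof eventually_elim
    fix x assume *: "ennreal (\<rho>0 x) * indicator ?Z x = 0"
    show "ennreal (\<rho>0 x) = ennreal (\<pi>X x) * ennreal (\<rho>0 x / \<pi>X x)"
    proof (cases "\<pi>X x = 0")
      case True
      with * show ?thesis by simp
    next
      case False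
      then show ?thesis using \<pi>_nonneg[of x] by (simp add: ennreal_mult'[symmetric])
    qed
  qed
qed

text \<open>Subtraction in \<open>ennreal\<close> is avoided by integrating
  \<open>(f - 1)\<^sup>2 + 2 * f = f\<^sup>2 + 1\<close> and cancelling a finite 1 at the
  end.\<close>

lemma chi_square_second_moment:
  fixes \<rho>0 :: "'a \<Rightarrow> real"
  assumes \<rho>: "prob_density \<rho>0" and ac: "absolutely_continuous (law_of \<pi>X) (law_of \<rho>0)"
  shows "chi_square \<rho>0 \<pi>X + 1 = (\<integral>\<^sup>+x. (ennreal (\<rho>0 x / \<pi>X x))\<^sup>2 * ennreal (\<pi>X x) \<partial>lborel)"
    and "(\<integral>\<^sup>+x. ennreal (\<rho>0 x / \<pi>X x) * ennreal (\<pi>X x) \<partial>lborel) = 1"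
proof -
  have [measurable]: "\<rho>0 \<in> borel_measurable borel" and \<rho>0: "\<And>x. 0 \<le> \<rho>0 x" using \<rho> by (auto simp: prob_density_def)
  let ?f = "\<lambda>x. \<rho>0 x / \<pi>X x"
  have f: "0 \<le> ?f x" for x using \<rho>0 \<pi>_nonneg by simp
  have "(\<integral>\<^sup>+x. ennreal (?f x) * ennreal (\<pi>X x) \<partial>lborel) = (\<integral>\<^sup>+x. ennreal (\<rho>0 x) \<partial>lborel)"
    by (intro nn_integral_cong_AE) (use absolutely_continuous_density[OF assms] in \<open>auto elim!: eventually_mono simp: mult.commute\<close>)
  then show m: "(\<integral>\<^sup>+x. ennreal (?f x) * ennreal (\<pi>X x) \<partial>lborel) = 1" using \<rho> by (simp add: prob_density_def)
  have "chi_square \<rho>0 \<pi>X + 2 * 1 = (\<integral>\<^sup>+x. ennreal ((?f x - 1)\<^sup>2 * \<pi>X x) \<partial>lborel) + (\<integral>\<^sup>+x. 2 * (ennreal (?f x) * ennreal (\<pi>X x)) \<partial>lborel)"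
    using ac by (simp add: chi_square_def nn_integral_cmult m)
  also have "\<dots> = (\<integral>\<^sup>+x. ennreal ((?f x - 1)\<^sup>2 * \<pi>X x) + 2 * (ennreal (?f x) * ennreal (\<pi>X x)) \<partial>lborel)"
    by (rule nn_integral_add[symmetric]) auto
  also have "\<dots> = (\<integral>\<^sup>+x. (ennreal (?f x))\<^sup>2 * ennreal (\<pi>X x) + ennreal (\<pi>X x) \<partial>lborel)"
  proof (intro nn_integral_cong)
    fix x
    have "ennreal ((?f x - 1)\<^sup>2 * \<pi>X x) + 2 * (ennreal (?f x) * ennreal (\<pi>X x)) = ennreal ((?f x - 1)\<^sup>2 * \<pi>X x) + ennreal (2 * (?f x * \<pi>X x))"
    proof -
      have "ennreal (2 * (a * b)) = 2 * (ennreal a * ennreal b)" if "0 \<le> a" "0 \<le> b" for a b :: real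
        using that by (simp add: ennreal_mult)
      from this[OF f[of x] \<pi>_nonneg[of x]] show ?thesis by (simp only:)
    qed
    also have "\<dots> = ennreal ((?f x - 1)\<^sup>2 * \<pi>X x + 2 * (?f x * \<pi>X x))"
      using \<rho>0[of x] \<pi>_nonneg[of x] by (intro ennreal_plus[symmetric]) auto
    also have "(?f x - 1)\<^sup>2 * \<pi>X x + 2 * (?f x * \<pi>X x) = (?f x)\<^sup>2 * \<pi>X x + \<pi>X x"
      by (simp only: power2_eq_square) (simp only: algebra_simps, simp)
    also have "ennreal ((?f x)\<^sup>2 * \<pi>X x + \<pi>X x) = (ennreal (?f x))\<^sup>2 * ennreal (\<pi>X x) + ennreal (\<pi>X x)"
      using f[of x] \<pi>_nonneg[of x] \<rho>0[of x] by (subst ennreal_plus) (auto simp: ennreal_mult ennreal_power simp del: divide_eq_0_iff)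
    finally show "ennreal ((?f x - 1)\<^sup>2 * \<pi>X x) + 2 * (ennreal (?f x) * ennreal (\<pi>X x)) = (ennreal (?f x))\<^sup>2 * ennreal (\<pi>X x) + ennreal (\<pi>X x)" .
  qed
  also have "\<dots> = (\<integral>\<^sup>+x. (ennreal (?f x))\<^sup>2 * ennreal (\<pi>X x) \<partial>lborel) + 1"
    by (subst nn_integral_add) (auto simp: nn_integral_\<pi>)
  finally have "1 + (chi_square \<rho>0 \<pi>X + 1) = 1 + (\<integral>\<^sup>+x. (ennreal (?f x))\<^sup>2 * ennreal (\<pi>X x) \<partial>lborel)"
    by (simp add: ac_simps numeral_2_eq_2 flip: one_add_one)
  then show "chi_square \<rho>0 \<pi>X + 1 = (\<integral>\<^sup>+x. (ennreal (?f x))\<^sup>2 * ennreal (\<pi>X x) \<partial>lborel)"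
    by (subst (asm) ennreal_add_left_cancel) auto
qed

text \<open>\<open>s\<close> is the chi-square divergence of the iterate, carried as the second
  moment \<open>1 + s\<close> so that \<open>F\<close> may be infinite on a null set. With
  \<open>r = \<eta> / C\<close>, one iteration gives \<open>(1 + r) * S' \<le> 1 + s + r\<close> for
  the new second moment, that is \<open>S' - 1 \<le> s / (1 + r)\<close>.\<close>

lemma exact_relative_density:
  fixes \<rho>0 :: "'a \<Rightarrow> real"
  assumes \<rho>: "prob_density \<rho>0" and ac: "absolutely_continuous (law_of \<pi>X) (law_of \<rho>0)"
    and fp: "fractional_poincare \<alpha> \<pi>X C" and chi: "chi_square \<rho>0 \<pi>X = ennreal c" "0 \<le> c"
  shows "\<exists>F s. F \<in> borel_measurable borel
       \<and> sampler_law \<alpha> \<eta> (\<lambda>_. restricted_stable_oracle \<alpha> \<eta> \<pi>X) \<rho>0 k = density lborel (\<lambda>x. ennreal (\<pi>X x) * F x)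
       \<and> (\<integral>\<^sup>+x. F x * ennreal (\<pi>X x) \<partial>lborel) = 1
       \<and> (\<integral>\<^sup>+x. (F x)\<^sup>2 * ennreal (\<pi>X x) \<partial>lborel) = ennreal (1 + s) \<and> 0 \<le> 1 + s \<and> s \<le> c / (1 + \<eta> / C) ^ k"
proof (induction k)
  case 0
  have [measurable]: "\<rho>0 \<in> borel_measurable borel" using \<rho> by (simp add: prob_density_def)
  have "law_of \<rho>0 = density lborel (\<lambda>x. ennreal (\<pi>X x) * ennreal (\<rho>0 x / \<pi>X x))"
    unfolding law_of_def by (rule density_cong) (use absolutely_continuous_density[OF \<rho> ac] in auto)
  then show ?case
    using chi_square_second_moment[OF \<rho> ac] chi
    by (intro exI[of _ "\<lambda>x. ennreal (\<rho>0 x / \<pi>X x)"] exI[of _ c]) (auto simp: add.commute)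
next
  case (Suc k)
  then obtain F s where [measurable]: "F \<in> borel_measurable borel"
    and law: "sampler_law \<alpha> \<eta> (\<lambda>_. restricted_stable_oracle \<alpha> \<eta> \<pi>X) \<rho>0 k = density lborel (\<lambda>x. ennreal (\<pi>X x) * F x)"
    and m: "(\<integral>\<^sup>+x. F x * ennreal (\<pi>X x) \<partial>lborel) = 1"
    and S: "(\<integral>\<^sup>+x. (F x)\<^sup>2 * ennreal (\<pi>X x) \<partial>lborel) = ennreal (1 + s)" and s: "0 \<le> 1 + s" "s \<le> c / (1 + \<eta> / C) ^ k"
    by blast
  have C: "C > 0" using fp by (simp add: fractional_poincare_def)
  define r where "r = \<eta> / C"
  have r: "r > 0" using C \<eta> by (simp add: r_def)
  let ?F = "forward (backward F)"
  let ?S = "\<integral>\<^sup>+x. (?F x)\<^sup>2 * ennreal (\<pi>X x) \<partial>lborel"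
  have law': "sampler_law \<alpha> \<eta> (\<lambda>_. restricted_stable_oracle \<alpha> \<eta> \<pi>X) \<rho>0 (Suc k) = density lborel (\<lambda>x. ennreal (\<pi>X x) * ?F x)"
    unfolding sampler_law.simps law by (rule exact_step) measurable
  have mb: "(\<integral>\<^sup>+y. backward F y * ennreal (\<pi>Y y) \<partial>lborel) = 1"
    using nn_integral_backward[of F] m by simp
  have m': "(\<integral>\<^sup>+x. ?F x * ennreal (\<pi>X x) \<partial>lborel) = 1"
    using nn_integral_forward[of "backward F"] mb by simp
  have "ennreal (1 + r) * ?S \<le> (\<integral>\<^sup>+y. (backward F y)\<^sup>2 * ennreal (\<pi>Y y) \<partial>lborel) + ennreal r * (\<integral>\<^sup>+y. backward F y * ennreal (\<pi>Y y) \<partial>lborel)\<^sup>2"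
    unfolding r_def by (rule forward_contraction[OF fp]) measurable
  also have "\<dots> \<le> ennreal (1 + s) + ennreal r"
    unfolding mb using nn_integral_backward_power2_le[of F] by (auto simp: S intro!: add_right_mono)
  also have "\<dots> = ennreal (1 + s + r)" using s r by (intro ennreal_plus[symmetric]) auto
  finally have le: "ennreal (1 + r) * ?S \<le> ennreal (1 + s + r)" .
  have "?S < \<infinity>"
  proof -
    have "ennreal (1 + r) * ?S < \<infinity>" by (rule le_less_trans[OF le]) simp
    then show ?thesis using r by (auto simp: ennreal_mult_less_top)
  qed
  then obtain S' where S': "?S = ennreal S'" "0 \<le> S'" by (cases ?S) auto
  have "(1 + r) * S' \<le> 1 + s + r"
  proof -
    have "ennreal ((1 + r) * S') = ennreal (1 + r) * ennreal S'"
      using r S'(2) by (intro ennreal_mult) auto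
    then have "ennreal ((1 + r) * S') \<le> ennreal (1 + s + r)" using le unfolding S'(1) by (simp only:)
    then show ?thesis by (subst (asm) ennreal_le_iff) (use s r in auto)
  qed
  then have "S' - 1 \<le> s / (1 + r)" using r by (simp add: field_simps)
  also have "\<dots> \<le> (c / (1 + r) ^ k) / (1 + r)" using s(2) r unfolding r_def[symmetric] by (intro divide_right_mono) auto
  finally have "S' - 1 \<le> c / (1 + r) ^ Suc k" by (simp add: mult.commute)
  then show ?case
    using law' m' S' by (intro exI[of _ ?F] exI[of _ "S' - 1"]) (auto simp: r_def)
qed

text \<open>Centering the indicator of \<open>A\<close> at \<open>1 / 2\<close> gains the factor \<open>1 / 2\<close>, since \<open>F - 1\<close> has mean zero.\<close>

lemma tv_dist_le_second_moment:
  assumes [measurable]: "F \<in> borel_measurable borel"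
    and m: "(\<integral>\<^sup>+x. F x * ennreal (\<pi>X x) \<partial>lborel) = 1"
    and S: "(\<integral>\<^sup>+x. (F x)\<^sup>2 * ennreal (\<pi>X x) \<partial>lborel) = ennreal (1 + s)" "0 \<le> 1 + s" and s: "s \<le> \<epsilon>\<^sup>2" and \<epsilon>: "0 \<le> \<epsilon>"
  shows "tv_dist (density lborel (\<lambda>x. ennreal (\<pi>X x) * F x)) (law_of \<pi>X) \<le> \<epsilon> / 2"
proof (rule tv_dist_least)
  interpret P: prob_space "law_of \<pi>X" by (rule prob_law_of)
  have [measurable_cong]: "sets (law_of \<pi>X) = sets borel" by (simp add: law_of_def)
  fix A :: "'a set" assume A[measurable]: "A \<in> sets borel"
  have nn: "(\<integral>\<^sup>+x. h x \<partial>law_of \<pi>X) = (\<integral>\<^sup>+x. h x * ennreal (\<pi>X x) \<partial>lborel)" if [measurable]: "h \<in> borel_measurable borel" for h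
    unfolding law_of_def by (subst nn_integral_density) (auto simp: mult.commute)
  define f where "f x = enn2real (F x)" for x
  have [measurable]: "f \<in> borel_measurable borel" unfolding f_def by measurable
  have f0: "0 \<le> f x" for x by (simp add: f_def)
  have mP: "(\<integral>\<^sup>+x. F x \<partial>law_of \<pi>X) = 1" using m by (simp add: nn)
  \<comment> \<open>A finite mean makes \<open>F\<close> finite almost everywhere, so passing to the
    real function \<open>f\<close> changes no integral.\<close>
  have "AE x in law_of \<pi>X. F x \<noteq> \<infinity>"
    by (rule nn_integral_noteq_infinite) (use mP in auto)
  then have ae: "AE x in law_of \<pi>X. ennreal (f x) = F x"
    by eventually_elim (simp add: f_def less_top)
  have mf: "(\<integral>\<^sup>+x. ennreal (f x) \<partial>law_of \<pi>X) = 1"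
    unfolding mP[symmetric] by (rule nn_integral_cong_AE) (rule ae)
  have Sf: "(\<integral>\<^sup>+x. ennreal ((f x)\<^sup>2) \<partial>law_of \<pi>X) = ennreal (1 + s)"
  proof -
    have "(\<integral>\<^sup>+x. ennreal ((f x)\<^sup>2) \<partial>law_of \<pi>X) = (\<integral>\<^sup>+x. (F x)\<^sup>2 \<partial>law_of \<pi>X)"
      by (rule nn_integral_cong_AE) (use ae in \<open>auto elim!: eventually_mono simp: ennreal_power[symmetric] f0\<close>)
    then show ?thesis using S by (simp add: nn)
  qed
  have f: "has_bochner_integral (law_of \<pi>X) f 1"
    by (rule has_bochner_integral_nn_integral) (use mf f0 in auto)
  have f2: "has_bochner_integral (law_of \<pi>X) (\<lambda>x. (f x)\<^sup>2) (1 + s)"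
    by (rule has_bochner_integral_nn_integral) (use Sf S in auto)
  have if1: "integrable (law_of \<pi>X) f" and if2: "integrable (law_of \<pi>X) (\<lambda>x. (f x)\<^sup>2)"
    and f1: "(\<integral>x. f x \<partial>law_of \<pi>X) = 1" and ff: "(\<integral>x. (f x)\<^sup>2 \<partial>law_of \<pi>X) = 1 + s"
    using f f2 by (auto simp: has_bochner_integral_iff)
  let ?i = "\<lambda>x. indicator A x :: real"
  have ifA: "integrable (law_of \<pi>X) (\<lambda>x. f x * ?i x)"
    by (rule integrable_real_mult_indicator) (use if1 in auto)
  have iA: "integrable (law_of \<pi>X) ?i" by (rule P.integrable_const_bound[where B=1]) auto
  have "emeasure (density lborel (\<lambda>x. ennreal (\<pi>X x) * F x)) A = (\<integral>\<^sup>+x. F x * indicator A x \<partial>law_of \<pi>X)"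
    by (subst nn) (auto simp: emeasure_density mult_ac)
  also have "\<dots> = (\<integral>\<^sup>+x. ennreal (f x * ?i x) \<partial>law_of \<pi>X)"
    by (rule nn_integral_cong_AE) (use ae in \<open>auto elim!: eventually_mono simp: indicator_def\<close>)
  also have "\<dots> = ennreal (\<integral>x. f x * ?i x \<partial>law_of \<pi>X)"
    by (rule nn_integral_eq_integral[OF ifA]) (simp add: f0)
  finally have MA: "measure (density lborel (\<lambda>x. ennreal (\<pi>X x) * F x)) A = (\<integral>x. f x * ?i x \<partial>law_of \<pi>X)"
    unfolding measure_def by (simp add: Bochner_Integration.integral_nonneg f0)
  have PA: "measure (law_of \<pi>X) A = (\<integral>x. ?i x \<partial>law_of \<pi>X)" by simp
  have ih: "integrable (law_of \<pi>X) (\<lambda>x. f x - 1)" using if1 by simp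
  have ih2: "integrable (law_of \<pi>X) (\<lambda>x. (f x - 1)\<^sup>2)"
  proof -
    have "(\<lambda>x. (f x - 1)\<^sup>2) = (\<lambda>x. (f x)\<^sup>2 - 2 * f x + 1)" by (simp add: fun_eq_iff power2_eq_square algebra_simps)
    then show ?thesis using if1 if2 by simp
  qed
  have h2: "(\<integral>x. (f x - 1)\<^sup>2 \<partial>law_of \<pi>X) = s"
    using P.variance_eq[OF if1 if2] by (simp add: f1 ff)
  have "measure (density lborel (\<lambda>x. ennreal (\<pi>X x) * F x)) A - measure (law_of \<pi>X) A = (\<integral>x. (f x - 1) * (?i x - 1 / 2) \<partial>law_of \<pi>X)"
  proof -
    have "(\<lambda>x. (f x - 1) * (?i x - 1 / 2)) = (\<lambda>x. (f x * ?i x - ?i x) - (f x - 1) / 2)" by (simp add: fun_eq_iff field_simps)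
    then have "(\<integral>x. (f x - 1) * (?i x - 1 / 2) \<partial>law_of \<pi>X) = ((\<integral>x. f x * ?i x \<partial>law_of \<pi>X) - (\<integral>x. ?i x \<partial>law_of \<pi>X)) - ((\<integral>x. f x \<partial>law_of \<pi>X) - 1) / 2"
      using ifA iA if1 by (simp add: P.prob_space)
    then show ?thesis unfolding MA PA by (simp add: f1)
  qed
  also have "\<bar>\<dots>\<bar> \<le> (\<integral>x. \<bar>(f x - 1) * (?i x - 1 / 2)\<bar> \<partial>law_of \<pi>X)" by (rule integral_abs_bound)
  also have "\<dots> = (\<integral>x. \<bar>f x - 1\<bar> / 2 \<partial>law_of \<pi>X)"
    by (intro Bochner_Integration.integral_cong) (auto simp: indicator_def abs_mult)
  also have "\<dots> = (\<integral>x. \<bar>f x - 1\<bar> \<partial>law_of \<pi>X) / 2" by simp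
  also have "\<dots> \<le> \<epsilon> / 2"
  proof -
    \<comment> \<open>Cauchy-Schwarz, read off from the nonnegative variance of
      \<open>\<bar>f x - 1\<bar>\<close>.\<close>
    have "(\<integral>x. \<bar>f x - 1\<bar> \<partial>law_of \<pi>X)\<^sup>2 \<le> s"
      using P.variance_positive[of "\<lambda>x. \<bar>f x - 1\<bar>"] P.variance_eq[of "\<lambda>x. \<bar>f x - 1\<bar>"] ih ih2 h2 by simp
    also have "\<dots> \<le> \<epsilon>\<^sup>2" by (rule s)
    finally have "(\<integral>x. \<bar>f x - 1\<bar> \<partial>law_of \<pi>X) \<le> \<epsilon>" using \<epsilon> by (rule power2_le_imp_le)
    then show ?thesis by simp
  qed
  finally show "\<bar>measure (density lborel (\<lambda>x. ennreal (\<pi>X x) * F x)) A - measure (law_of \<pi>X) A\<bar> \<le> \<epsilon> / 2" .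
qed

text \<open>\<open>ln y \<le> y - 1\<close> at \<open>y = 1 / (1 + r)\<close> gives
  \<open>ln (1 + r) \<ge> 1 / (1 + 1 / r)\<close>, so the hypothesis on \<open>K\<close> yields
  \<open>K * ln (1 + r) \<ge> ln (x / \<epsilon>\<^sup>2)\<close>. For \<open>x = 0\<close> the
  logarithm is \<open>- \<infinity>\<close> and the claim is immediate.\<close>

lemma exponential_decay:
  fixes x r \<epsilon> :: real and K :: nat
  assumes x: "0 \<le> x" and r: "0 < r" and \<epsilon>: "0 < \<epsilon>"
    and K: "ereal (1 + 1 / r) * ln_ext (ennreal x / ennreal (\<epsilon>\<^sup>2)) \<le> ereal (real K)"
  shows "x / (1 + r) ^ K \<le> \<epsilon>\<^sup>2"
proof (cases "x = 0")
  case False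
  with x have x: "x > 0" by simp
  have "ennreal x / ennreal (\<epsilon>\<^sup>2) = ennreal (x / \<epsilon>\<^sup>2)"
    using x \<epsilon> by (intro divide_ennreal) auto
  then have "ln_ext (ennreal x / ennreal (\<epsilon>\<^sup>2)) = ereal (ln (x / \<epsilon>\<^sup>2))"
    using x \<epsilon> by (auto simp: ln_ext_def)
  with K have le: "(1 + 1 / r) * ln (x / \<epsilon>\<^sup>2) \<le> real K" by simp
  have ln: "1 / (1 + 1 / r) \<le> ln (1 + r)"
  proof -
    have "ln (1 / (1 + r)) \<le> 1 / (1 + r) - 1" using r by (intro ln_le_minus_one) auto
    moreover have "ln (1 / (1 + r)) = - ln (1 + r)" using r by (simp add: ln_div)
    moreover have "1 - 1 / (1 + r) = 1 / (1 + 1 / r)" using r by (simp add: field_simps)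
    ultimately show ?thesis by linarith
  qed
  have "ln (x / \<epsilon>\<^sup>2) \<le> real K * (1 / (1 + 1 / r))"
    using le r by (simp add: pos_le_divide_eq mult.commute add_pos_pos)
  also have "\<dots> \<le> real K * ln (1 + r)" by (intro mult_left_mono ln) simp
  also have "\<dots> = ln ((1 + r) ^ K)" using r by (simp add: ln_realpow)
  finally have "x / \<epsilon>\<^sup>2 \<le> (1 + r) ^ K"
    using x r \<epsilon> by (subst (asm) ln_le_cancel_iff) auto
  then show ?thesis using r \<epsilon> by (simp add: divide_le_eq mult.commute)
qed simp

text \<open>A natural number above the threshold forces the initial divergence to be finite, since
  \<open>ln_ext\<close> would otherwise be \<open>\<infinity>\<close>; the guard in
  \<open>chi_square\<close> then gives absolute continuity, and the decay lemmas apply.\<close>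

lemma exact_tv_dist_target:
  fixes \<rho>0 :: "'a \<Rightarrow> real"
  assumes \<rho>: "prob_density \<rho>0" and fp: "fractional_poincare \<alpha> \<pi>X C" and \<epsilon>: "0 < \<epsilon>"
    and K: "ereal (1 + C * inverse \<eta>) * ln_ext (chi_square \<rho>0 \<pi>X / ennreal (\<epsilon>\<^sup>2)) \<le> ereal (real K)"
  shows "tv_dist (sampler_law \<alpha> \<eta> (\<lambda>_. restricted_stable_oracle \<alpha> \<eta> \<pi>X) \<rho>0 K) (law_of \<pi>X) \<le> \<epsilon> / 2"
proof -
  have C: "C > 0" using fp by (simp add: fractional_poincare_def)
  have q: "1 + C * inverse \<eta> > 0" using C \<eta> by (intro add_pos_pos) auto
  have fin: "chi_square \<rho>0 \<pi>X \<noteq> \<infinity>"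
  proof
    assume "chi_square \<rho>0 \<pi>X = \<infinity>"
    then have "ln_ext (chi_square \<rho>0 \<pi>X / ennreal (\<epsilon>\<^sup>2)) = \<infinity>"
      by (simp add: ln_ext_def ennreal_top_divide)
    with K q show False by simp
  qed
  then have ac: "absolutely_continuous (law_of \<pi>X) (law_of \<rho>0)"
    unfolding chi_square_def by (auto split: if_splits)
  from fin obtain c where c: "chi_square \<rho>0 \<pi>X = ennreal c" "0 \<le> c" by (cases "chi_square \<rho>0 \<pi>X") auto
  obtain F s where F: "F \<in> borel_measurable borel"
    and law: "sampler_law \<alpha> \<eta> (\<lambda>_. restricted_stable_oracle \<alpha> \<eta> \<pi>X) \<rho>0 K = density lborel (\<lambda>x. ennreal (\<pi>X x) * F x)"
    and m: "(\<integral>\<^sup>+x. F x * ennreal (\<pi>X x) \<partial>lborel) = 1"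
    and S: "(\<integral>\<^sup>+x. (F x)\<^sup>2 * ennreal (\<pi>X x) \<partial>lborel) = ennreal (1 + s)" "0 \<le> 1 + s" and s: "s \<le> c / (1 + \<eta> / C) ^ K"
    using exact_relative_density[OF \<rho> ac fp c, of K] by blast
  have "c / (1 + \<eta> / C) ^ K \<le> \<epsilon>\<^sup>2"
  proof (rule exponential_decay[OF c(2) _ \<epsilon>])
    show "0 < \<eta> / C" using C \<eta> by simp
    show "ereal (1 + 1 / (\<eta> / C)) * ln_ext (ennreal c / ennreal (\<epsilon>\<^sup>2)) \<le> ereal (real K)"
      using K by (simp add: c divide_inverse mult.commute)
  qed
  with s have "s \<le> \<epsilon>\<^sup>2" by simp
  then show ?thesis unfolding law using \<epsilon> by (intro tv_dist_le_second_moment[OF F m S]) auto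
qed

end

theorem proposition3p1:
  fixes \<alpha> \<eta> \<epsilon>TV :: real
    and \<pi>X \<rho>0 \<rho>0' :: "'a::euclidean_space \<Rightarrow> real"
    and q :: "nat \<Rightarrow> 'a \<Rightarrow> 'a \<Rightarrow> real"
  defines "exact \<equiv> sampler_law \<alpha> \<eta> (\<lambda>_. restricted_stable_oracle \<alpha> \<eta> \<pi>X) \<rho>0"
    and "inexact \<equiv> sampler_law \<alpha> \<eta> q \<rho>0'"
  assumes "0 < \<alpha>" "\<alpha> < 2" "0 < \<eta>" "0 < \<epsilon>TV"
    and "prob_density \<pi>X" "prob_density \<rho>0" "prob_density \<rho>0'"
    and "oracle_kernel q"
    and "\<And>k y. k \<ge> 1 \<Longrightarrow>
           tv_dist (law_of (q k y)) (law_of (restricted_stable_oracle \<alpha> \<eta> \<pi>X y)) \<le> \<epsilon>TV"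
  shows "(\<forall>k. tv_dist (inexact k) (exact k) \<le> tv_dist (inexact 0) (exact 0) + real k * \<epsilon>TV) \<and>
         (\<forall>C \<epsilon> K.
            fractional_poincare \<alpha> \<pi>X C \<longrightarrow> \<rho>0' = \<rho>0 \<longrightarrow> 0 < \<epsilon> \<longrightarrow>
            ereal (1 + C * inverse \<eta>) * ln_ext (chi_square \<rho>0' \<pi>X / ennreal (\<epsilon>\<^sup>2)) \<le> ereal (real K) \<longrightarrow>
            (K = 0 \<or> \<epsilon>TV \<le> \<epsilon> / (2 * real K)) \<longrightarrow>
            tv_dist (inexact K) (law_of \<pi>X) \<le> \<epsilon>)"
proof -
  interpret stable_proximal \<alpha> \<eta> \<pi>X using assms by unfold_locales auto
  have law_sub: "borel_subprob (law_of f)" if "prob_density f" for f :: "'a \<Rightarrow> real"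
    using that by (auto simp: borel_subprob_def law_of_def prob_density_def emeasure_density intro!: subprob_spaceI)
  have qk: "(\<lambda>y. law_of (q (Suc k) y)) \<in> borel \<rightarrow>\<^sub>M subprob_algebra borel" for k
    using \<open>oracle_kernel q\<close> unfolding oracle_kernel_def by (intro measurable_prob_algebraD) auto
  have sub_ex: "borel_subprob (exact k)" for k
    unfolding exact_def
    by (induction k) (auto intro!: borel_subprob_bind transition_kernel exact_oracle_kernel law_sub assms)
  have sub_in: "borel_subprob (inexact k)" for k
    unfolding inexact_def
    by (induction k) (auto intro!: borel_subprob_bind transition_kernel qk law_sub assms)
  have part1: "tv_dist (inexact k) (exact k) \<le> tv_dist (inexact 0) (exact 0) + real k * \<epsilon>TV" for k
  proof (induction k)
    case (Suc k)
    let ?T = "\<lambda>x. law_of (stable_transition \<alpha> \<eta> x) :: 'a measure"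
    have "tv_dist (inexact (Suc k)) (exact (Suc k))
       \<le> tv_dist (Giry_Monad.bind (inexact k) ?T) (Giry_Monad.bind (exact k) ?T) + \<epsilon>TV"
      unfolding exact_def inexact_def sampler_law.simps
      unfolding exact_def[symmetric] inexact_def[symmetric]
      by (intro tv_dist_bind_le borel_subprob_bind sub_ex sub_in transition_kernel exact_oracle_kernel qk assms) simp
    \<comment> \<open>The noising kernel is the same for both chains, so it costs nothing.\<close>
    also have "tv_dist (Giry_Monad.bind (inexact k) ?T) (Giry_Monad.bind (exact k) ?T) \<le> tv_dist (inexact k) (exact k) + 0"
      by (intro tv_dist_bind_le sub_ex sub_in transition_kernel tv_dist_self)
    finally show ?case using Suc.IH by (simp add: algebra_simps)
  qed simp
  moreover have "tv_dist (inexact K) (law_of \<pi>X) \<le> \<epsilon>"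
    if fp: "fractional_poincare \<alpha> \<pi>X C" and "\<rho>0' = \<rho>0" and \<epsilon>: "0 < \<epsilon>"
      and K: "ereal (1 + C * inverse \<eta>) * ln_ext (chi_square \<rho>0' \<pi>X / ennreal (\<epsilon>\<^sup>2)) \<le> ereal (real K)"
      and \<epsilon>TV: "K = 0 \<or> \<epsilon>TV \<le> \<epsilon> / (2 * real K)" for C \<epsilon> K
  proof -
    have "tv_dist (inexact 0) (exact 0) \<le> 0"
      unfolding exact_def inexact_def \<open>\<rho>0' = \<rho>0\<close> by (simp add: tv_dist_self)
    \<comment> \<open>For \<open>K = 0\<close> the quotient \<open>\<epsilon> / (2 * real K)\<close>
      would be 0, below the positive \<open>\<epsilon>TV\<close>; that case has its own disjunct,
      and the left side is then 0.\<close>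
    moreover have "real K * \<epsilon>TV \<le> \<epsilon> / 2"
      using \<epsilon>TV \<epsilon> by (cases "K = 0") (auto simp: field_simps)
    moreover have "tv_dist (exact K) (law_of \<pi>X) \<le> \<epsilon> / 2"
      unfolding exact_def using K \<open>\<rho>0' = \<rho>0\<close> by (intro exact_tv_dist_target[OF assms(8) fp \<epsilon>]) simp
    moreover have "tv_dist (inexact K) (law_of \<pi>X) \<le> tv_dist (inexact K) (exact K) + tv_dist (exact K) (law_of \<pi>X)"
      by (intro tv_dist_triangle sub_ex sub_in law_sub assms)
    ultimately show ?thesis using part1[of K] by linarith
  qed
  ultimately show ?thesis by blast
qed

end
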